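(* Let $\overline{L}=f(e^{\sigma}L,\beta)$ be a generalized $\beta$-conformal change of a Finsler space $(M,L)$ of dimension $n\ge3$, and assume $\lambda\neq0$. If the tensor $$q_{ijk}:=\frac{1}{6\lambda}\mathfrak{S}_{ijk}\left\{2e^{\sigma}\lambda p\,C_{ijk}+(3e^{\sigma}p_{-1}h_{ij}+p_{02}m_im_j)(e^{\sigma}ps_0C_{k\beta\beta}-C_k)\right\}$$ vanishes, then the space $(M,\overline L)$ is quasi-C-reducible.
   Context: $(M,L)$ is an $n$-dimensional smooth Finsler manifold; $\dot\partial_i=\partial/\partial y^i$, $g_{ij}=\frac12\dot\partial_i\dot\partial_jL^2$ (indices of unbarred objects are raised with $g^{ij}$), $l_i=\dot\partial_iL$, $y_i=g_{ij}y^j$, $h_{ij}=g_{ij}-l_il_j$, $C_{ijk}=\frac12\dot\partial_kg_{ij}$, $C_i=C_{ijk}g^{jk}$. $\mathfrak S_{ijk}$ denotes the cyclic sum over $i,j,k$. A generalized $\beta$-conformal change is $L\mapsto\overline{L}=f(\widetilde L,\beta)$ with $\widetilde L=e^{\sigma(x)}L$, $\sigma$ a smooth function on $M$, $\beta=b_i(x)y^i$ a 1-form, and $f$ smooth and positively homogeneous of degree one in $(\widetilde L,\beta)$; it is assumed that $(M,\overline L)$ is a Finsler space. Barred objects are those of $(M,\overline L)$. Subscripts $1,2$ on $f$ denote partial derivatives with respect to $\widetilde L,\beta$. Put $p=ff_1/L$, $q_0=ff_{22}$, $p_0=f_2^2+q_0$, $p_{-1}=ff_{12}/L+pf_2/f$,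 $p_{02}=\partial p_0/\partial\beta$, $m_i=b_i-(\beta/L^2)y_i$, $m^2=g^{ij}m_im_j$, $b^i=g^{ij}b_j$, $C_{k\beta\beta}=C_{kij}b^ib^j$, $$s_0=\frac{e^{-\sigma}q_0}{p(e^{\sigma}p+m^2q_0)},\qquad \lambda=\frac{(n+1)p_{-1}}{2p}-\frac{3e^{\sigma}p_{-1}m^2s_0}{2}+\frac{p_{02}m^2}{2(e^{\sigma}p+q_0m^2)}.$$ Standing assumptions at the points under consideration: $m_i\ne0$, $m^2\neq0$, $p\ne0$, $e^{\sigma}p+m^2q_0\neq0$. A Finsler space $(M,L)$ of dimension $n\ge3$ is quasi-C-reducible if $C_{ijk}=Q_{ij}C_k+Q_{jk}C_i+Q_{ki}C_j$ for some symmetric indicatory tensor $Q_{ij}$ (indicatory: $Q_{ij}y^i=0$). *)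

theory Defs
  imports "HOL-Analysis.Analysis"
begin

section \<open>Smooth maps between Euclidean spaces\<close>

primrec times_differentiable_on ::
    "nat \<Rightarrow> 'a::real_normed_vector set \<Rightarrow> ('a \<Rightarrow> 'b::real_normed_vector) \<Rightarrow> bool" where
  "times_differentiable_on 0 S f \<longleftrightarrow> continuous_on S f"
| "times_differentiable_on (Suc k) S f \<longleftrightarrow>
     (\<forall>x\<in>S. f differentiable (at x)) \<and>
     (\<forall>v. times_differentiable_on k S (\<lambda>x. frechet_derivative f (at x) v))"

text \<open>Only used for open \<open>S\<close>.\<close>

definition smooth_on :: "'a::real_normed_vector set \<Rightarrow> ('a \<Rightarrow> 'b::real_normed_vector) \<Rightarrow> bool" where
  "smooth_on S f \<longleftrightarrow> (\<forall>k. times_differentiable_on k S f)"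


section \<open>Smooth manifolds and their tangent bundles\<close>

text \<open>A chart is a pair of its domain and its coordinate map.\<close>

type_synonym ('p, 'n) chart = "'p set \<times> ('p \<Rightarrow> real ^ 'n)"

definition chart_inv :: "('p, 'n) chart \<Rightarrow> real ^ 'n \<Rightarrow> 'p" where
  "chart_inv c = inv_into (fst c) (snd c)"

definition smooth_manifold :: "'p topology \<Rightarrow> ('p, 'n::finite) chart set \<Rightarrow> bool" where
  "smooth_manifold M A \<longleftrightarrow>
     Hausdorff_space M \<and> second_countable M \<and>
     (\<Union>c\<in>A. fst c) = topspace M \<and>
     (\<forall>c\<in>A. openin M (fst c) \<and> open (snd c ` fst c) \<and>
        homeomorphic_map (subtopology M (fst c)) (top_of_set (snd c ` fst c)) (snd c)) \<and>
     (\<forall>c\<in>A. \<forall>d\<in>A. smooth_on (snd c ` (fst c \<inter> fst d)) (snd d \<circ> chart_inv c))"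

text \<open>
  A tangent vector at \<open>p\<close> is the family of its coordinate vectors in all the charts around \<open>p\<close>,
  related to each other by the Jacobians of the transition maps. In the charts of the atlas that
  do not contain \<open>p\<close>, and outside the atlas, the family is \<open>0\<close>, so that equality of tangent vectors
  is equality of functions.
\<close>

type_synonym ('p, 'n) tvec = "('p, 'n) chart \<Rightarrow> real ^ 'n"

definition tangent_space :: "('p, 'n::finite) chart set \<Rightarrow> 'p \<Rightarrow> ('p, 'n) tvec set" where
  "tangent_space A p = {v.
     (\<forall>c\<in>A. \<forall>d\<in>A. p \<in> fst c \<longrightarrow> p \<in> fst d \<longrightarrow>
        v d = frechet_derivative (snd d \<circ> chart_inv c) (at (snd c p)) (v c)) \<and>
     (\<forall>d. \<not> (d \<in> A \<and> p \<in> fst d) \<longrightarrow> v d = 0)}"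

text \<open>The tangent vector \<open>y\<^sup>i \<partial>/\<partial>x\<^sup>i\<close> at \<open>p\<close>, with respect to the coordinates of the chart \<open>c\<close>.\<close>

definition tvec :: "('p, 'n::finite) chart set \<Rightarrow> ('p, 'n) chart \<Rightarrow> 'p \<Rightarrow> real ^ 'n \<Rightarrow> ('p, 'n) tvec" where
  "tvec A c p y = (\<lambda>d. if d \<in> A \<and> p \<in> fst d
     then frechet_derivative (snd d \<circ> chart_inv c) (at (snd c p)) y else 0)"

definition tpoint :: "('p, 'n::finite) chart set \<Rightarrow> ('p, 'n) chart \<Rightarrow> real ^ 'n \<Rightarrow> real ^ 'n
    \<Rightarrow> 'p \<times> ('p, 'n) tvec" where
  "tpoint A c x y = (chart_inv c x, tvec A c (chart_inv c x) y)"

text \<open>The part of a subset \<open>D\<close> of \<open>TM\<close> lying over a chart, in the coordinates \<open>(x, y)\<close>.\<close>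

definition tcoords :: "('p, 'n::finite) chart set \<Rightarrow> ('p, 'n) chart \<Rightarrow> ('p \<times> ('p, 'n) tvec) set
    \<Rightarrow> ((real ^ 'n) \<times> (real ^ 'n)) set" where
  "tcoords A c D = {(x, y). x \<in> snd c ` fst c \<and> tpoint A c x y \<in> D}"

definition local_rep :: "('p, 'n::finite) chart set \<Rightarrow> ('p, 'n) chart \<Rightarrow> ('p \<times> ('p, 'n) tvec \<Rightarrow> real)
    \<Rightarrow> real ^ 'n \<Rightarrow> real ^ 'n \<Rightarrow> real" where
  "local_rep A c F x y = F (tpoint A c x y)"

definition smooth_function :: "('p, 'n::finite) chart set \<Rightarrow> ('p \<Rightarrow> real) \<Rightarrow> bool" where
  "smooth_function A \<sigma> \<longleftrightarrow> (\<forall>c\<in>A. smooth_on (snd c ` fst c) (\<sigma> \<circ> chart_inv c))"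

text \<open>A 1-form is a fibrewise linear function \<open>\<beta>\<close> on \<open>TM\<close>; its components in a chart are
  \<open>b\<^sub>i(x) = \<beta>(\<partial>/\<partial>x\<^sup>i)\<close>.\<close>

definition form_comp :: "('p, 'n::finite) chart set \<Rightarrow> ('p, 'n) chart \<Rightarrow> ('p \<times> ('p, 'n) tvec \<Rightarrow> real)
    \<Rightarrow> real ^ 'n \<Rightarrow> real ^ 'n" where
  "form_comp A c \<beta> x = (\<chi> i. \<beta> (tpoint A c x (axis i 1)))"

definition one_form :: "('p, 'n::finite) chart set \<Rightarrow> ('p \<times> ('p, 'n) tvec \<Rightarrow> real) \<Rightarrow> bool" where
  "one_form A \<beta> \<longleftrightarrow>
     (\<forall>c\<in>A. (\<forall>x\<in>snd c ` fst c. linear (\<lambda>y. \<beta> (tpoint A c x y))) \<and>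
        smooth_on (snd c ` fst c) (form_comp A c \<beta>))"

text \<open>
  A covariant tensor field of order two on \<open>D\<close> in the sense of Finsler geometry: it assigns to
  \<open>u = (p, v)\<close> in \<open>D\<close> a bilinear form on the tangent space at \<open>p\<close>, depending smoothly on \<open>u\<close>.
\<close>

definition tensor_comp :: "('p, 'n::finite) chart set \<Rightarrow> ('p, 'n) chart
    \<Rightarrow> ('p \<times> ('p, 'n) tvec \<Rightarrow> ('p, 'n) tvec \<Rightarrow> ('p, 'n) tvec \<Rightarrow> real)
    \<Rightarrow> real ^ 'n \<Rightarrow> real ^ 'n \<Rightarrow> real ^ 'n ^ 'n" where
  "tensor_comp A c Q x y = (\<chi> i j. Q (tpoint A c x y)
     (tvec A c (chart_inv c x) (axis i 1)) (tvec A c (chart_inv c x) (axis j 1)))"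

definition tensor_field :: "('p, 'n::finite) chart set \<Rightarrow> ('p \<times> ('p, 'n) tvec) set
    \<Rightarrow> ('p \<times> ('p, 'n) tvec \<Rightarrow> ('p, 'n) tvec \<Rightarrow> ('p, 'n) tvec \<Rightarrow> real) \<Rightarrow> bool" where
  "tensor_field A D Q \<longleftrightarrow>
     (\<forall>c\<in>A.
        (\<forall>(x, y)\<in>tcoords A c D. bilinear (\<lambda>v w. Q (tpoint A c x y)
            (tvec A c (chart_inv c x) v) (tvec A c (chart_inv c x) w))) \<and>
        smooth_on (tcoords A c D) (\<lambda>(x, y). tensor_comp A c Q x y))"


section \<open>Finsler tensors in local coordinates\<close>

text \<open>
  In this section \<open>F\<close> is the function \<open>y \<mapsto> L(x, y)\<close> of the components of a tangent vector, for a
  fixed point with coordinates \<open>x\<close>, and \<open>b\<close> is the covector with the components \<open>b\<^sub>i(x)\<close>.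
\<close>

definition pd :: "'n::finite \<Rightarrow> (real ^ 'n \<Rightarrow> real) \<Rightarrow> real ^ 'n \<Rightarrow> real" where
  "pd i F y = deriv (\<lambda>t. F (y + t *\<^sub>R axis i 1)) 0"

definition metric :: "(real ^ 'n::finite \<Rightarrow> real) \<Rightarrow> real ^ 'n \<Rightarrow> real ^ 'n ^ 'n" where
  "metric F y = (\<chi> i j. 1/2 * pd i (pd j (\<lambda>z. (F z)\<^sup>2)) y)"

definition inv_metric :: "(real ^ 'n::finite \<Rightarrow> real) \<Rightarrow> real ^ 'n \<Rightarrow> real ^ 'n ^ 'n" where
  "inv_metric F y = matrix_inv (metric F y)"

definition y_low :: "(real ^ 'n::finite \<Rightarrow> real) \<Rightarrow> real ^ 'n \<Rightarrow> real ^ 'n" where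
  "y_low F y = (\<chi> i. \<Sum>j\<in>UNIV. metric F y $ i $ j * y $ j)"

definition angular_metric :: "(real ^ 'n::finite \<Rightarrow> real) \<Rightarrow> real ^ 'n \<Rightarrow> real ^ 'n ^ 'n" where
  "angular_metric F y = (\<chi> i j. metric F y $ i $ j - pd i F y * pd j F y)"

definition cartan :: "(real ^ 'n::finite \<Rightarrow> real) \<Rightarrow> real ^ 'n \<Rightarrow> 'n \<Rightarrow> 'n \<Rightarrow> 'n \<Rightarrow> real" where
  "cartan F y i j k = 1/2 * pd k (\<lambda>z. metric F z $ i $ j) y"

definition cartan_trace :: "(real ^ 'n::finite \<Rightarrow> real) \<Rightarrow> real ^ 'n \<Rightarrow> 'n \<Rightarrow> real" where
  "cartan_trace F y i = (\<Sum>j\<in>UNIV. \<Sum>k\<in>UNIV. cartan F y i j k * inv_metric F y $ j $ k)"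

definition b_up :: "real ^ 'n::finite \<Rightarrow> (real ^ 'n \<Rightarrow> real) \<Rightarrow> real ^ 'n \<Rightarrow> real ^ 'n" where
  "b_up b F y = (\<chi> i. \<Sum>j\<in>UNIV. inv_metric F y $ i $ j * b $ j)"

definition cartan_bb :: "real ^ 'n::finite \<Rightarrow> (real ^ 'n \<Rightarrow> real) \<Rightarrow> real ^ 'n \<Rightarrow> 'n \<Rightarrow> real" where
  "cartan_bb b F y k =
     (\<Sum>i\<in>UNIV. \<Sum>j\<in>UNIV. cartan F y k i j * b_up b F y $ i * b_up b F y $ j)"

definition m_cov :: "real ^ 'n::finite \<Rightarrow> (real ^ 'n \<Rightarrow> real) \<Rightarrow> real ^ 'n \<Rightarrow> real ^ 'n" where
  "m_cov b F y = (\<chi> i. b $ i - (b \<bullet> y) / (F y)\<^sup>2 * y_low F y $ i)"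

definition m_sq :: "real ^ 'n::finite \<Rightarrow> (real ^ 'n \<Rightarrow> real) \<Rightarrow> real ^ 'n \<Rightarrow> real" where
  "m_sq b F y =
     (\<Sum>i\<in>UNIV. \<Sum>j\<in>UNIV. inv_metric F y $ i $ j * m_cov b F y $ i * m_cov b F y $ j)"


section \<open>The scalars of a generalized \<open>\<beta>\<close>-conformal change\<close>

text \<open>The partial derivatives with respect to the first argument and to the second one.\<close>

definition D1 :: "(real \<Rightarrow> real \<Rightarrow> real) \<Rightarrow> real \<Rightarrow> real \<Rightarrow> real" where
  "D1 f a t = deriv (\<lambda>u. f u t) a"

definition D2 :: "(real \<Rightarrow> real \<Rightarrow> real) \<Rightarrow> real \<Rightarrow> real \<Rightarrow> real" where
  "D2 f a t = deriv (\<lambda>u. f a u) t"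

text \<open>
  The functions of the next group take the values \<open>a\<close> of \<open>e\<^sup>\<sigma>L\<close>, \<open>t\<close> of \<open>\<beta>\<close> and, where needed, \<open>l\<close>
  of \<open>L\<close>.
\<close>

definition p_fun :: "(real \<Rightarrow> real \<Rightarrow> real) \<Rightarrow> real \<Rightarrow> real \<Rightarrow> real \<Rightarrow> real" where
  "p_fun f l a t = f a t * D1 f a t / l"

definition q0_fun :: "(real \<Rightarrow> real \<Rightarrow> real) \<Rightarrow> real \<Rightarrow> real \<Rightarrow> real" where
  "q0_fun f a t = f a t * D2 (D2 f) a t"

definition p0_fun :: "(real \<Rightarrow> real \<Rightarrow> real) \<Rightarrow> real \<Rightarrow> real \<Rightarrow> real" where
  "p0_fun f a t = (D2 f a t)\<^sup>2 + q0_fun f a t"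

definition pm1_fun :: "(real \<Rightarrow> real \<Rightarrow> real) \<Rightarrow> real \<Rightarrow> real \<Rightarrow> real \<Rightarrow> real" where
  "pm1_fun f l a t = f a t * D2 (D1 f) a t / l + p_fun f l a t * D2 f a t / f a t"

definition p02_fun :: "(real \<Rightarrow> real \<Rightarrow> real) \<Rightarrow> real \<Rightarrow> real \<Rightarrow> real" where
  "p02_fun f a t = D2 (p0_fun f) a t"

text \<open>Their values at \<open>(x, y)\<close>, where \<open>s = \<sigma>(x)\<close>.\<close>

definition pc :: "(real \<Rightarrow> real \<Rightarrow> real) \<Rightarrow> real \<Rightarrow> real ^ 'n::finite \<Rightarrow> (real ^ 'n \<Rightarrow> real) \<Rightarrow> real ^ 'n \<Rightarrow> real" where
  "pc f s b F y = p_fun f (F y) (exp s * F y) (b \<bullet> y)"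

definition q0 :: "(real \<Rightarrow> real \<Rightarrow> real) \<Rightarrow> real \<Rightarrow> real ^ 'n::finite \<Rightarrow> (real ^ 'n \<Rightarrow> real) \<Rightarrow> real ^ 'n \<Rightarrow> real" where
  "q0 f s b F y = q0_fun f (exp s * F y) (b \<bullet> y)"

definition pm1 :: "(real \<Rightarrow> real \<Rightarrow> real) \<Rightarrow> real \<Rightarrow> real ^ 'n::finite \<Rightarrow> (real ^ 'n \<Rightarrow> real) \<Rightarrow> real ^ 'n \<Rightarrow> real" where
  "pm1 f s b F y = pm1_fun f (F y) (exp s * F y) (b \<bullet> y)"

definition p02 :: "(real \<Rightarrow> real \<Rightarrow> real) \<Rightarrow> real \<Rightarrow> real ^ 'n::finite \<Rightarrow> (real ^ 'n \<Rightarrow> real) \<Rightarrow> real ^ 'n \<Rightarrow> real" where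
  "p02 f s b F y = p02_fun f (exp s * F y) (b \<bullet> y)"

definition s0 :: "(real \<Rightarrow> real \<Rightarrow> real) \<Rightarrow> real \<Rightarrow> real ^ 'n::finite \<Rightarrow> (real ^ 'n \<Rightarrow> real) \<Rightarrow> real ^ 'n \<Rightarrow> real" where
  "s0 f s b F y = exp (- s) * q0 f s b F y /
     (pc f s b F y * (exp s * pc f s b F y + m_sq b F y * q0 f s b F y))"

definition lam :: "(real \<Rightarrow> real \<Rightarrow> real) \<Rightarrow> real \<Rightarrow> real ^ 'n::finite \<Rightarrow> (real ^ 'n \<Rightarrow> real) \<Rightarrow> real ^ 'n \<Rightarrow> real" where
  "lam f s b F y =
     (real CARD('n) + 1) * pm1 f s b F y / (2 * pc f s b F y)
     - 3 * exp s * pm1 f s b F y * m_sq b F y * s0 f s b F y / 2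
     + p02 f s b F y * m_sq b F y / (2 * (exp s * pc f s b F y + q0 f s b F y * m_sq b F y))"

definition cyclic_sum :: "('n \<Rightarrow> 'n \<Rightarrow> 'n \<Rightarrow> real) \<Rightarrow> 'n \<Rightarrow> 'n \<Rightarrow> 'n \<Rightarrow> real" where
  "cyclic_sum T i j k = T i j k + T j k i + T k i j"

definition q_tensor :: "(real \<Rightarrow> real \<Rightarrow> real) \<Rightarrow> real \<Rightarrow> real ^ 'n::finite \<Rightarrow> (real ^ 'n \<Rightarrow> real) \<Rightarrow> real ^ 'n
    \<Rightarrow> 'n \<Rightarrow> 'n \<Rightarrow> 'n \<Rightarrow> real" where
  "q_tensor f s b F y i j k = 1 / (6 * lam f s b F y) * cyclic_sum (\<lambda>i j k.
     2 * exp s * lam f s b F y * pc f s b F y * cartan F y i j k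
     + (3 * exp s * pm1 f s b F y * angular_metric F y $ i $ j
        + p02 f s b F y * m_cov b F y $ i * m_cov b F y $ j)
       * (exp s * pc f s b F y * s0 f s b F y * cartan_bb b F y k - cartan_trace F y k)) i j k"


section \<open>Finsler spaces and generalized \<open>\<beta>\<close>-conformal changes\<close>

text \<open>
  A Finsler space carries its domain \<open>D\<close>, an open conic subset of the slit tangent bundle; the
  classical case is the whole slit tangent bundle. The domain is needed for two reasons: for many
  \<open>f\<close> (such as \<open>f(a, t) = a\<^sup>2/t\<close>) the changed function is regular on a cone only, and for a positive
  definite metric the condition \<open>m\<^sub>i \<noteq> 0\<close> fails somewhere in every slit tangent space, so that it
  can only be imposed on a smaller set of directions. The metric is required to be nondegenerate;
  positive definite metrics are a special case.
\<close>

definition finsler_space :: "'p topology \<Rightarrow> ('p, 'n::finite) chart set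
    \<Rightarrow> ('p \<times> ('p, 'n) tvec) set \<Rightarrow> ('p \<times> ('p, 'n) tvec \<Rightarrow> real) \<Rightarrow> bool" where
  "finsler_space M A D L \<longleftrightarrow>
     smooth_manifold M A \<and>
     (\<forall>(p, v)\<in>D. p \<in> topspace M \<and> v \<in> tangent_space A p \<and> v \<noteq> (\<lambda>_. 0)) \<and>
     (\<forall>c\<in>A. open (tcoords A c D) \<and> smooth_on (tcoords A c D) (\<lambda>(x, y). local_rep A c L x y)) \<and>
     (\<forall>u\<in>D. 0 < L u) \<and>
     (\<forall>(p, v)\<in>D. \<forall>t>0. (p, \<lambda>d. t *\<^sub>R v d) \<in> D \<and> L (p, \<lambda>d. t *\<^sub>R v d) = t * L (p, v)) \<and>
     (\<forall>c\<in>A. \<forall>(x, y)\<in>tcoords A c D. invertible (metric (local_rep A c L x) y))"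

definition quasi_C_reducible :: "'p topology \<Rightarrow> ('p, 'n::finite) chart set
    \<Rightarrow> ('p \<times> ('p, 'n) tvec) set \<Rightarrow> ('p \<times> ('p, 'n) tvec \<Rightarrow> real) \<Rightarrow> bool" where
  "quasi_C_reducible M A D L \<longleftrightarrow>
     finsler_space M A D L \<and> CARD('n) \<ge> 3 \<and>
     (\<exists>Q. tensor_field A D Q \<and>
        (\<forall>c\<in>A. \<forall>(x, y)\<in>tcoords A c D.
           let F = local_rep A c L x; q = tensor_comp A c Q x y in
             (\<forall>i j. q $ i $ j = q $ j $ i) \<and>
             (\<forall>j. (\<Sum>i\<in>UNIV. q $ i $ j * y $ i) = 0) \<and>
             (\<forall>i j k. cartan F y i j k =
                q $ i $ j * cartan_trace F y k + q $ j $ k * cartan_trace F y i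
                + q $ k $ i * cartan_trace F y j)))"

definition changed_L :: "('p \<Rightarrow> real) \<Rightarrow> ('p \<times> ('p, 'n) tvec \<Rightarrow> real) \<Rightarrow> (real \<Rightarrow> real \<Rightarrow> real)
    \<Rightarrow> ('p \<times> ('p, 'n) tvec \<Rightarrow> real) \<Rightarrow> 'p \<times> ('p, 'n) tvec \<Rightarrow> real" where
  "changed_L \<sigma> \<beta> f L u = f (exp (\<sigma> (fst u)) * L u) (\<beta> u)"

text \<open>\<open>\<Omega>\<close> is the open cone of pairs \<open>(e\<^sup>\<sigma>L, \<beta>)\<close> on which \<open>f\<close> is given.\<close>

definition gen_beta_conformal_change :: "'p topology \<Rightarrow> ('p, 'n::finite) chart set
    \<Rightarrow> ('p \<times> ('p, 'n) tvec) set \<Rightarrow> ('p \<times> ('p, 'n) tvec \<Rightarrow> real) \<Rightarrow> ('p \<Rightarrow> real)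
    \<Rightarrow> ('p \<times> ('p, 'n) tvec \<Rightarrow> real) \<Rightarrow> (real \<times> real) set \<Rightarrow> (real \<Rightarrow> real \<Rightarrow> real) \<Rightarrow> bool" where
  "gen_beta_conformal_change M A D L \<sigma> \<beta> \<Omega> f \<longleftrightarrow>
     finsler_space M A D L \<and>
     smooth_function A \<sigma> \<and> one_form A \<beta> \<and>
     open \<Omega> \<and> smooth_on \<Omega> (\<lambda>(a, t). f a t) \<and>
     (\<forall>(a, t)\<in>\<Omega>. \<forall>r>0. (r * a, r * t) \<in> \<Omega> \<and> f (r * a) (r * t) = r * f a t) \<and>
     (\<forall>u\<in>D. (exp (\<sigma> (fst u)) * L u, \<beta> u) \<in> \<Omega>) \<and>
     finsler_space M A D (changed_L \<sigma> \<beta> f L)"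

end

theory Submission
  imports Defs
begin

text \<open>
  Fix a point and write \<open>F\<close> for \<open>L\<close> and \<open>B\<close> for the changed function, both as functions of
  the direction \<open>y\<close>, with a star on the objects derived from \<open>B\<close>; put \<open>P = e\<^sup>\<sigma>p\<close> and
  \<open>P' = e\<^sup>\<sigma>p\<^sub>-\<^sub>1\<close>. The Euler relations of \<open>f\<close> make every first \<open>y\<close>-derivative of a scalar
  homogeneous of degree \<open>0\<close> in \<open>(e\<^sup>\<sigma>L, \<beta>)\<close> a multiple of the indicatory covector \<open>m\<close>. With them two
  differentiations of \<open>B\<close> give
  \<open>g\<^sup>*\<^sub>i\<^sub>j = P h\<^sub>i\<^sub>j + q\<^sub>0 m\<^sub>i m\<^sub>j + l\<^sup>*\<^sub>i l\<^sup>*\<^sub>j\<close> (\<open>metric_bar\<close>), and a third one gives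
  \<open>C\<^sup>*\<^sub>i\<^sub>j\<^sub>k = P C\<^sub>i\<^sub>j\<^sub>k + P'/2 (h\<^sub>i\<^sub>j m\<^sub>k + h\<^sub>j\<^sub>k m\<^sub>i + h\<^sub>k\<^sub>i m\<^sub>j) + p\<^sub>0\<^sub>2/2 m\<^sub>i m\<^sub>j m\<^sub>k\<close> (\<open>cartan_bar\<close>).

  For the trace, the inverse of \<open>g\<^sup>*\<close> is needed only up to terms with a factor \<open>y\<close>, since \<open>C\<^sup>*\<close> is
  indicatory. Modulo such terms it is \<open>g\<^sup>j\<^sup>k/P - s\<^sub>0 m\<^sup>j m\<^sup>k\<close>, so that
  \<open>C\<^sup>*\<^sub>i = C\<^sub>i - P s\<^sub>0 C\<^sub>i\<^sub>\<beta>\<^sub>\<beta> + \<lambda> m\<^sub>i\<close> (\<open>cartan_trace_bar\<close>). As \<open>\<lambda> \<noteq> 0\<close>, this can be solved for \<open>m\<^sub>i\<close>.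
  Replacing one factor \<open>m\<close> in each term of \<open>C\<^sup>*\<^sub>i\<^sub>j\<^sub>k\<close> accordingly turns it into the cyclic sum of
  \<open>Q\<^sub>i\<^sub>j C\<^sup>*\<^sub>k\<close> plus \<open>q\<^sub>i\<^sub>j\<^sub>k\<close>, where \<open>Q\<^sub>i\<^sub>j = (3 P' h\<^sub>i\<^sub>j + p\<^sub>0\<^sub>2 m\<^sub>i m\<^sub>j)/(6\<lambda>)\<close>; the hypothesis removes the last
  summand (\<open>cartan_bar_reducible\<close>).

  It remains to see that \<open>Q\<close> is a smooth tensor field. The local expressions for \<open>Q\<close> in two charts
  differ by the Jacobian of the transition map, because each ingredient is a covector, a bilinear
  form or a scalar under linear changes of \<open>y\<close> (\<open>reducing_tensor_compose_linear\<close>); and they are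
  rational in iterated derivatives of smooth functions and in the inverse metric
  (\<open>smooth_on_reducing_tensor\<close>).
\<close>

section \<open>Calculus of smooth maps\<close>

text \<open>On an open set a function inherits the Frechet derivative of a function it agrees with there, so
  the induction can pass to the directional derivatives.\<close>

lemma times_differentiable_on_cong:
  assumes "open S" "\<And>x. x \<in> S \<Longrightarrow> f x = g x" "times_differentiable_on k S f"
  shows "times_differentiable_on k S g"
  using assms(2,3)
proof (induction k arbitrary: f g)
  case 0
  then show ?case
    using continuous_on_eq[of S f g] by simp
next
  case (Suc k)
  have g: "(g has_derivative frechet_derivative f (at x)) (at x)" if "x \<in> S" for x
  proof (rule has_derivative_transform_within_open[OF _ assms(1) that])
    show "(f has_derivative frechet_derivative f (at x)) (at x)"
      using Suc.prems(2) that frechet_derivative_works by auto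
  qed (rule Suc.prems(1))
  have "times_differentiable_on k S (\<lambda>x. frechet_derivative g (at x) v)" for v
  proof (rule Suc.IH)
    show "frechet_derivative f (at x) v = frechet_derivative g (at x) v" if "x \<in> S" for x
      using frechet_derivative_at[OF g[OF that]] by simp
    show "times_differentiable_on k S (\<lambda>x. frechet_derivative f (at x) v)"
      using Suc.prems(2) by simp
  qed
  moreover have "g differentiable (at x)" if "x \<in> S" for x
    using g[OF that] unfolding differentiable_def by blast
  ultimately show ?case by simp
qed

text \<open>All closure properties below are proved by exhibiting a derivative pointwise and showing that its
  directional values are one order less regular; this rule packages that step.\<close>

lemma times_differentiable_on_SucI:
  assumes "open S" "\<And>x. x \<in> S \<Longrightarrow> (f has_derivative f' x) (at x)"
    and "\<And>v. times_differentiable_on k S (\<lambda>x. f' x v)"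
  shows "times_differentiable_on (Suc k) S f"
proof -
  have "f' x = frechet_derivative f (at x)" if "x \<in> S" for x
    using assms(2)[OF that] by (rule frechet_derivative_at)
  then have "times_differentiable_on k S (\<lambda>x. frechet_derivative f (at x) v)" for v
    by (intro times_differentiable_on_cong[OF assms(1) _ assms(3)[of v]]) simp
  then show ?thesis
    using assms(2) by (auto simp: differentiable_def)
qed

lemma times_differentiable_on_has_derivative:
  assumes "times_differentiable_on (Suc k) S f" "x \<in> S"
  shows "(f has_derivative frechet_derivative f (at x)) (at x)"
  using assms by (auto simp: frechet_derivative_works)

lemma times_differentiable_on_Suc_imp:
  "times_differentiable_on (Suc k) S f \<Longrightarrow> times_differentiable_on k S f"
proof (induction k arbitrary: f)
  case 0
  then show ?case
    by (auto intro!: continuous_at_imp_continuous_on differentiable_imp_continuous_within)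
next
  case (Suc k)
  have "times_differentiable_on k S (\<lambda>x. frechet_derivative f (at x) v)" for v
    using Suc.prems by (intro Suc.IH) (subst (asm) times_differentiable_on.simps(2), blast)
  then show ?case using Suc.prems by auto
qed

lemma times_differentiable_on_const: "times_differentiable_on k S (\<lambda>_. c)"
  by (induction k arbitrary: c) auto

lemma times_differentiable_on_bounded_linear:
  assumes "open S" "bounded_linear f"
  shows "times_differentiable_on k S f"
proof (cases k)
  case 0
  then show ?thesis using assms(2) by (simp add: linear_continuous_on)
next
  case (Suc j)
  show ?thesis unfolding Suc
    by (rule times_differentiable_on_SucI[where f'="\<lambda>_. f"])
      (simp_all add: assms bounded_linear_imp_has_derivative times_differentiable_on_const del: times_differentiable_on.simps)
qed

lemma times_differentiable_on_add:
  assumes "open S" "times_differentiable_on k S f" "times_differentiable_on k S g"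
  shows "times_differentiable_on k S (\<lambda>x. f x + g x)"
  using assms(2,3)
proof (induction k arbitrary: f g)
  case 0
  then show ?case by (simp add: continuous_on_add)
next
  case (Suc k)
  show ?case
  proof (rule times_differentiable_on_SucI[OF assms(1)])
    show "((\<lambda>x. f x + g x) has_derivative
        (\<lambda>v. frechet_derivative f (at x) v + frechet_derivative g (at x) v)) (at x)" if "x \<in> S" for x
      using Suc.prems that by (intro has_derivative_add times_differentiable_on_has_derivative)
    show "times_differentiable_on k S
        (\<lambda>x. frechet_derivative f (at x) v + frechet_derivative g (at x) v)" for v
      using Suc.prems by (intro Suc.IH) auto
  qed
qed

lemma times_differentiable_on_linear_compose:
  assumes "open S" "bounded_linear L" "times_differentiable_on k S f"
  shows "times_differentiable_on k S (\<lambda>x. L (f x))"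
  using assms(3)
proof (induction k arbitrary: f)
  case 0
  then show ?case using assms(2) by (simp add: bounded_linear.continuous_on)
next
  case (Suc k)
  show ?case
  proof (rule times_differentiable_on_SucI[OF assms(1)])
    show "((\<lambda>x. L (f x)) has_derivative (\<lambda>v. L (frechet_derivative f (at x) v))) (at x)"
      if "x \<in> S" for x
      using Suc.prems that
      by (intro bounded_linear.has_derivative[OF assms(2)] times_differentiable_on_has_derivative)
    show "times_differentiable_on k S (\<lambda>x. L (frechet_derivative f (at x) v))" for v
      using Suc.prems by (intro Suc.IH) auto
  qed
qed

lemma times_differentiable_on_bilinear:
  assumes "open S" "bounded_bilinear B" "times_differentiable_on k S f" "times_differentiable_on k S g"
  shows "times_differentiable_on k S (\<lambda>x. B (f x) (g x))"
  using assms(3,4)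
proof (induction k arbitrary: f g)
  case 0
  then show ?case using assms(2) by (simp add: bounded_bilinear.continuous_on)
next
  case (Suc k)
  have "times_differentiable_on k S f" "times_differentiable_on k S g"
    using Suc.prems times_differentiable_on_Suc_imp by blast+
  note fg = this
  show ?case
  proof (rule times_differentiable_on_SucI[OF assms(1)])
    show "((\<lambda>x. B (f x) (g x)) has_derivative (\<lambda>v. B (f x) (frechet_derivative g (at x) v) +
         B (frechet_derivative f (at x) v) (g x))) (at x)" if "x \<in> S" for x
      using Suc.prems that
      by (intro bounded_bilinear.FDERIV[OF assms(2)] times_differentiable_on_has_derivative)
    show "times_differentiable_on k S (\<lambda>x. B (f x) (frechet_derivative g (at x) v) +
         B (frechet_derivative f (at x) v) (g x))" for v
      using Suc.prems fg by (intro times_differentiable_on_add[OF assms(1)] Suc.IH) auto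
  qed
qed

lemma times_differentiable_on_sum:
  assumes "open S" "finite I" "\<And>i. i \<in> I \<Longrightarrow> times_differentiable_on k S (f i)"
  shows "times_differentiable_on k S (\<lambda>x. \<Sum>i\<in>I. f i x)"
  using assms(2,3)
  by (induction I rule: finite_induct)
    (auto intro: times_differentiable_on_const times_differentiable_on_add[OF assms(1)])

text \<open>The derivative of \<open>g\<close> at \<open>f x\<close> is applied to a vector that itself depends on \<open>x\<close>, which is outside
  the scope of the induction hypothesis. Expanding that vector in a basis leaves directional
  derivatives of \<open>g\<close> in constant directions, with scalar coefficients.\<close>

lemma times_differentiable_on_compose:
  fixes f :: "'a::real_normed_vector \<Rightarrow> 'b::euclidean_space"
  assumes "open S" "times_differentiable_on k T g" "times_differentiable_on k S f" "f ` S \<subseteq> T"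
  shows "times_differentiable_on k S (\<lambda>x. g (f x))"
  using assms(2,3)
proof (induction k arbitrary: g)
  case 0
  then show ?case using assms(4) by (auto intro: continuous_on_compose2)
next
  case (Suc k)
  let ?f' = "\<lambda>x. frechet_derivative f (at x)"
  let ?g' = "\<lambda>x v. \<Sum>i\<in>Basis. (?f' x v \<bullet> i) *\<^sub>R frechet_derivative g (at (f x)) i"
  have f: "times_differentiable_on k S f"
    using Suc.prems(2) times_differentiable_on_Suc_imp by blast
  show ?case
  proof (rule times_differentiable_on_SucI[OF assms(1), where f'="?g'"])
    fix x assume x: "x \<in> S"
    then have "f x \<in> T" using assms(4) by auto
    then have g: "(g has_derivative frechet_derivative g (at (f x))) (at (f x))"
      using Suc.prems(1) times_differentiable_on_has_derivative by blast
    have "((\<lambda>x. g (f x)) has_derivative (\<lambda>v. frechet_derivative g (at (f x)) (?f' x v))) (at x)"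
      by (rule has_derivative_compose[OF times_differentiable_on_has_derivative[OF Suc.prems(2) x] g])
    moreover have "frechet_derivative g (at (f x)) (?f' x v) = ?g' x v" for v
    proof -
      have lin: "linear (frechet_derivative g (at (f x)))"
        using g has_derivative_linear by blast
      have "frechet_derivative g (at (f x)) (?f' x v) =
          frechet_derivative g (at (f x)) (\<Sum>i\<in>Basis. (?f' x v \<bullet> i) *\<^sub>R i)"
        by (simp add: euclidean_representation)
      then show ?thesis
        by (simp add: linear_sum[OF lin] linear_scale[OF lin])
    qed
    ultimately show "((\<lambda>x. g (f x)) has_derivative ?g' x) (at x)" by simp
  next
    fix v
    have "times_differentiable_on k S (\<lambda>x. ?f' x v \<bullet> i)" for i
      using Suc.prems(2)
      by (intro times_differentiable_on_linear_compose[OF assms(1) bounded_linear_inner_left]) auto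
    moreover have "times_differentiable_on k S (\<lambda>x. frechet_derivative g (at (f x)) i)" for i
      using Suc.prems(1) f by (intro Suc.IH) auto
    ultimately show "times_differentiable_on k S (\<lambda>x. ?g' x v)"
      by (intro times_differentiable_on_sum[OF assms(1)]
          times_differentiable_on_bilinear[OF assms(1) bounded_bilinear_scaleR]) auto
  qed
qed

text \<open>The derivative \<open>- f'/f\<^sup>2\<close> contains \<open>1/f\<close> again, but only its regularity of the order below is
  needed, which the induction hypothesis supplies. The exponential function is treated alike.\<close>

lemma times_differentiable_on_inverse:
  fixes f :: "'a::real_normed_vector \<Rightarrow> real"
  assumes "open S" "times_differentiable_on k S f" "\<And>x. x \<in> S \<Longrightarrow> f x \<noteq> 0"
  shows "times_differentiable_on k S (\<lambda>x. inverse (f x))"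
  using assms(2)
proof (induction k)
  case 0
  then show ?case using assms(3) by (auto intro: continuous_on_inverse)
next
  case (Suc k)
  then have "times_differentiable_on k S (\<lambda>x. inverse (f x))"
    using times_differentiable_on_Suc_imp by blast
  note inv = this
  show ?case
  proof (rule times_differentiable_on_SucI[OF assms(1)])
    show "((\<lambda>x. inverse (f x)) has_derivative
        (\<lambda>v. - (inverse (f x) * frechet_derivative f (at x) v * inverse (f x)))) (at x)" if "x \<in> S" for x
      using Suc.prems that assms(3)
      by (intro Deriv.has_derivative_inverse times_differentiable_on_has_derivative)
    show "times_differentiable_on k S
        (\<lambda>x. - (inverse (f x) * frechet_derivative f (at x) v * inverse (f x)))" for v
      using Suc.prems inv
      by (intro times_differentiable_on_linear_compose[OF assms(1) bounded_linear_minus[OF bounded_linear_ident]]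
          times_differentiable_on_bilinear[OF assms(1) bounded_bilinear_mult]) auto
  qed
qed

lemma times_differentiable_on_exp:
  fixes f :: "'a::real_normed_vector \<Rightarrow> real"
  assumes "open S" "times_differentiable_on k S f"
  shows "times_differentiable_on k S (\<lambda>x. exp (f x))"
  using assms(2)
proof (induction k)
  case 0
  then show ?case by (auto intro: continuous_on_exp)
next
  case (Suc k)
  then have "times_differentiable_on k S (\<lambda>x. exp (f x))"
    using times_differentiable_on_Suc_imp by blast
  note exp = this
  show ?case
  proof (rule times_differentiable_on_SucI[OF assms(1)])
    show "((\<lambda>x. exp (f x)) has_derivative (\<lambda>v. exp (f x) * frechet_derivative f (at x) v)) (at x)"
      if "x \<in> S" for x
      using times_differentiable_on_has_derivative[OF Suc.prems that]
      by (auto intro!: derivative_eq_intros)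
    show "times_differentiable_on k S (\<lambda>x. exp (f x) * frechet_derivative f (at x) v)" for v
      using Suc.prems exp
      by (intro times_differentiable_on_bilinear[OF assms(1) bounded_bilinear_mult]) auto
  qed
qed

lemma smooth_on_cong:
  assumes "open S" "\<And>x. x \<in> S \<Longrightarrow> f x = g x" "smooth_on S f" shows "smooth_on S g"
  using assms times_differentiable_on_cong unfolding smooth_on_def by blast

lemma smooth_on_const [simp]: "smooth_on S (\<lambda>_. c)"
  by (simp add: smooth_on_def times_differentiable_on_const)

lemma smooth_on_bounded_linear: "open S \<Longrightarrow> bounded_linear f \<Longrightarrow> smooth_on S f"
  by (simp add: smooth_on_def times_differentiable_on_bounded_linear)

lemma smooth_on_linear_compose:
  "open S \<Longrightarrow> bounded_linear L \<Longrightarrow> smooth_on S f \<Longrightarrow> smooth_on S (\<lambda>x. L (f x))"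
  by (simp add: smooth_on_def times_differentiable_on_linear_compose)

lemma smooth_on_add:
  "open S \<Longrightarrow> smooth_on S f \<Longrightarrow> smooth_on S g \<Longrightarrow> smooth_on S (\<lambda>x. f x + g x)"
  by (simp add: smooth_on_def times_differentiable_on_add)

lemma smooth_on_sum:
  "open S \<Longrightarrow> finite I \<Longrightarrow> (\<And>i. i \<in> I \<Longrightarrow> smooth_on S (f i)) \<Longrightarrow> smooth_on S (\<lambda>x. \<Sum>i\<in>I. f i x)"
  by (simp add: smooth_on_def times_differentiable_on_sum)

lemma smooth_on_bilinear:
  "open S \<Longrightarrow> bounded_bilinear B \<Longrightarrow> smooth_on S f \<Longrightarrow> smooth_on S g \<Longrightarrow> smooth_on S (\<lambda>x. B (f x) (g x))"
  by (simp add: smooth_on_def times_differentiable_on_bilinear)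

lemma smooth_on_mult:
  fixes f g :: "'a::real_normed_vector \<Rightarrow> real"
  shows "open S \<Longrightarrow> smooth_on S f \<Longrightarrow> smooth_on S g \<Longrightarrow> smooth_on S (\<lambda>x. f x * g x)"
  by (rule smooth_on_bilinear[OF _ bounded_bilinear_mult])

lemma smooth_on_minus:
  "open S \<Longrightarrow> smooth_on S f \<Longrightarrow> smooth_on S (\<lambda>x. - f x)"
  by (rule smooth_on_linear_compose[OF _ bounded_linear_minus[OF bounded_linear_ident]])

lemma smooth_on_diff:
  "open S \<Longrightarrow> smooth_on S f \<Longrightarrow> smooth_on S g \<Longrightarrow> smooth_on S (\<lambda>x. f x - g x)"
  using smooth_on_add[OF _ _ smooth_on_minus, of S f g] by simp

lemma smooth_on_divide:
  fixes f g :: "'a::real_normed_vector \<Rightarrow> real"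
  assumes "open S" "smooth_on S f" "smooth_on S g" "\<And>x. x \<in> S \<Longrightarrow> g x \<noteq> 0"
  shows "smooth_on S (\<lambda>x. f x / g x)"
proof -
  have "smooth_on S (\<lambda>x. inverse (g x))"
    using assms by (simp add: smooth_on_def times_differentiable_on_inverse)
  then show ?thesis
    using assms by (simp add: divide_inverse smooth_on_mult)
qed

lemma smooth_on_exp:
  fixes f :: "'a::real_normed_vector \<Rightarrow> real"
  shows "open S \<Longrightarrow> smooth_on S f \<Longrightarrow> smooth_on S (\<lambda>x. exp (f x))"
  by (simp add: smooth_on_def times_differentiable_on_exp)

lemma smooth_on_power:
  fixes f :: "'a::real_normed_vector \<Rightarrow> real"
  shows "open S \<Longrightarrow> smooth_on S f \<Longrightarrow> smooth_on S (\<lambda>x. f x ^ n)"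
  by (induction n) (auto intro: smooth_on_mult)

lemma smooth_on_prod:
  fixes f :: "'i \<Rightarrow> 'a::real_normed_vector \<Rightarrow> real"
  assumes "open S" "finite I" "\<And>i. i \<in> I \<Longrightarrow> smooth_on S (f i)"
  shows "smooth_on S (\<lambda>x. \<Prod>i\<in>I. f i x)"
  using assms(2,3) by (induction I rule: finite_induct) (auto intro: smooth_on_mult[OF assms(1)])

lemma smooth_on_compose:
  fixes f :: "'a::real_normed_vector \<Rightarrow> 'b::euclidean_space"
  assumes "open S" "smooth_on T g" "smooth_on S f" "\<And>x. x \<in> S \<Longrightarrow> f x \<in> T"
  shows "smooth_on S (\<lambda>x. g (f x))"
  using assms times_differentiable_on_compose[of S _ T g f] unfolding smooth_on_def by blast

lemma smooth_on_euclidean: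
  fixes f :: "'a::real_normed_vector \<Rightarrow> 'b::euclidean_space"
  assumes "open S" "\<And>i. i \<in> Basis \<Longrightarrow> smooth_on S (\<lambda>x. f x \<bullet> i)"
  shows "smooth_on S f"
proof -
  have "smooth_on S (\<lambda>x. \<Sum>i\<in>Basis. (f x \<bullet> i) *\<^sub>R i)"
    using assms by (intro smooth_on_sum smooth_on_linear_compose[OF _ bounded_linear_scaleR_left]) auto
  then show ?thesis by (simp add: euclidean_representation)
qed

lemma smooth_on_Pair_real:
  fixes f g :: "'a::real_normed_vector \<Rightarrow> real"
  assumes "open S" "smooth_on S f" "smooth_on S g"
  shows "smooth_on S (\<lambda>x. (f x, g x))"
proof (rule smooth_on_euclidean[OF assms(1)])
  fix i :: "real \<times> real" assume "i \<in> Basis"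
  have "smooth_on S (\<lambda>x. f x * fst i + g x * snd i)"
    by (intro smooth_on_add[OF assms(1)] smooth_on_mult[OF assms(1) _ smooth_on_const] assms)
  then show "smooth_on S (\<lambda>x. (f x, g x) \<bullet> i)" by (simp add: inner_prod_def)
qed

lemma smooth_on_vector:
  assumes "open S" "\<And>i. smooth_on S (\<lambda>x. f x $ i)"
  shows "smooth_on S (f :: 'a::real_normed_vector \<Rightarrow> 'b::euclidean_space ^ 'n::finite)"
proof (rule smooth_on_euclidean[OF assms(1)])
  fix e :: "'b ^ 'n" assume "e \<in> Basis"
  then obtain i u where e: "e = axis i u" by (auto simp: Basis_vec_def)
  show "smooth_on S (\<lambda>x. f x \<bullet> e)"
    unfolding e inner_axis
    by (rule smooth_on_linear_compose[OF assms(1) bounded_linear_inner_left assms(2)])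
qed

lemma smooth_on_component:
  "open S \<Longrightarrow> smooth_on S f \<Longrightarrow> smooth_on S (\<lambda>x. f x $ i)"
  by (rule smooth_on_linear_compose[OF _ bounded_linear_vec_nth])

lemma smooth_on_differentiable: "smooth_on S f \<Longrightarrow> x \<in> S \<Longrightarrow> f differentiable (at x)"
  unfolding smooth_on_def by (metis times_differentiable_on.simps(2))

lemma smooth_on_has_derivative:
  "smooth_on S f \<Longrightarrow> x \<in> S \<Longrightarrow> (f has_derivative frechet_derivative f (at x)) (at x)"
  using smooth_on_differentiable frechet_derivative_works by blast

lemma smooth_on_frechet_derivative: "smooth_on S f \<Longrightarrow> smooth_on S (\<lambda>x. frechet_derivative f (at x) v)"
  unfolding smooth_on_def by (metis times_differentiable_on.simps(2))

lemma smooth_on_continuous_on: "smooth_on S f \<Longrightarrow> continuous_on S f"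
  unfolding smooth_on_def by (metis times_differentiable_on.simps(1))

lemma has_derivative_along_line:
  fixes f :: "'a::real_normed_vector \<Rightarrow> real"
  assumes "(f has_derivative f') (at (x + t *\<^sub>R v))"
  shows "((\<lambda>t. f (x + t *\<^sub>R v)) has_real_derivative f' v) (at t)"
proof -
  have "((\<lambda>t. f (x + t *\<^sub>R v)) has_derivative (\<lambda>s. f' (s *\<^sub>R v))) (at t)"
    by (rule has_derivative_compose[where g=f and f="\<lambda>t. x + t *\<^sub>R v", OF _ assms]) (auto intro!: derivative_eq_intros)
  moreover have "f' (s *\<^sub>R v) = f' v * s" for s
    using has_derivative_linear[OF assms] by (simp add: linear_scale mult.commute)
  ultimately show ?thesis by (simp add: has_field_derivative_def)
qed

text \<open>The mean value theorem is applied to \<open>r \<mapsto> f (x + rv + tw) - f (x + rv)\<close> and then, in the direction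
  \<open>w\<close>, to the derivative of \<open>f\<close> in the direction \<open>v\<close>.\<close>

lemma second_difference:
  fixes f :: "'a::real_normed_vector \<Rightarrow> real"
  assumes f: "smooth_on S f" and t: "t > 0"
    and S: "\<And>a b. 0 \<le> a \<Longrightarrow> a \<le> t \<Longrightarrow> 0 \<le> b \<Longrightarrow> b \<le> t \<Longrightarrow> x + a *\<^sub>R v + b *\<^sub>R w \<in> S"
  shows "\<exists>a b. 0 \<le> a \<and> a \<le> t \<and> 0 \<le> b \<and> b \<le> t \<and>
    f (x + t *\<^sub>R v + t *\<^sub>R w) - f (x + t *\<^sub>R v) - f (x + t *\<^sub>R w) + f x =
    t * t * frechet_derivative (\<lambda>z. frechet_derivative f (at z) v) (at (x + a *\<^sub>R v + b *\<^sub>R w)) w"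
proof -
  let ?f' = "\<lambda>z. frechet_derivative f (at z) v"
  have d: "((\<lambda>r. f (x + b *\<^sub>R w + r *\<^sub>R v)) has_real_derivative ?f' (x + b *\<^sub>R w + a *\<^sub>R v)) (at a)"
    if "0 \<le> a" "a \<le> t" "0 \<le> b" "b \<le> t" for a b
    using S[OF that] by (intro has_derivative_along_line smooth_on_has_derivative[OF f]) (simp add: add_ac)
  have "\<exists>a. 0 < a \<and> a < t \<and> (f (x + t *\<^sub>R w + t *\<^sub>R v) - f (x + 0 *\<^sub>R w + t *\<^sub>R v))
      - (f (x + t *\<^sub>R w + 0 *\<^sub>R v) - f (x + 0 *\<^sub>R w + 0 *\<^sub>R v))
      = (t - 0) * (?f' (x + t *\<^sub>R w + a *\<^sub>R v) - ?f' (x + 0 *\<^sub>R w + a *\<^sub>R v))"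
    using t by (intro MVT2 DERIV_diff d) auto
  then obtain a where a: "0 < a" "a < t" and eq1: "f (x + t *\<^sub>R v + t *\<^sub>R w) - f (x + t *\<^sub>R v)
      - f (x + t *\<^sub>R w) + f x = t * (?f' (x + a *\<^sub>R v + t *\<^sub>R w) - ?f' (x + a *\<^sub>R v))"
    by (auto simp: add_ac algebra_simps)
  have "\<exists>b. 0 < b \<and> b < t \<and> ?f' (x + a *\<^sub>R v + t *\<^sub>R w) - ?f' (x + a *\<^sub>R v + 0 *\<^sub>R w)
      = (t - 0) * frechet_derivative ?f' (at (x + a *\<^sub>R v + b *\<^sub>R w)) w"
    using t a S
    by (intro MVT2 has_derivative_along_line smooth_on_has_derivative[OF smooth_on_frechet_derivative[OF f]]) auto
  then obtain b where "0 < b" "b < t" "?f' (x + a *\<^sub>R v + t *\<^sub>R w) - ?f' (x + a *\<^sub>R v)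
      = t * frechet_derivative ?f' (at (x + a *\<^sub>R v + b *\<^sub>R w)) w"
    by auto
  then show ?thesis
    using a eq1 by (intro exI[of _ a] exI[of _ b]) auto
qed

text \<open>The second difference of \<open>f\<close> is symmetric in \<open>v\<close> and \<open>w\<close>. It is therefore \<open>t\<^sup>2\<close> times a value of
  either mixed derivative at a point near \<open>x\<close>, and continuity identifies the limits for \<open>t \<rightarrow> 0\<close>.\<close>

lemma frechet_derivative_commute:
  fixes f :: "'a::real_normed_vector \<Rightarrow> real"
  assumes "open S" and f: "smooth_on S f" and x: "x \<in> S"
  shows "frechet_derivative (\<lambda>z. frechet_derivative f (at z) v) (at x) w =
         frechet_derivative (\<lambda>z. frechet_derivative f (at z) w) (at x) v"
proof -
  define A where "A = (\<lambda>v w z. frechet_derivative (\<lambda>z. frechet_derivative f (at z) v) (at z) w)"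
  have A: "isCont (A v w) x" for v w
    unfolding A_def
    using smooth_on_continuous_on[OF smooth_on_frechet_derivative[OF smooth_on_frechet_derivative[OF f]]]
      continuous_on_eq_continuous_at[OF assms(1)] x by blast
  have "\<bar>A v w x - A w v x\<bar> < 2 * e" if e: "e > 0" for e
  proof -
    obtain d where d: "d > 0" "\<And>z. dist z x < d \<Longrightarrow> dist (A v w z) (A v w x) < e"
      using A[of v w] e unfolding continuous_at_eps_delta by metis
    obtain d' where d': "d' > 0" "\<And>z. dist z x < d' \<Longrightarrow> dist (A w v z) (A w v x) < e"
      using A[of w v] e unfolding continuous_at_eps_delta by metis
    obtain d'' where d'': "d'' > 0" "ball x d'' \<subseteq> S"
      using assms(1) x open_contains_ball by blast
    \<comment> \<open>\<open>t\<close> is so small that the parallelogram spanned by \<open>tv\<close> and \<open>tw\<close> at \<open>x\<close> lies in the ball of radius \<open>D\<close>\<close>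
    define D where "D = min d (min d' d'')"
    define t where "t = D / (2 * (norm v + norm w + 1))"
    have D: "D > 0" using d(1) d'(1) d''(1) by (simp add: D_def)
    have n: "norm v + norm w + 1 > 0"
      by (simp add: add_nonneg_pos)
    have t: "t > 0" using D n by (simp add: t_def)
    have near: "dist (x + a *\<^sub>R v' + b *\<^sub>R w') x < D"
      if "0 \<le> a" "a \<le> t" "0 \<le> b" "b \<le> t" "{v', w'} = {v, w}" for a b v' w'
    proof -
      have "norm (a *\<^sub>R v' + b *\<^sub>R w') \<le> a * norm v' + b * norm w'"
        using norm_triangle_ineq[of "a *\<^sub>R v'" "b *\<^sub>R w'"] that by simp
      also have "\<dots> \<le> t * norm v' + t * norm w'"
        using that by (intro add_mono mult_right_mono) auto
      also have "\<dots> = t * (norm v + norm w)"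
        using that(5) by (auto simp: doubleton_eq_iff algebra_simps)
      also have "\<dots> \<le> t * (norm v + norm w + 1)" using t by simp
      also have "\<dots> = D / 2" using n by (simp add: t_def field_simps)
      finally show ?thesis using D by (simp add: dist_norm add.assoc)
    qed
    have inS: "x + a *\<^sub>R v' + b *\<^sub>R w' \<in> S"
      if "0 \<le> a" "a \<le> t" "0 \<le> b" "b \<le> t" "{v', w'} = {v, w}" for a b v' w'
      using near[OF that] d''(2) by (auto simp: D_def dist_commute subset_eq)
    obtain a b where ab: "0 \<le> a" "a \<le> t" "0 \<le> b" "b \<le> t" and eq:
      "f (x + t *\<^sub>R v + t *\<^sub>R w) - f (x + t *\<^sub>R v) - f (x + t *\<^sub>R w) + f x
        = t * t * A v w (x + a *\<^sub>R v + b *\<^sub>R w)"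
      using second_difference[OF f t, of x v w] inS[of _ _ v w] unfolding A_def by auto
    obtain a' b' where ab': "0 \<le> a'" "a' \<le> t" "0 \<le> b'" "b' \<le> t" and eq':
      "f (x + t *\<^sub>R w + t *\<^sub>R v) - f (x + t *\<^sub>R w) - f (x + t *\<^sub>R v) + f x
        = t * t * A w v (x + a' *\<^sub>R w + b' *\<^sub>R v)"
      using second_difference[OF f t, of x w v] inS[of _ _ w v] unfolding A_def by (auto simp: insert_commute)
    have "t * t * A v w (x + a *\<^sub>R v + b *\<^sub>R w) = t * t * A w v (x + a' *\<^sub>R w + b' *\<^sub>R v)"
    proof -
      have "f (x + t *\<^sub>R w + t *\<^sub>R v) = f (x + t *\<^sub>R v + t *\<^sub>R w)" by (simp add: add_ac)
      then show ?thesis using eq eq' by linarith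
    qed
    then have "A v w (x + a *\<^sub>R v + b *\<^sub>R w) = A w v (x + a' *\<^sub>R w + b' *\<^sub>R v)"
      using t by simp
    moreover have "dist (A v w (x + a *\<^sub>R v + b *\<^sub>R w)) (A v w x) < e"
      using near[OF ab, of v w] by (intro d(2)) (simp add: D_def)
    moreover have "dist (A w v (x + a' *\<^sub>R w + b' *\<^sub>R v)) (A w v x) < e"
      using near[OF ab', of w v] by (intro d'(2)) (simp add: D_def insert_commute)
    ultimately show ?thesis by (simp add: dist_real_def)
  qed
  from this[of "\<bar>A v w x - A w v x\<bar> / 2"] have "A v w x = A w v x" by fastforce
  then show ?thesis by (simp add: A_def)
qed

section \<open>Partial derivatives in Euclidean space\<close>

lemma deriv_along_line:
  fixes f :: "'a::real_normed_vector \<Rightarrow> real"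
  assumes "f differentiable (at x)"
  shows "((\<lambda>t. f (x + t *\<^sub>R v)) has_real_derivative frechet_derivative f (at x) v) (at 0)"
    and "deriv (\<lambda>t. f (x + t *\<^sub>R v)) 0 = frechet_derivative f (at x) v"
proof -
  show *: "((\<lambda>t. f (x + t *\<^sub>R v)) has_real_derivative frechet_derivative f (at x) v) (at 0)"
    using assms by (intro has_derivative_along_line) (simp add: frechet_derivative_works[symmetric])
  then show "deriv (\<lambda>t. f (x + t *\<^sub>R v)) 0 = frechet_derivative f (at x) v"
    by (rule DERIV_imp_deriv)
qed

text \<open>The function \<open>pd\<close> takes an arbitrary value where the derivative does not exist; the relation records
  existence as well, so that differentiation rules can be chained without separate differentiability assumptions.\<close>

definition has_pd :: "(real ^ 'n::finite \<Rightarrow> real) \<Rightarrow> real \<Rightarrow> 'n \<Rightarrow> real ^ 'n \<Rightarrow> bool" where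
  "has_pd F d k y \<longleftrightarrow> ((\<lambda>t. F (y + t *\<^sub>R axis k 1)) has_real_derivative d) (at 0)"

lemma has_pd_imp_pd: "has_pd F d k y \<Longrightarrow> pd k F y = d"
  unfolding has_pd_def pd_def by (rule DERIV_imp_deriv)

lemma has_pd_pd: "F differentiable (at y) \<Longrightarrow> has_pd F (pd k F y) k y"
  unfolding has_pd_def pd_def by (simp add: deriv_along_line)

lemma has_pd_smooth: "smooth_on U F \<Longrightarrow> y \<in> U \<Longrightarrow> has_pd F (pd k F y) k y"
  by (simp add: has_pd_pd smooth_on_differentiable)

lemma has_pd_const: "has_pd (\<lambda>_. c) 0 k y"
  by (simp add: has_pd_def)

lemma has_pd_add: "has_pd F d k y \<Longrightarrow> has_pd G e k y \<Longrightarrow> has_pd (\<lambda>z. F z + G z) (d + e) k y"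
  unfolding has_pd_def by (rule DERIV_add)

lemma has_pd_diff: "has_pd F d k y \<Longrightarrow> has_pd G e k y \<Longrightarrow> has_pd (\<lambda>z. F z - G z) (d - e) k y"
  unfolding has_pd_def by (rule DERIV_diff)

lemma has_pd_mult: "has_pd F d k y \<Longrightarrow> has_pd G e k y \<Longrightarrow> has_pd (\<lambda>z. F z * G z) (d * G y + e * F y) k y"
  unfolding has_pd_def using DERIV_mult by fastforce

lemma has_pd_divide:
  "has_pd F d k y \<Longrightarrow> has_pd G e k y \<Longrightarrow> G y \<noteq> 0 \<Longrightarrow>
   has_pd (\<lambda>z. F z / G z) ((d * G y - F y * e) / (G y * G y)) k y"
  unfolding has_pd_def by (auto intro!: derivative_eq_intros)

lemma has_pd_sum:
  "finite I \<Longrightarrow> (\<And>k. k \<in> I \<Longrightarrow> has_pd (H k) (d k) i y) \<Longrightarrow> has_pd (\<lambda>z. \<Sum>k\<in>I. H k z) (\<Sum>k\<in>I. d k) i y"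
  by (induction I rule: finite_induct) (auto intro: has_pd_const has_pd_add)

lemma has_pd_inner: "has_pd (\<lambda>z. b \<bullet> z) (b $ k) k y"
  unfolding has_pd_def inner_add_right
  by (auto intro!: derivative_eq_intros simp: inner_axis)

lemma has_pd_cong:
  assumes "open U" "y \<in> U" "\<And>z. z \<in> U \<Longrightarrow> F z = G z" "has_pd F d k y"
  shows "has_pd G d k y"
proof -
  let ?l = "\<lambda>t. y + t *\<^sub>R axis k (1::real)"
  have "open (?l -` U)"
    by (rule open_vimage[OF assms(1)]) (intro continuous_intros)
  then show ?thesis
    using assms(4) assms(2,3) unfolding has_pd_def
    by (elim has_field_derivative_transform_within_open) auto
qed

lemma pd_cong:
  assumes "open U" "y \<in> U" "\<And>z. z \<in> U \<Longrightarrow> F z = G z" "smooth_on U G"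
  shows "pd k F y = pd k G y"
  using has_pd_cong[OF assms(1,2) assms(3)[symmetric] has_pd_smooth[OF assms(4,2)]]
  by (rule has_pd_imp_pd)

lemma pd_frechet: "F differentiable (at y) \<Longrightarrow> pd k F y = frechet_derivative F (at y) (axis k 1)"
  unfolding pd_def by (rule deriv_along_line)

lemma frechet_derivative_pd:
  assumes "F differentiable (at y)"
  shows "frechet_derivative F (at y) v = (\<Sum>i\<in>UNIV. v $ i * pd i F y)"
proof -
  have lin: "linear (frechet_derivative F (at y))"
    by (rule linear_frechet_derivative[OF assms])
  have "v = (\<Sum>i\<in>UNIV. v $ i *\<^sub>R axis i 1)"
    using basis_expansion[of v] by (simp add: scalar_mult_eq_scaleR)
  then have "frechet_derivative F (at y) v = frechet_derivative F (at y) (\<Sum>i\<in>UNIV. v $ i *\<^sub>R axis i 1)"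
    by simp
  then show ?thesis
    by (simp add: linear_sum[OF lin] linear_scale[OF lin] pd_frechet[OF assms])
qed

lemma smooth_on_pd:
  assumes "open U" "smooth_on U F"
  shows "smooth_on U (pd k F)"
  by (rule smooth_on_cong[OF assms(1) _ smooth_on_frechet_derivative[OF assms(2), of "axis k 1"]])
    (simp add: pd_frechet smooth_on_differentiable[OF assms(2)])

lemma pd_commute:
  assumes U: "open U" "smooth_on U F" "y \<in> U"
  shows "pd i (pd j F) y = pd j (pd i F) y"
proof -
  have "pd i (pd j F) y = frechet_derivative (\<lambda>z. frechet_derivative F (at z) (axis j 1)) (at y) (axis i 1)"
    for i j
  proof -
    have "pd i (pd j F) y = pd i (\<lambda>z. frechet_derivative F (at z) (axis j 1)) y"
      using U by (intro pd_cong[OF U(1,3)]) (auto simp: pd_frechet smooth_on_differentiable smooth_on_frechet_derivative)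
    then show ?thesis
      using smooth_on_differentiable[OF smooth_on_frechet_derivative[OF U(2)] U(3)]
      by (simp add: pd_frechet)
  qed
  then show ?thesis
    using frechet_derivative_commute[OF U] by metis
qed

lemma euler_homogeneous:
  fixes H :: "real ^ 'n::finite \<Rightarrow> real"
  assumes "H differentiable (at y)" "\<And>t. t > 0 \<Longrightarrow> H (t *\<^sub>R y) = t ^ r * H y"
  shows "(\<Sum>i\<in>UNIV. y $ i * pd i H y) = real r * H y"
proof -
  have 1: "((\<lambda>t. H (y + t *\<^sub>R y)) has_real_derivative frechet_derivative H (at y) y) (at 0)"
    by (rule deriv_along_line[OF assms(1)])
  have "((\<lambda>t. (1 + t) ^ r * H y) has_real_derivative real r * H y) (at 0)"
    by (auto intro!: derivative_eq_intros)
  then have "((\<lambda>t. H (y + t *\<^sub>R y)) has_real_derivative real r * H y) (at 0)"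
  proof (rule has_field_derivative_transform_within_open[where S="{-1<..}"])
    fix t :: real assume "t \<in> {-1<..}"
    then have "H ((1 + t) *\<^sub>R y) = (1 + t) ^ r * H y" by (intro assms(2)) auto
    then show "(1 + t) ^ r * H y = H (y + t *\<^sub>R y)" by (simp add: scaleR_left_distrib)
  qed auto
  then have "frechet_derivative H (at y) y = real r * H y"
    using 1 DERIV_unique by blast
  then show ?thesis by (simp add: frechet_derivative_pd[OF assms(1)])
qed

text \<open>Differentiation lowers the degree of homogeneity by one: \<open>H (t (y + u e)) = t\<^sup>r\<^sup>+\<^sup>1 H (y + u e)\<close> is
  differentiated with respect to \<open>u\<close> at \<open>0\<close>.\<close>

lemma pd_homogeneous:
  fixes H :: "real ^ 'n::finite \<Rightarrow> real"
  assumes U: "open U" "smooth_on U H" and cone: "\<And>z t. z \<in> U \<Longrightarrow> t > 0 \<Longrightarrow> t *\<^sub>R z \<in> U"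
    and hom: "\<And>z t. z \<in> U \<Longrightarrow> t > 0 \<Longrightarrow> H (t *\<^sub>R z) = t ^ Suc r * H z"
    and y: "y \<in> U" "t > 0"
  shows "pd k H (t *\<^sub>R y) = t ^ r * pd k H y"
proof -
  have d: "H differentiable (at (t *\<^sub>R y))" "H differentiable (at y)"
    using smooth_on_differentiable[OF U(2)] cone y by auto
  let ?l = "\<lambda>u. y + u *\<^sub>R axis k (1::real)"
  have op: "open (?l -` U)"
    by (rule open_vimage[OF U(1)]) (intro continuous_intros)
  have "((\<lambda>u. H (t *\<^sub>R y + u *\<^sub>R t *\<^sub>R axis k 1)) has_real_derivative
      frechet_derivative H (at (t *\<^sub>R y)) (t *\<^sub>R axis k 1)) (at 0)"
    by (rule deriv_along_line[OF d(1)])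
  then have "((\<lambda>u. t ^ Suc r * H (?l u)) has_real_derivative
      frechet_derivative H (at (t *\<^sub>R y)) (t *\<^sub>R axis k 1)) (at 0)"
    using op
  proof (rule has_field_derivative_transform_within_open)
    fix u assume "u \<in> ?l -` U"
    then have "H (t *\<^sub>R ?l u) = t ^ Suc r * H (?l u)" using hom y(2) by auto
    then show "H (t *\<^sub>R y + u *\<^sub>R t *\<^sub>R axis k 1) = t ^ Suc r * H (?l u)"
      by (simp add: scaleR_right_distrib mult.commute)
  qed (use y in auto)
  moreover have "((\<lambda>u. t ^ Suc r * H (?l u)) has_real_derivative t ^ Suc r * frechet_derivative H (at y) (axis k 1)) (at 0)"
    by (rule DERIV_cmult[OF deriv_along_line(1)[OF d(2)]])
  ultimately have "frechet_derivative H (at (t *\<^sub>R y)) (t *\<^sub>R axis k 1) = t ^ Suc r * pd k H y"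
    using DERIV_unique pd_frechet[OF d(2)] by metis
  moreover have "frechet_derivative H (at (t *\<^sub>R y)) (t *\<^sub>R axis k 1) = t * pd k H (t *\<^sub>R y)"
    using linear_scale[OF linear_frechet_derivative[OF d(1)]] by (simp add: pd_frechet[OF d(1)])
  ultimately show ?thesis using y(2) by simp
qed

section \<open>Homogeneous functions of two variables\<close>

abbreviation uncurry2 :: "(real \<Rightarrow> real \<Rightarrow> real) \<Rightarrow> real \<times> real \<Rightarrow> real" where
  "uncurry2 g \<equiv> \<lambda>(a, t). g a t"

lemma
  assumes "uncurry2 g differentiable (at (a, t))"
  shows D1_frechet: "D1 g a t = frechet_derivative (uncurry2 g) (at (a, t)) (1, 0)"
    and D2_frechet: "D2 g a t = frechet_derivative (uncurry2 g) (at (a, t)) (0, 1)"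
proof -
  have "((\<lambda>u. uncurry2 g ((0, t) + u *\<^sub>R (1, 0))) has_real_derivative
      frechet_derivative (uncurry2 g) (at (a, t)) (1, 0)) (at a)"
    using assms by (intro has_derivative_along_line) (simp add: frechet_derivative_works[symmetric])
  then show "D1 g a t = frechet_derivative (uncurry2 g) (at (a, t)) (1, 0)"
    unfolding D1_def by (intro DERIV_imp_deriv) simp
  have "((\<lambda>u. uncurry2 g ((a, 0) + u *\<^sub>R (0, 1))) has_real_derivative
      frechet_derivative (uncurry2 g) (at (a, t)) (0, 1)) (at t)"
    using assms by (intro has_derivative_along_line) (simp add: frechet_derivative_works[symmetric])
  then show "D2 g a t = frechet_derivative (uncurry2 g) (at (a, t)) (0, 1)"
    unfolding D2_def by (intro DERIV_imp_deriv) simp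
qed

lemma smooth_on_D1:
  assumes "open \<Omega>" "smooth_on \<Omega> (uncurry2 g)"
  shows "smooth_on \<Omega> (uncurry2 (D1 g))"
proof (rule smooth_on_cong[OF assms(1) _ smooth_on_frechet_derivative[OF assms(2)]])
  fix x assume "x \<in> \<Omega>"
  then show "frechet_derivative (uncurry2 g) (at x) (1, 0) = uncurry2 (D1 g) x"
    using D1_frechet[of g "fst x" "snd x"] smooth_on_differentiable[OF assms(2)] by (simp add: case_prod_beta')
qed

lemma smooth_on_D2:
  assumes "open \<Omega>" "smooth_on \<Omega> (uncurry2 g)"
  shows "smooth_on \<Omega> (uncurry2 (D2 g))"
proof (rule smooth_on_cong[OF assms(1) _ smooth_on_frechet_derivative[OF assms(2)]])
  fix x assume "x \<in> \<Omega>"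
  then show "frechet_derivative (uncurry2 g) (at x) (0, 1) = uncurry2 (D2 g) x"
    using D2_frechet[of g "fst x" "snd x"] smooth_on_differentiable[OF assms(2)] by (simp add: case_prod_beta')
qed

lemma DERIV_uncurry2:
  assumes "smooth_on \<Omega> (uncurry2 g)" "(A u, T u) \<in> \<Omega>"
    and "(A has_real_derivative a') (at u)" "(T has_real_derivative t') (at u)"
  shows "((\<lambda>u. g (A u) (T u)) has_real_derivative D1 g (A u) (T u) * a' + D2 g (A u) (T u) * t') (at u)"
proof -
  let ?g' = "frechet_derivative (uncurry2 g) (at (A u, T u))"
  have d: "uncurry2 g differentiable (at (A u, T u))"
    using smooth_on_differentiable assms(1,2) by blast
  have lin: "linear ?g'" by (rule linear_frechet_derivative[OF d])
  have "((\<lambda>u. (A u, T u)) has_derivative (\<lambda>h. (a' * h, t' * h))) (at u)"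
    using assms(3,4) by (intro has_derivative_Pair) (auto simp: has_field_derivative_def)
  then have "((\<lambda>u. uncurry2 g (A u, T u)) has_derivative (\<lambda>h. ?g' (a' * h, t' * h))) (at u)"
    by (rule has_derivative_compose) (use d frechet_derivative_works in auto)
  moreover have "?g' (a' * h, t' * h) = (D1 g (A u) (T u) * a' + D2 g (A u) (T u) * t') * h" for h
  proof -
    have "(a' * h, t' * h) = (a' * h) *\<^sub>R (1, 0) + (t' * h) *\<^sub>R (0, 1)" by simp
    then have "?g' (a' * h, t' * h) = (a' * h) *\<^sub>R ?g' (1, 0) + (t' * h) *\<^sub>R ?g' (0, 1)"
      by (metis linear_add[OF lin] linear_scale[OF lin])
    then show ?thesis by (simp add: D1_frechet[OF d] D2_frechet[OF d] algebra_simps)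
  qed
  ultimately show ?thesis by (simp add: has_field_derivative_def)
qed

lemma DERIV_D1:
  assumes "smooth_on \<Omega> (uncurry2 g)" "(a, t) \<in> \<Omega>"
  shows "((\<lambda>u. g u t) has_real_derivative D1 g a t) (at a)"
  using DERIV_uncurry2[of \<Omega> g "\<lambda>u. u" a "\<lambda>_. t" 1 0] assms by simp

lemma DERIV_D2:
  assumes "smooth_on \<Omega> (uncurry2 g)" "(a, t) \<in> \<Omega>"
  shows "((\<lambda>u. g a u) has_real_derivative D2 g a t) (at t)"
  using DERIV_uncurry2[of \<Omega> g "\<lambda>_. a" t "\<lambda>u. u" 0 1] assms by simp

lemma has_pd_compose2:
  assumes "smooth_on \<Omega> (uncurry2 g)" "(A y, T y) \<in> \<Omega>" "has_pd A a' k y" "has_pd T t' k y"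
  shows "has_pd (\<lambda>z. g (A z) (T z)) (D1 g (A y) (T y) * a' + D2 g (A y) (T y) * t') k y"
  using DERIV_uncurry2[OF assms(1), of "\<lambda>t. A (y + t *\<^sub>R axis k 1)" 0 "\<lambda>t. T (y + t *\<^sub>R axis k 1)"] assms(2-)
  unfolding has_pd_def by simp

lemma open_line_sections:
  fixes \<Omega> :: "(real \<times> real) set"
  assumes "open \<Omega>"
  shows "open {u. (u, t) \<in> \<Omega>}" and "open {u. (a, u) \<in> \<Omega>}"
proof -
  have "open ((\<lambda>u. (u, t)) -` \<Omega>)" "open ((\<lambda>u. (a, u)) -` \<Omega>)"
    by (rule open_vimage[OF assms]; intro continuous_intros)+
  then show "open {u. (u, t) \<in> \<Omega>}" "open {u. (a, u) \<in> \<Omega>}" by (auto simp: vimage_def)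
qed

lemma D1_cong:
  assumes "open \<Omega>" "\<And>a t. (a, t) \<in> \<Omega> \<Longrightarrow> g a t = h a t" "(a, t) \<in> \<Omega>" "smooth_on \<Omega> (uncurry2 g)"
  shows "((\<lambda>u. h u t) has_real_derivative D1 g a t) (at a)" and "D1 h a t = D1 g a t"
proof -
  show *: "((\<lambda>u. h u t) has_real_derivative D1 g a t) (at a)"
    using DERIV_D1[OF assms(4,3)] open_line_sections(1)[OF assms(1), of t] assms(2,3)
    by (elim has_field_derivative_transform_within_open) auto
  then show "D1 h a t = D1 g a t" unfolding D1_def by (rule DERIV_imp_deriv)
qed

lemma D2_cong:
  assumes "open \<Omega>" "\<And>a t. (a, t) \<in> \<Omega> \<Longrightarrow> g a t = h a t" "(a, t) \<in> \<Omega>" "smooth_on \<Omega> (uncurry2 g)"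
  shows "((\<lambda>u. h a u) has_real_derivative D2 g a t) (at t)" and "D2 h a t = D2 g a t"
proof -
  show *: "((\<lambda>u. h a u) has_real_derivative D2 g a t) (at t)"
    using DERIV_D2[OF assms(4,3)] open_line_sections(2)[OF assms(1), of a] assms(2,3)
    by (elim has_field_derivative_transform_within_open) auto
  then show "D2 h a t = D2 g a t" unfolding D2_def by (rule DERIV_imp_deriv)
qed

text \<open>The operators \<open>D1\<close> and \<open>D2\<close> are directional derivatives of the function on pairs, so this is an
  instance of the symmetry of second derivatives.\<close>

lemma D1_D2_commute:
  assumes O: "open \<Omega>" "smooth_on \<Omega> (uncurry2 g)" and x: "(a, t) \<in> \<Omega>"
  shows "D1 (D2 g) a t = D2 (D1 g) a t"
proof -
  let ?d = "\<lambda>v. \<lambda>a t. frechet_derivative (uncurry2 g) (at (a, t)) v"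
  have sm: "smooth_on \<Omega> (uncurry2 (?d v))" for v
    using smooth_on_frechet_derivative[OF O(2), of v] by (simp add: case_prod_beta')
  have "D1 (D2 g) a t = D1 (?d (0, 1)) a t"
    by (rule D1_cong(2)[OF O(1) _ x sm]) (simp add: D2_frechet smooth_on_differentiable[OF O(2)])
  moreover have "D2 (D1 g) a t = D2 (?d (1, 0)) a t"
    by (rule D2_cong(2)[OF O(1) _ x sm]) (simp add: D1_frechet smooth_on_differentiable[OF O(2)])
  moreover have "D1 (?d (0, 1)) a t = D2 (?d (1, 0)) a t"
    using frechet_derivative_commute[OF O x, of "(0,1)" "(1,0)"]
      D1_frechet[OF smooth_on_differentiable[OF sm x]] D2_frechet[OF smooth_on_differentiable[OF sm x]]
    by (simp add: case_prod_beta')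
  ultimately show ?thesis by simp
qed

text \<open>The setting for \<open>f\<close>. Euler's relation for \<open>f\<close> and its derivatives determine the derivatives with
  respect to the first argument from \<open>f\<close> and those with respect to the second one; all later simplifications
  of scalars rest on this.\<close>

locale homogeneous2 =
  fixes \<Omega> :: "(real \<times> real) set" and f :: "real \<Rightarrow> real \<Rightarrow> real"
  assumes open_\<Omega>: "open \<Omega>" and smooth_f: "smooth_on \<Omega> (uncurry2 f)"
    and hom_f: "(a, t) \<in> \<Omega> \<Longrightarrow> r > 0 \<Longrightarrow> f (r * a) (r * t) = r * f a t"
begin

abbreviation "f1 \<equiv> D1 f"
abbreviation "f2 \<equiv> D2 f"
abbreviation "f11 \<equiv> D1 (D1 f)"
abbreviation "f12 \<equiv> D2 (D1 f)"
abbreviation "f22 \<equiv> D2 (D2 f)"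
abbreviation "f122 \<equiv> D1 (D2 (D2 f))"
abbreviation "f222 \<equiv> D2 (D2 (D2 f))"

lemmas smooth_Ds = smooth_f
  smooth_on_D1[OF open_\<Omega> smooth_f] smooth_on_D2[OF open_\<Omega> smooth_f]
  smooth_on_D1[OF open_\<Omega> smooth_on_D1[OF open_\<Omega> smooth_f]]
  smooth_on_D2[OF open_\<Omega> smooth_on_D1[OF open_\<Omega> smooth_f]]
  smooth_on_D2[OF open_\<Omega> smooth_on_D2[OF open_\<Omega> smooth_f]]

lemmas DERIV_f_1 = smooth_Ds[THEN DERIV_D1]
lemmas DERIV_f_2 = smooth_Ds[THEN DERIV_D2]

lemma euler_f:
  assumes x: "(a, t) \<in> \<Omega>"
  shows "a * f1 a t + t * f2 a t = f a t"
proof -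
  have "((\<lambda>u. f (u * a) (u * t)) has_real_derivative f1 (1 * a) (1 * t) * a + f2 (1 * a) (1 * t) * t) (at 1)"
    using x by (intro DERIV_uncurry2[OF smooth_f]) (auto intro!: derivative_eq_intros)
  moreover have "((\<lambda>u. f (u * a) (u * t)) has_real_derivative f a t) (at 1)"
  proof (rule has_field_derivative_transform_within_open[where S="{0<..}"])
    show "((\<lambda>u. u * f a t) has_real_derivative f a t) (at 1)" by (auto intro!: derivative_eq_intros)
  qed (auto simp: hom_f[OF x])
  ultimately have "f1 (1 * a) (1 * t) * a + f2 (1 * a) (1 * t) * t = f a t"
    by (rule DERIV_unique)
  then show ?thesis by (simp add: mult.commute)
qed

text \<open>This allows an identity that is valid on \<open>\<Omega>\<close> to be differentiated along a line.\<close>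

lemma zero_derivative:
  assumes "open S" "x \<in> S" "\<And>u. u \<in> S \<Longrightarrow> H u = (0::real)" "(H has_real_derivative d) (at x)"
  shows "d = 0"
proof -
  have "(H has_real_derivative 0) (at x)"
    using assms(1-3) by (intro has_field_derivative_transform_within_open[of "\<lambda>_. 0" 0 x S H]) auto
  then show ?thesis using assms(4) DERIV_unique by blast
qed

lemma euler_f1:
  assumes x: "(a, t) \<in> \<Omega>"
  shows "a * f11 a t + t * f12 a t = 0"
proof -
  have "((\<lambda>u. u * f1 u t + t * f2 u t - f u t) has_real_derivative
      (1 * f1 a t + f11 a t * a) + t * D1 f2 a t - f1 a t) (at a)"
    using x by (intro DERIV_diff DERIV_add DERIV_mult DERIV_cmult DERIV_ident DERIV_f_1)
  then have "(1 * f1 a t + f11 a t * a) + t * D1 f2 a t - f1 a t = 0"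
    by (rule zero_derivative[OF open_line_sections(1)[OF open_\<Omega>, of t], rotated 2])
      (simp_all add: x euler_f)
  then show ?thesis by (simp add: D1_D2_commute[OF open_\<Omega> smooth_f x] algebra_simps)
qed

lemma euler_f2:
  assumes x: "(a, t) \<in> \<Omega>"
  shows "a * f12 a t + t * f22 a t = 0"
proof -
  have "((\<lambda>u. a * f1 a u + u * f2 a u - f a u) has_real_derivative
      a * f12 a t + (1 * f2 a t + f22 a t * t) - f2 a t) (at t)"
    using x by (intro DERIV_diff DERIV_add DERIV_mult DERIV_cmult DERIV_ident DERIV_f_2)
  then have "a * f12 a t + (1 * f2 a t + f22 a t * t) - f2 a t = 0"
    by (rule zero_derivative[OF open_line_sections(2)[OF open_\<Omega>, of a], rotated 2])
      (simp_all add: x euler_f)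
  then show ?thesis by (simp add: algebra_simps)
qed

lemma euler_f22:
  assumes x: "(a, t) \<in> \<Omega>"
  shows "a * f122 a t + t * f222 a t = - f22 a t"
proof -
  have "((\<lambda>u. a * f12 a u + u * f22 a u) has_real_derivative
      a * D2 f12 a t + (1 * f22 a t + f222 a t * t)) (at t)"
    using x by (intro DERIV_diff DERIV_add DERIV_mult DERIV_cmult DERIV_ident DERIV_f_2)
  then have "a * D2 f12 a t + (1 * f22 a t + f222 a t * t) = 0"
    by (rule zero_derivative[OF open_line_sections(2)[OF open_\<Omega>, of a], rotated 2])
      (simp_all add: x euler_f2)
  moreover have "D2 f12 a t = D2 (D1 f2) a t"
    by (rule D2_cong(2)[OF open_\<Omega> D1_D2_commute[OF open_\<Omega> smooth_f] x smooth_on_D1[OF open_\<Omega> smooth_Ds(3)]])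
  moreover have "D2 (D1 f2) a t = f122 a t"
    using D1_D2_commute[OF open_\<Omega> smooth_Ds(3) x] by simp
  ultimately show ?thesis by (simp add: algebra_simps)
qed

lemma smooth_q0_fun: "smooth_on \<Omega> (uncurry2 (q0_fun f))"
  using smooth_on_mult[OF open_\<Omega> smooth_f smooth_Ds(6)] by (simp add: q0_fun_def case_prod_beta')

lemma smooth_p0_fun: "smooth_on \<Omega> (uncurry2 (p0_fun f))"
  using smooth_on_add[OF open_\<Omega> smooth_on_power[OF open_\<Omega> smooth_Ds(3), of 2] smooth_q0_fun]
  by (simp add: p0_fun_def case_prod_beta')

lemma D_q0:
  assumes x: "(a, t) \<in> \<Omega>"
  shows "D1 (q0_fun f) a t = f1 a t * f22 a t + f122 a t * f a t"
    and "D2 (q0_fun f) a t = f2 a t * f22 a t + f222 a t * f a t"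
  unfolding D1_def[of "q0_fun f"] D2_def[of "q0_fun f"] q0_fun_def
  by (rule DERIV_imp_deriv[OF DERIV_mult[OF DERIV_f_1(1)[OF x] DERIV_f_1(6)[OF x]]]
      DERIV_imp_deriv[OF DERIV_mult[OF DERIV_f_2(1)[OF x] DERIV_f_2(6)[OF x]]])+

lemma euler_q0:
  assumes x: "(a, t) \<in> \<Omega>"
  shows "a * D1 (q0_fun f) a t + t * D2 (q0_fun f) a t = 0"
proof -
  have "a * D1 (q0_fun f) a t + t * D2 (q0_fun f) a t =
      (a * f1 a t + t * f2 a t) * f22 a t + (a * f122 a t + t * f222 a t) * f a t"
    by (simp add: D_q0[OF x] algebra_simps)
  then show ?thesis by (simp add: euler_f[OF x] euler_f22[OF x])
qed

lemma p02_fun_eq: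
  assumes x: "(a, t) \<in> \<Omega>"
  shows "p02_fun f a t = 2 * f2 a t * f22 a t + D2 (q0_fun f) a t"
proof -
  have "((\<lambda>u. f2 a u * f2 a u + q0_fun f a u) has_real_derivative
     f22 a t * f2 a t + f22 a t * f2 a t + D2 (q0_fun f) a t) (at t)"
    using x by (intro DERIV_add DERIV_mult DERIV_f_2 DERIV_D2[OF smooth_q0_fun])
  then show ?thesis
    unfolding p02_fun_def D2_def[of "p0_fun f"] p0_fun_def
    by (intro DERIV_imp_deriv) (simp add: power2_eq_square mult_ac)
qed

end

section \<open>Inverse matrices\<close>

lemma matrix_inv_works:
  assumes "invertible (A :: real ^ 'n ^ 'n)"
  shows "A ** matrix_inv A = mat 1" and "matrix_inv A ** A = mat 1"
  using assms unfolding invertible_def matrix_inv_def by (metis (mono_tags, lifting) someI_ex)+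

lemma matrix_inv_sum:
  assumes "invertible (A :: real ^ 'n::finite ^ 'n)"
  shows "(\<Sum>i\<in>UNIV. matrix_inv A $ j $ i * (\<Sum>l\<in>UNIV. A $ i $ l * v l)) = v j"
    and "(\<Sum>l\<in>UNIV. A $ i $ l * matrix_inv A $ l $ k) = (if i = k then 1 else 0)"
    and "(\<Sum>l\<in>UNIV. matrix_inv A $ i $ l * A $ l $ k) = (if i = k then 1 else 0)"
proof -
  have "matrix_inv A *v (A *v (\<chi> l. v l)) = (\<chi> l. v l)"
    by (simp add: matrix_vector_mul_assoc matrix_inv_works[OF assms])
  then show "(\<Sum>i\<in>UNIV. matrix_inv A $ j $ i * (\<Sum>l\<in>UNIV. A $ i $ l * v l)) = v j"
    by (simp add: matrix_vector_mult_def vec_eq_iff)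
  show "(\<Sum>l\<in>UNIV. A $ i $ l * matrix_inv A $ l $ k) = (if i = k then 1 else 0)"
    using arg_cong[OF matrix_inv_works(1)[OF assms], of "\<lambda>X. X $ i $ k"]
    by (simp add: matrix_matrix_mult_def mat_def)
  show "(\<Sum>l\<in>UNIV. matrix_inv A $ i $ l * A $ l $ k) = (if i = k then 1 else 0)"
    using arg_cong[OF matrix_inv_works(2)[OF assms], of "\<lambda>X. X $ i $ k"]
    by (simp add: matrix_matrix_mult_def mat_def)
qed

lemma matrix_inv_sym:
  assumes A: "invertible (A :: real ^ 'n::finite ^ 'n)" and sym: "\<And>i j. A $ i $ j = A $ j $ i"
  shows "matrix_inv A $ j $ k = matrix_inv A $ k $ j"
proof -
  have "transpose A = A" using sym by (simp add: transpose_def vec_eq_iff)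
  then have "transpose (matrix_inv A) ** A = mat 1"
    using matrix_inv_works(1)[OF A] by (metis matrix_transpose_mul transpose_mat)
  then have "transpose (matrix_inv A) = matrix_inv A"
    using matrix_inv_works(1)[OF A] by (metis matrix_mul_assoc matrix_mul_lid matrix_mul_rid)
  then have "transpose (matrix_inv A) $ j $ k = matrix_inv A $ j $ k" by simp
  then show ?thesis by (simp add: transpose_def)
qed

text \<open>A contraction with the inverse of \<open>A\<close> can be computed from an approximate inverse \<open>X\<close>. Multiplying the
  hypothesis on \<open>X\<close> by the inverse shows that \<open>X\<close> differs from it by terms with a factor \<open>y\<close> in the second
  index or \<open>w\<close> in the first index, and \<open>K\<close> annihilates these.\<close>

lemma trace_matrix_inv_modulo:
  fixes A :: "real ^ 'n::finite ^ 'n"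
  assumes A: "invertible A"
    and AX: "\<And>i k. (\<Sum>j\<in>UNIV. A $ i $ j * X j k) =
      (if i = k then 1 else 0) + \<alpha> i * y k + (\<Sum>j\<in>UNIV. A $ i $ j * w j) * \<nu> k"
    and K: "\<And>j. (\<Sum>k\<in>UNIV. K j k * y k) = 0" "\<And>k. (\<Sum>j\<in>UNIV. K j k * w j) = 0"
  shows "(\<Sum>j\<in>UNIV. \<Sum>k\<in>UNIV. K j k * matrix_inv A $ j $ k) = (\<Sum>j\<in>UNIV. \<Sum>k\<in>UNIV. K j k * X j k)"
proof -
  define \<gamma> where "\<gamma> j = (\<Sum>i\<in>UNIV. matrix_inv A $ j $ i * \<alpha> i)" for j
  have X: "X j k = matrix_inv A $ j $ k + \<gamma> j * y k + w j * \<nu> k" for j k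
  proof -
    have "X j k = (\<Sum>i\<in>UNIV. matrix_inv A $ j $ i * (\<Sum>l\<in>UNIV. A $ i $ l * X l k))"
      by (rule matrix_inv_sum(1)[OF A, symmetric])
    also have "\<dots> = (\<Sum>i\<in>UNIV. matrix_inv A $ j $ i * (if i = k then 1 else 0) +
        matrix_inv A $ j $ i * \<alpha> i * y k + matrix_inv A $ j $ i * (\<Sum>l\<in>UNIV. A $ i $ l * w l) * \<nu> k)"
      by (simp only: AX) (simp only: distrib_left mult.assoc)
    also have "\<dots> = matrix_inv A $ j $ k + \<gamma> j * y k + w j * \<nu> k"
      by (simp add: sum.distrib sum_distrib_right[symmetric] matrix_inv_sum(1)[OF A] if_distrib[of "(*) _"] \<gamma>_def cong: if_cong)
    finally show ?thesis .
  qed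
  have "(\<Sum>j\<in>UNIV. \<Sum>k\<in>UNIV. K j k * X j k) = (\<Sum>j\<in>UNIV. \<Sum>k\<in>UNIV. K j k * matrix_inv A $ j $ k)
      + (\<Sum>j\<in>UNIV. \<gamma> j * (\<Sum>k\<in>UNIV. K j k * y k)) + (\<Sum>j\<in>UNIV. \<Sum>k\<in>UNIV. K j k * w j * \<nu> k)"
    by (simp add: X sum.distrib sum_distrib_left algebra_simps)
  moreover have "(\<Sum>j\<in>UNIV. \<Sum>k\<in>UNIV. K j k * w j * \<nu> k) = (\<Sum>k\<in>UNIV. (\<Sum>j\<in>UNIV. K j k * w j) * \<nu> k)"
    by (subst sum.swap) (simp add: sum_distrib_right)
  ultimately show ?thesis using K by simp
qed

lemma matrix_inv_unique:
  assumes "A ** B = mat 1" shows "matrix_inv (A :: real ^ 'n::finite ^ 'n) = B"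
proof -
  have "invertible A"
    using assms matrix_left_right_inverse[of A B] unfolding invertible_def by auto
  then show ?thesis
    using assms matrix_inv_works[of A] by (metis matrix_mul_assoc matrix_mul_lid matrix_mul_rid)
qed

text \<open>The inverse of a bilinear form transforms contravariantly.\<close>

lemma matrix_inv_congruence:
  fixes J A :: "real ^ 'n::finite ^ 'n"
  assumes "invertible J" "invertible A"
  shows "matrix_inv (transpose J ** A ** J) = matrix_inv J ** matrix_inv A ** transpose (matrix_inv J)"
proof (rule matrix_inv_unique)
  have T: "transpose J ** transpose (matrix_inv J) = mat 1"
    using matrix_inv_works(2)[OF assms(1)] by (metis matrix_transpose_mul transpose_mat)
  have "transpose J ** A ** J ** (matrix_inv J ** matrix_inv A ** transpose (matrix_inv J)) =
     transpose J ** (A ** (J ** matrix_inv J) ** matrix_inv A) ** transpose (matrix_inv J)"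
    by (simp add: matrix_mul_assoc)
  also have "\<dots> = mat 1"
    by (simp add: matrix_inv_works assms T)
  finally show "transpose J ** A ** J ** (matrix_inv J ** matrix_inv A ** transpose (matrix_inv J)) = mat 1" .
qed

lemma inner_transpose: "(transpose J *v u) \<bullet> v = u \<bullet> (J *v v)" for J :: "real ^ 'n::finite ^ 'm::finite"
  by (metis dot_lmul_matrix transpose_matrix_vector)

section \<open>Finsler tensors at a point\<close>

text \<open>The Finsler function of a single tangent space, on the cone of admissible directions there.\<close>

locale finsler_cone =
  fixes U :: "(real ^ 'n::finite) set" and F :: "real ^ 'n \<Rightarrow> real"
  assumes open_U: "open U" and smooth_F: "smooth_on U F"
    and pos_F: "y \<in> U \<Longrightarrow> F y > 0"
    and cone_U: "y \<in> U \<Longrightarrow> t > 0 \<Longrightarrow> t *\<^sub>R y \<in> U"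
    and hom_F: "y \<in> U \<Longrightarrow> t > 0 \<Longrightarrow> F (t *\<^sub>R y) = t * F y"
begin

lemma smooth_F2: "smooth_on U (\<lambda>z. (F z)\<^sup>2)"
  by (rule smooth_on_power[OF open_U smooth_F])

lemmas smooth_pd_F = smooth_on_pd[OF open_U smooth_F]
lemmas smooth_pd2_F2 = smooth_on_pd[OF open_U smooth_on_pd[OF open_U smooth_F2]]

lemma smooth_metric: "smooth_on U (\<lambda>z. metric F z $ i $ j)"
  unfolding metric_def vec_lambda_beta by (rule smooth_on_mult[OF open_U smooth_on_const smooth_pd2_F2])

text \<open>The form \<open>l\<^sub>i l\<^sub>j + F \<partial>\<^sub>i\<partial>\<^sub>jF\<close> of the metric identifies \<open>h\<^sub>i\<^sub>j\<close> with \<open>F \<partial>\<^sub>i\<partial>\<^sub>jF\<close>, which gives the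
  derivative of \<open>l\<close>.\<close>

lemma metric_eq:
  assumes y: "y \<in> U"
  shows "metric F y $ i $ j = pd i F y * pd j F y + F y * pd i (pd j F) y"
proof -
  have "pd j (\<lambda>z. (F z)\<^sup>2) z = 2 * (F z * pd j F z)" if "z \<in> U" for z
    using has_pd_imp_pd[OF has_pd_mult[OF has_pd_smooth[OF smooth_F that] has_pd_smooth[OF smooth_F that], of j]]
    by (simp add: power2_eq_square)
  moreover have "smooth_on U (\<lambda>z. 2 * (F z * pd j F z))"
    by (intro smooth_on_mult[OF open_U] smooth_on_const smooth_F smooth_pd_F)
  ultimately have "pd i (pd j (\<lambda>z. (F z)\<^sup>2)) y = pd i (\<lambda>z. 2 * (F z * pd j F z)) y"
    by (intro pd_cong[OF open_U y])
  also have "\<dots> = 2 * (pd i F y * pd j F y + F y * pd i (pd j F) y)"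
    using has_pd_imp_pd[OF has_pd_mult[OF has_pd_const[of 2]
          has_pd_mult[OF has_pd_smooth[OF smooth_F y] has_pd_smooth[OF smooth_pd_F y]], of j i]]
    by (simp add: algebra_simps)
  finally show ?thesis by (simp add: metric_def)
qed

lemma pd2_sym: "y \<in> U \<Longrightarrow> pd i (pd j F) y = pd j (pd i F) y"
  by (rule pd_commute[OF open_U smooth_F])

lemma metric_sym: "y \<in> U \<Longrightarrow> metric F y $ i $ j = metric F y $ j $ i"
  by (simp add: metric_eq pd2_sym)

lemma F_nonzero: "y \<in> U \<Longrightarrow> F y \<noteq> 0"
  using pos_F by fastforce

lemma angular_eq: "y \<in> U \<Longrightarrow> angular_metric F y $ i $ j = F y * pd i (pd j F) y"
  by (simp add: angular_metric_def metric_eq)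

lemma angular_sym: "y \<in> U \<Longrightarrow> angular_metric F y $ i $ j = angular_metric F y $ j $ i"
  by (simp add: angular_eq pd2_sym)

lemma euler_F: "y \<in> U \<Longrightarrow> (\<Sum>i\<in>UNIV. y $ i * pd i F y) = F y"
  using euler_homogeneous[of F y 1] hom_F smooth_on_differentiable[OF smooth_F] by simp

lemma euler_pd_F:
  assumes y: "y \<in> U" shows "(\<Sum>j\<in>UNIV. y $ j * pd i (pd j F) y) = 0"
proof -
  have "pd i F (t *\<^sub>R y) = t ^ 0 * pd i F y" if "t > 0" for t
    using that y by (intro pd_homogeneous[OF open_U smooth_F]) (simp_all add: cone_U hom_F)
  then have "(\<Sum>j\<in>UNIV. y $ j * pd j (pd i F) y) = real 0 * pd i F y"
    using smooth_on_differentiable[OF smooth_pd_F y] by (intro euler_homogeneous) auto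
  then show ?thesis using pd2_sym[OF y, of i] by simp
qed

lemma angular_y: "y \<in> U \<Longrightarrow> (\<Sum>j\<in>UNIV. angular_metric F y $ i $ j * y $ j) = 0"
  using euler_pd_F[of y i]
  by (simp add: angular_eq mult.assoc mult.commute[of "pd i _ y"] sum_distrib_left[symmetric])

lemma metric_y: "y \<in> U \<Longrightarrow> (\<Sum>j\<in>UNIV. metric F y $ i $ j * y $ j) = F y * pd i F y"
proof -
  assume y: "y \<in> U"
  have "(\<Sum>j\<in>UNIV. metric F y $ i $ j * y $ j) =
      (\<Sum>j\<in>UNIV. angular_metric F y $ i $ j * y $ j) + pd i F y * (\<Sum>j\<in>UNIV. y $ j * pd j F y)"
    by (simp add: angular_metric_def algebra_simps sum.distrib sum_subtractf sum_distrib_left)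
  then show ?thesis by (simp add: angular_y[OF y] euler_F[OF y])
qed

lemma y_low_eq: "y \<in> U \<Longrightarrow> y_low F y $ i = F y * pd i F y"
  by (simp add: y_low_def metric_y)

lemma has_pd_F: "y \<in> U \<Longrightarrow> has_pd F (pd k F y) k y"
  by (rule has_pd_smooth[OF smooth_F])

lemma has_pd_l: "y \<in> U \<Longrightarrow> has_pd (pd i F) (angular_metric F y $ i $ k / F y) k y"
  using has_pd_smooth[OF smooth_pd_F, of y i k] by (simp add: angular_eq pd2_sym[of y k i] F_nonzero)

lemma has_pd_metric: "y \<in> U \<Longrightarrow> has_pd (\<lambda>z. metric F z $ i $ j) (2 * cartan F y i j k) k y"
  using has_pd_smooth[OF smooth_metric, of y i j k] by (simp add: cartan_def)

lemma has_pd_angular: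
  assumes y: "y \<in> U"
  shows "has_pd (\<lambda>z. angular_metric F z $ i $ j) (2 * cartan F y i j k -
    (angular_metric F y $ i $ k * pd j F y + pd i F y * angular_metric F y $ j $ k) / F y) k y"
proof -
  have "has_pd (\<lambda>z. metric F z $ i $ j - pd i F z * pd j F z) (2 * cartan F y i j k -
      (angular_metric F y $ i $ k / F y * pd j F y + angular_metric F y $ j $ k / F y * pd i F y)) k y"
    by (intro has_pd_diff has_pd_metric has_pd_mult has_pd_l y)
  then show ?thesis
    by (simp add: add_divide_distrib mult.commute angular_metric_def)
qed

lemma cartan_eq:
  assumes y: "y \<in> U" shows "cartan F y i j k = 1/4 * pd k (pd i (pd j (\<lambda>z. (F z)\<^sup>2))) y"
  using has_pd_imp_pd[OF has_pd_mult[OF has_pd_const[of "1/2"] has_pd_smooth[OF smooth_pd2_F2 y, of i j k]]]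
  by (simp add: cartan_def metric_def)

lemma cartan_sym12: "y \<in> U \<Longrightarrow> cartan F y i j k = cartan F y j i k"
  unfolding cartan_def using metric_sym smooth_metric by (simp add: pd_cong[OF open_U, of y "\<lambda>z. metric F z $ i $ j" "\<lambda>z. metric F z $ j $ i"])

lemma cartan_sym13: "y \<in> U \<Longrightarrow> cartan F y i j k = cartan F y k j i"
  by (simp add: cartan_eq pd_commute[OF open_U smooth_on_pd[OF open_U smooth_F2], of y k i])

lemma cartan_sym23: "y \<in> U \<Longrightarrow> cartan F y i j k = cartan F y i k j"
  using cartan_sym12 cartan_sym13 by metis

text \<open>The metric is homogeneous of degree \<open>0\<close>, being the second derivative of \<open>F\<^sup>2/2\<close>.\<close>

lemma cartan_y:
  assumes y: "y \<in> U" shows "(\<Sum>k\<in>UNIV. cartan F y i j k * y $ k) = 0"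
proof -
  have 1: "pd j (\<lambda>z. (F z)\<^sup>2) (t *\<^sub>R z) = t ^ Suc 0 * pd j (\<lambda>z. (F z)\<^sup>2) z" if "z \<in> U" "t > 0" for z t
    by (intro pd_homogeneous[OF open_U smooth_F2 _ _ that])
      (simp_all add: cone_U hom_F power2_eq_square)
  have "pd i (pd j (\<lambda>z. (F z)\<^sup>2)) (t *\<^sub>R y) = t ^ 0 * pd i (pd j (\<lambda>z. (F z)\<^sup>2)) y" if "t > 0" for t
    by (intro pd_homogeneous[OF open_U smooth_on_pd[OF open_U smooth_F2] _ 1 y that]) (simp_all add: cone_U)
  then have "(\<Sum>k\<in>UNIV. y $ k * pd k (\<lambda>z. metric F z $ i $ j) y) = real 0 * metric F y $ i $ j"
    using smooth_on_differentiable[OF smooth_metric y] by (intro euler_homogeneous) (auto simp: metric_def)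
  then show ?thesis
    by (simp add: cartan_def sum_distrib_left[symmetric] sum_divide_distrib[symmetric] mult.commute)
qed

lemma m_cov_eq: "y \<in> U \<Longrightarrow> m_cov b F y $ i = b $ i - (b \<bullet> y) / F y * pd i F y"
  by (simp add: m_cov_def y_low_eq power2_eq_square F_nonzero)

lemma m_y: "y \<in> U \<Longrightarrow> (\<Sum>i\<in>UNIV. m_cov b F y $ i * y $ i) = 0"
proof -
  assume y: "y \<in> U"
  have "(\<Sum>i\<in>UNIV. m_cov b F y $ i * y $ i) = b \<bullet> y - (b \<bullet> y) / F y * (\<Sum>i\<in>UNIV. y $ i * pd i F y)"
    unfolding sum_distrib_left inner_vec_def[of b y] sum_subtractf[symmetric]
    by (intro sum.cong) (simp_all add: m_cov_eq[OF y] inner_vec_def algebra_simps)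
  then show ?thesis by (simp add: euler_F[OF y] F_nonzero[OF y])
qed

lemma has_pd_m:
  assumes y: "y \<in> U"
  shows "has_pd (\<lambda>z. m_cov b F z $ i) (- (m_cov b F y $ k * pd i F y) / F y
     - (b \<bullet> y) / (F y)\<^sup>2 * angular_metric F y $ i $ k) k y"
proof -
  have "has_pd (\<lambda>z. b $ i - (b \<bullet> z) / F z * pd i F z)
     (0 - ((b $ k * F y - (b \<bullet> y) * pd k F y) / (F y * F y) * pd i F y
      + angular_metric F y $ i $ k / F y * ((b \<bullet> y) / F y))) k y"
    by (intro has_pd_diff has_pd_const has_pd_mult has_pd_divide has_pd_inner has_pd_F has_pd_l y F_nonzero)
  then have "has_pd (\<lambda>z. m_cov b F z $ i)
     (0 - ((b $ k * F y - (b \<bullet> y) * pd k F y) / (F y * F y) * pd i F y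
      + angular_metric F y $ i $ k / F y * ((b \<bullet> y) / F y))) k y"
    by (rule has_pd_cong[OF open_U y, rotated]) (simp add: m_cov_eq)
  moreover have "0 - ((b $ k * F y - (b \<bullet> y) * pd k F y) / (F y * F y) * pd i F y
      + angular_metric F y $ i $ k / F y * ((b \<bullet> y) / F y)) =
      - (m_cov b F y $ k * pd i F y) / F y - (b \<bullet> y) / (F y)\<^sup>2 * angular_metric F y $ i $ k"
    using F_nonzero[OF y] by (simp add: m_cov_eq[OF y] field_simps power2_eq_square)
  ultimately show ?thesis by simp
qed

end

section \<open>The changed Finsler function at a point\<close>

text \<open>The algebraic part of the computation of \<open>C\<^sup>*\<close>: the left-hand side is the product rule applied to
  \<open>l\<^sup>*\<^sub>1 l\<^sup>*\<^sub>2 + P h\<^sub>1\<^sub>2 + q m\<^sub>1 m\<^sub>2\<close>. Its terms with a factor \<open>l\<close> cancel, because \<open>l\<^sup>*\<close> is \<open>l\<close> scaled by \<open>B/F\<close>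
  modulo \<open>m\<close>; the others combine to the coefficients \<open>P'\<close> and \<open>c = p\<^sub>0\<^sub>2\<close>.\<close>

lemma cartan_change_algebra:
  fixes F B :: real
  assumes "F \<noteq> 0" "B \<noteq> 0"
    and lbar: "lb1 = B / F * l1 + f2 * m1" "lb2 = B / F * l2 + f2 * m2"
    and qq: "q = B * f22" "c = 2 * f2 * f22 + q2" and P': "P' = P * f2 / B - q * t / F\<^sup>2"
  shows "((P * h13 + q * m1 * m3) / B * lb2 + (P * h23 + q * m2 * m3) / B * lb1)
     + (P' * m3 * h12 + (2 * C - (h13 * l2 + l1 * h23) / F) * P)
     + (q2 * m3 * (m1 * m2) + ((- (m3 * l1) / F - t / F\<^sup>2 * h13) * m2 + (- (m3 * l2) / F - t / F\<^sup>2 * h23) * m1) * q)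
   = 2 * P * C + P' * (h12 * m3 + h23 * m1 + h13 * m2) + c * m1 * m2 * m3"
proof -
  define u w where "u = 1 / F" and "w = 1 / B"
  have u: "x / F = u * x" "x / F\<^sup>2 = u * u * x" and w: "x / B = w * x" "B * w = 1" for x
    using assms(2) by (simp_all add: u_def w_def power2_eq_square)
  show ?thesis
    unfolding lbar qq P' u w(1) using w(2) by algebra
qed

text \<open>A generalized \<open>\<beta>\<close>-conformal change in a single tangent space, with \<open>s = \<sigma>(x)\<close> and \<open>b\<close> the value of
  \<open>\<beta>\<close> at the point.\<close>

locale beta_change = finsler_cone U F + homogeneous2 \<Omega> f
  for U :: "(real ^ 'n::finite) set" and F and \<Omega> and f +
  fixes s :: real and b :: "real ^ 'n"
  assumes in_\<Omega>: "y \<in> U \<Longrightarrow> (exp s * F y, b \<bullet> y) \<in> \<Omega>"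
    and pos_f: "y \<in> U \<Longrightarrow> f (exp s * F y) (b \<bullet> y) > 0"
begin

text \<open>The changed Finsler function.\<close>

definition "B y = f (exp s * F y) (b \<bullet> y)"

lemma smooth_arg: "smooth_on U (\<lambda>z. (exp s * F z, b \<bullet> z))"
  by (intro smooth_on_Pair_real[OF open_U] smooth_on_mult[OF open_U smooth_on_const smooth_F]
      smooth_on_bounded_linear[OF open_U bounded_linear_inner_right])

lemma smooth_compose_arg:
  assumes "smooth_on \<Omega> (uncurry2 g)" shows "smooth_on U (\<lambda>z. g (exp s * F z) (b \<bullet> z))"
  using smooth_on_compose[OF open_U assms smooth_arg in_\<Omega>] by simp

sublocale bar: finsler_cone U B
proof
  show "smooth_on U B" unfolding B_def by (rule smooth_compose_arg[OF smooth_f])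
  show "B (t *\<^sub>R y) = t * B y" if "y \<in> U" "t > 0" for y t
    using hom_f[OF in_\<Omega>[OF that(1)] that(2)] by (simp add: B_def hom_F[OF that] mult.left_commute)
qed (simp_all add: open_U cone_U B_def pos_f)

abbreviation "at2 g y \<equiv> g (exp s * F y) (b \<bullet> y)"

lemma has_pd_at2:
  assumes "smooth_on \<Omega> (uncurry2 g)" "y \<in> U"
  shows "has_pd (at2 g) (at2 (D1 g) y * (exp s * pd k F y) + at2 (D2 g) y * b $ k) k y"
  using has_pd_mult[OF has_pd_const[of "exp s"] has_pd_F[OF assms(2)], of k]
  by (intro has_pd_compose2[OF assms(1)] in_\<Omega> assms(2) has_pd_inner) (simp_all add: mult.commute)

lemma pd_B: "y \<in> U \<Longrightarrow> pd k B y = exp s * at2 f1 y * pd k F y + at2 f2 y * b $ k"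
  using has_pd_imp_pd[OF has_pd_at2[OF smooth_f], of y k] by (simp add: B_def[abs_def] mult_ac)

text \<open>Solved for the derivatives with respect to \<open>e\<^sup>\<sigma>L\<close>, the Euler relations express the scalars that arise below by
  \<open>f\<^sub>2\<^sub>2\<close>, \<open>\<partial>q\<^sub>0/\<partial>\<beta>\<close> and the ratio \<open>\<beta>/L\<close>.\<close>

lemma euler_relations:
  assumes y: "y \<in> U"
  shows "B y = exp s * F y * at2 f1 y + (b \<bullet> y) * at2 f2 y"
    and "exp s * at2 f12 y = - ((b \<bullet> y) / F y) * at2 f22 y"
    and "exp s * exp s * at2 f11 y = ((b \<bullet> y) / F y)\<^sup>2 * at2 f22 y"
    and "at2 (D1 f2) y = at2 f12 y"
    and "exp s * at2 (D1 (q0_fun f)) y = - ((b \<bullet> y) / F y) * at2 (D2 (q0_fun f)) y"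
proof -
  note F = F_nonzero[OF y]
  show "B y = exp s * F y * at2 f1 y + (b \<bullet> y) * at2 f2 y"
    using euler_f[OF in_\<Omega>[OF y]] by (simp add: B_def)
  show 12: "exp s * at2 f12 y = - ((b \<bullet> y) / F y) * at2 f22 y"
    using euler_f2[OF in_\<Omega>[OF y]] F by (simp add: field_simps)
  have "exp s * at2 f11 y = - ((b \<bullet> y) / F y) * at2 f12 y"
    using euler_f1[OF in_\<Omega>[OF y]] F by (simp add: field_simps)
  then have "exp s * exp s * at2 f11 y = - ((b \<bullet> y) / F y) * (exp s * at2 f12 y)"
    by algebra
  then show "exp s * exp s * at2 f11 y = ((b \<bullet> y) / F y)\<^sup>2 * at2 f22 y"
    unfolding 12 by (simp add: power2_eq_square)
  show "at2 (D1 f2) y = at2 f12 y"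
    by (rule D1_D2_commute[OF open_\<Omega> smooth_f in_\<Omega>[OF y]])
  show "exp s * at2 (D1 (q0_fun f)) y = - ((b \<bullet> y) / F y) * at2 (D2 (q0_fun f)) y"
    using euler_q0[OF in_\<Omega>[OF y]] F by (simp add: field_simps)
qed

lemma pd_B_eq:
  assumes y: "y \<in> U" shows "pd k B y = B y / F y * pd k F y + at2 f2 y * m_cov b F y $ k"
  using F_nonzero[OF y] by (simp add: pd_B[OF y] euler_relations(1)[OF y] m_cov_eq[OF y] field_simps)

abbreviation "P y \<equiv> exp s * pc f s b F y"
abbreviation "P' y \<equiv> exp s * pm1 f s b F y"
abbreviation "m y \<equiv> m_cov b F y"
abbreviation "h y \<equiv> angular_metric F y"

lemma P_eq: "P y = exp s * (B y * at2 f1 y / F y)"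
  by (simp add: pc_def p_fun_def B_def)

lemma q0_eq: "q0 f s b F y = B y * at2 f22 y"
  by (simp add: q0_def q0_fun_def B_def)

lemma P'_eq: "y \<in> U \<Longrightarrow> P' y = P y * at2 f2 y / B y - q0 f s b F y * (b \<bullet> y) / (F y)\<^sup>2"
proof -
  assume y: "y \<in> U"
  have "P' y = B y * (exp s * at2 f12 y) / F y + P y * at2 f2 y / B y"
    by (simp add: pm1_def pm1_fun_def pc_def B_def field_simps)
  then show ?thesis
    unfolding euler_relations(2)[OF y] by (simp add: q0_eq power2_eq_square)
qed

text \<open>By the Euler relations the Hessian of \<open>f\<close> is \<open>f\<^sub>2\<^sub>2\<close> times the square of the covector \<open>(-\<beta>/e\<^sup>\<sigma>L, 1)\<close>;
  composed with \<open>(e\<^sup>\<sigma>L, \<beta>)\<close> this covector becomes \<open>b\<^sub>i - (\<beta>/L) l\<^sub>i = m\<^sub>i\<close>.\<close>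

lemma has_pd_pd_B:
  assumes y: "y \<in> U"
  shows "has_pd (pd i B) ((P y * h y $ i $ k + q0 f s b F y * m y $ i * m y $ k) / B y) k y"
proof -
  let ?d = "((at2 f11 y * (exp s * pd k F y) + at2 f12 y * b $ k) * exp s) * pd i F y
      + h y $ i $ k / F y * (exp s * at2 f1 y)
      + ((at2 (D1 f2) y * (exp s * pd k F y) + at2 f22 y * b $ k) * b $ i + 0 * at2 f2 y)"
  have e: "has_pd (\<lambda>z. exp s * at2 f1 z) ((at2 f11 y * (exp s * pd k F y) + at2 f12 y * b $ k) * exp s) k y"
    using has_pd_mult[OF has_pd_const has_pd_at2[OF smooth_Ds(2) y]] by simp
  have "has_pd (\<lambda>z. exp s * at2 f1 z * pd i F z + at2 f2 z * b $ i) ?d k y"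
    by (intro has_pd_add has_pd_mult e has_pd_l has_pd_at2 smooth_Ds y has_pd_const)
  then have "has_pd (pd i B) ?d k y"
    by (rule has_pd_cong[OF open_U y, rotated]) (simp add: pd_B)
  moreover have "?d = (P y * h y $ i $ k + q0 f s b F y * m y $ i * m y $ k) / B y"
  proof -
    define c where "c = (b \<bullet> y) / F y"
    have "?d = (exp s * exp s * at2 f11 y) * pd k F y * pd i F y + (exp s * at2 f12 y) * b $ k * pd i F y
       + h y $ i $ k / F y * (exp s * at2 f1 y)
       + (exp s * at2 f12 y) * pd k F y * b $ i + at2 f22 y * b $ k * b $ i"
      unfolding euler_relations(4)[OF y] by (simp add: algebra_simps)
    also have "\<dots> = exp s * at2 f1 y / F y * h y $ i $ k + at2 f22 y * m y $ i * m y $ k"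
      unfolding euler_relations(2,3)[OF y] m_cov_eq[OF y] c_def[symmetric] by (simp add: algebra_simps power2_eq_square)
    also have "\<dots> = (P y * h y $ i $ k + q0 f s b F y * m y $ i * m y $ k) / B y"
      using bar.F_nonzero[OF y] by (simp add: P_eq q0_eq add_divide_distrib)
    finally show ?thesis .
  qed
  ultimately show ?thesis by simp
qed

lemma metric_bar:
  assumes y: "y \<in> U"
  shows "metric B y $ i $ j = pd i B y * pd j B y + P y * h y $ i $ j + q0 f s b F y * (m y $ i * m y $ j)"
  using has_pd_imp_pd[OF has_pd_pd_B[OF y], of i j] bar.pd2_sym[OF y, of j i] bar.F_nonzero[OF y]
  by (simp add: bar.metric_eq[OF y] angular_sym[OF y, of j i])

text \<open>The scalar \<open>p\<close> is homogeneous of degree \<open>0\<close> in \<open>(e\<^sup>\<sigma>L, \<beta>)\<close> and \<open>p\<^sub>-\<^sub>1 = \<partial>p/\<partial>\<beta>\<close>. The same reason gives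
  the derivative of \<open>q\<^sub>0\<close>.\<close>

lemma has_pd_P:
  assumes y: "y \<in> U"
  shows "has_pd (\<lambda>z. P z) (P' y * m y $ k) k y"
proof -
  let ?d = "0 * (B y * at2 f1 y / F y) + ((pd k B y * at2 f1 y + (at2 f11 y * (exp s * pd k F y) + at2 f12 y * b $ k) * B y) * F y
      - (B y * at2 f1 y) * pd k F y) / (F y * F y) * exp s"
  have "has_pd (\<lambda>z. P z) ?d k y"
    unfolding P_eq
    by (intro has_pd_mult has_pd_const has_pd_divide has_pd_at2 smooth_Ds y has_pd_F bar.has_pd_F F_nonzero)
  moreover have "?d = P' y * m y $ k"
  proof -
    define u where "u = 1 / F y"
    have u: "F y * u = 1" "\<And>x. x / F y = u * x" using F_nonzero[OF y] by (simp_all add: u_def)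
    define E X where "E = exp s" and "X = E * at2 f12 y"
    have f11: "E * E * at2 f11 y = u * u * (b \<bullet> y) * (b \<bullet> y) * at2 f22 y"
      using euler_relations(3)[OF y] by (simp add: u_def E_def power2_eq_square)
    have f12: "X = - u * (b \<bullet> y) * at2 f22 y"
      using euler_relations(2)[OF y] by (simp add: u_def E_def X_def)
    have "?d = ((pd k B y * E * at2 f1 y + (E * E * at2 f11 y * pd k F y + X * b $ k) * B y) * u
      - (B y * at2 f1 y) * pd k F y * u * u * E)"
      using u(1) by (simp add: E_def X_def u_def F_nonzero[OF y] field_simps)
    also have "\<dots> = (E * at2 f1 y * u * at2 f2 y - B y * at2 f22 y * (b \<bullet> y) * u * u) * m y $ k"
      unfolding pd_B_eq[OF y] m_cov_eq[OF y] f11 f12 u(2) by algebra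
    also have "\<dots> = P' y * m y $ k"
      using bar.F_nonzero[OF y] unfolding P'_eq[OF y] P_eq q0_eq
      by (simp add: u_def E_def power2_eq_square)
    finally show ?thesis .
  qed
  ultimately show ?thesis by simp
qed

lemma has_pd_q0:
  assumes y: "y \<in> U"
  shows "has_pd (\<lambda>z. q0 f s b F z) (at2 (D2 (q0_fun f)) y * m y $ k) k y"
proof -
  have "has_pd (\<lambda>z. q0 f s b F z) (at2 (D1 (q0_fun f)) y * (exp s * pd k F y) + at2 (D2 (q0_fun f)) y * b $ k) k y"
    unfolding q0_def by (rule has_pd_at2[OF smooth_q0_fun y])
  moreover have "at2 (D1 (q0_fun f)) y * (exp s * pd k F y) + at2 (D2 (q0_fun f)) y * b $ k
      = (exp s * at2 (D1 (q0_fun f)) y) * pd k F y + at2 (D2 (q0_fun f)) y * b $ k" by simp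
  moreover have "\<dots> = at2 (D2 (q0_fun f)) y * m y $ k"
    unfolding euler_relations(5)[OF y] m_cov_eq[OF y] by (simp add: algebra_simps)
  ultimately show ?thesis by simp
qed

lemma cartan_bar:
  assumes y: "y \<in> U"
  shows "cartan B y i j k = P y * cartan F y i j k
    + P' y / 2 * (h y $ i $ j * m y $ k + h y $ j $ k * m y $ i + h y $ k $ i * m y $ j)
    + p02 f s b F y / 2 * (m y $ i * m y $ j * m y $ k)"
proof -
  let ?d = "((P y * h y $ i $ k + q0 f s b F y * m y $ i * m y $ k) / B y * pd j B y
       + (P y * h y $ j $ k + q0 f s b F y * m y $ j * m y $ k) / B y * pd i B y)
     + (P' y * m y $ k * h y $ i $ j
       + (2 * cartan F y i j k - (h y $ i $ k * pd j F y + pd i F y * h y $ j $ k) / F y) * P y)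
     + (at2 (D2 (q0_fun f)) y * m y $ k * (m y $ i * m y $ j)
       + ((- (m y $ k * pd i F y) / F y - (b \<bullet> y) / (F y)\<^sup>2 * h y $ i $ k) * m y $ j
        + (- (m y $ k * pd j F y) / F y - (b \<bullet> y) / (F y)\<^sup>2 * h y $ j $ k) * m y $ i) * q0 f s b F y)"
  have "has_pd (\<lambda>z. pd i B z * pd j B z + P z * h z $ i $ j + q0 f s b F z * (m z $ i * m z $ j)) ?d k y"
    by (intro has_pd_add has_pd_mult[OF has_pd_P] has_pd_mult[OF has_pd_q0] has_pd_mult[OF has_pd_pd_B]
        has_pd_mult[OF has_pd_m] has_pd_pd_B has_pd_m has_pd_angular y)
  then have "has_pd (\<lambda>z. metric B z $ i $ j) ?d k y"
    by (rule has_pd_cong[OF open_U y, rotated]) (simp add: metric_bar)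
  then have "pd k (\<lambda>z. metric B z $ i $ j) y = ?d"
    by (rule has_pd_imp_pd)
  moreover have "2 * cartan B y i j k = pd k (\<lambda>z. metric B z $ i $ j) y"
    by (simp add: cartan_def[of B])
  ultimately have "2 * cartan B y i j k = ?d" by simp
  also have "\<dots> = 2 * P y * cartan F y i j k
     + P' y * (h y $ i $ j * m y $ k + h y $ j $ k * m y $ i + h y $ i $ k * m y $ j)
     + p02 f s b F y * m y $ i * m y $ j * m y $ k"
    by (rule cartan_change_algebra[OF F_nonzero[OF y] bar.F_nonzero[OF y] pd_B_eq[OF y] pd_B_eq[OF y] q0_eq _ P'_eq[OF y]])
      (simp add: p02_def p02_fun_eq[OF in_\<Omega>[OF y]])
  finally show ?thesis
    by (simp add: angular_sym[OF y, of k i] algebra_simps)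
qed

end

section \<open>The changed mean Cartan tensor\<close>

text \<open>The tensor \<open>Q\<^sub>i\<^sub>j\<close> through which the changed space is quasi-C-reducible.\<close>

definition reducing_tensor :: "(real \<Rightarrow> real \<Rightarrow> real) \<Rightarrow> real \<Rightarrow> real ^ 'n::finite \<Rightarrow> (real ^ 'n \<Rightarrow> real) \<Rightarrow> real ^ 'n
    \<Rightarrow> real ^ 'n ^ 'n" where
  "reducing_tensor f s b F y = (\<chi> i j. (3 * exp s * pm1 f s b F y * angular_metric F y $ i $ j
     + p02 f s b F y * m_cov b F y $ i * m_cov b F y $ j) / (6 * lam f s b F y))"

context beta_change
begin

abbreviation "msq y \<equiv> m_sq b F y"

lemma indicatory:
  assumes y: "y \<in> U"
  shows "(\<Sum>k\<in>UNIV. cartan B y i j k * y $ k) = 0" and "(\<Sum>j\<in>UNIV. cartan B y i j k * y $ j) = 0"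
proof -
  show *: "(\<Sum>k\<in>UNIV. cartan B y i j k * y $ k) = 0" for j by (rule bar.cartan_y[OF y])
  show "(\<Sum>j\<in>UNIV. cartan B y i j k * y $ j) = 0"
    using *[of k] bar.cartan_sym23[OF y] by simp
qed

text \<open>With \<open>\<mu>\<^sup>j = g\<^sup>j\<^sup>k m\<^sub>k\<close>, the approximate inverse is \<open>E\<^sup>j\<^sup>k = g\<^sup>j\<^sup>k/P - s\<^sub>0 \<mu>\<^sup>j \<mu>\<^sup>k\<close>. The value of \<open>s\<^sub>0\<close> is the one
  for which the \<open>m\<^sub>i \<mu>\<^sup>k\<close> terms of \<open>(P h + q\<^sub>0 m m) E\<close> cancel; what remains besides the identity has a
  factor \<open>y\<^sup>k\<close> or a factor \<open>l\<^sup>*\<^sub>i\<close>, where \<open>l\<^sup>*\<^sub>i = g\<^sup>*\<^sub>i\<^sub>j y\<^sup>j/B\<close>. The contraction of \<open>C\<^sup>*\<^sub>i\<^sub>j\<^sub>k\<close> with \<open>E\<close> is then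
  computed term by term.\<close>

lemma cartan_trace_bar:
  assumes y: "y \<in> U" and inv: "invertible (metric F y)" "invertible (metric B y)"
    and P: "pc f s b F y \<noteq> 0" and S: "P y + msq y * q0 f s b F y \<noteq> 0"
  shows "cartan_trace B y i = cartan_trace F y i - P y * s0 f s b F y * cartan_bb b F y i
    + lam f s b F y * m y $ i"
proof -
  define G Gi where "G = metric F y" and "Gi = inv_metric F y"
  define \<mu> where "\<mu> j = (\<Sum>k\<in>UNIV. Gi $ j $ k * m y $ k)" for j
  define l where "l j = pd j F y" for j
  define E where "E j k = Gi $ j $ k / P y - s0 f s b F y * \<mu> j * \<mu> k" for j k
  \<comment> \<open>\<open>E\<close> takes \<open>m\<close> to \<open>\<kappa> \<mu>\<close>; the value is the reciprocal of \<open>P + m\<^sup>2 q\<^sub>0\<close>\<close>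
  define \<kappa> where "\<kappa> = 1 / P y - s0 f s b F y * msq y"
  note F = F_nonzero[OF y] and B = bar.F_nonzero[OF y]
  have P0: "P y \<noteq> 0" using P by simp
  have s0: "s0 f s b F y * (P y * (P y + msq y * q0 f s b F y)) = q0 f s b F y"
  proof -
    have "s0 f s b F y = q0 f s b F y / (P y * (P y + msq y * q0 f s b F y))"
      by (simp add: s0_def exp_minus divide_inverse mult_ac)
    then show ?thesis using P S by simp
  qed
  have P\<kappa>: "P y * \<kappa> = 1 - P y * s0 f s b F y * msq y"
    using P0 by (simp add: \<kappa>_def right_diff_distrib)
  have "P y * (\<kappa> * (P y + msq y * q0 f s b F y)) = P y * 1"
    using P\<kappa> s0 by algebra
  then have \<kappa>: "\<kappa> * (P y + msq y * q0 f s b F y) = 1"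
    using P0 by (simp only: mult_cancel_left) simp
  have "P y * (q0 f s b F y * \<kappa>) = P y * (P y * s0 f s b F y)"
    using P\<kappa> s0 by algebra
  then have \<kappa>q: "q0 f s b F y * \<kappa> = P y * s0 f s b F y"
    using P0 by (simp only: mult_cancel_left) simp
  have Gi_sym: "Gi $ j $ k = Gi $ k $ j" for j k
    unfolding Gi_def inv_metric_def by (rule matrix_inv_sym[OF inv(1) metric_sym[OF y]])
  have GGi: "(\<Sum>j\<in>UNIV. G $ i $ j * Gi $ j $ k) = (if i = k then 1 else 0)" for i k
    unfolding G_def Gi_def inv_metric_def by (rule matrix_inv_sum(2)[OF inv(1)])
  have GiG: "(\<Sum>i\<in>UNIV. Gi $ j $ i * (\<Sum>k\<in>UNIV. G $ i $ k * v k)) = v j" for v j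
    unfolding G_def Gi_def inv_metric_def by (rule matrix_inv_sum(1)[OF inv(1)])
  have Gil: "(\<Sum>k\<in>UNIV. Gi $ j $ k * l k) = y $ j / F y" for j
  proof -
    have "F y * (\<Sum>k\<in>UNIV. Gi $ j $ k * l k) = y $ j"
      using GiG[of j "\<lambda>k. y $ k"] unfolding G_def metric_y[OF y] l_def
      by (simp add: sum_distrib_left mult_ac)
    then show ?thesis using F by (simp add: field_simps)
  qed
  have lGi: "(\<Sum>j\<in>UNIV. l j * Gi $ j $ k) = y $ k / F y" for k
    using Gil[of k] by (simp add: Gi_sym[of k] mult.commute)
  have mGi: "(\<Sum>j\<in>UNIV. m y $ j * Gi $ j $ k) = \<mu> k" for k
    by (simp add: \<mu>_def Gi_sym[of k] mult.commute)
  have l\<mu>: "(\<Sum>j\<in>UNIV. l j * \<mu> j) = 0"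
  proof -
    have "(\<Sum>j\<in>UNIV. l j * \<mu> j) = (\<Sum>k\<in>UNIV. (\<Sum>j\<in>UNIV. l j * Gi $ j $ k) * m y $ k)"
      unfolding \<mu>_def sum_distrib_left sum_distrib_right by (subst sum.swap) (simp add: mult.assoc)
    also have "\<dots> = (\<Sum>k\<in>UNIV. m y $ k * y $ k) / F y"
      unfolding lGi by (simp add: sum_divide_distrib mult.commute)
    finally show ?thesis using m_y[OF y] by simp
  qed
  have m\<mu>: "(\<Sum>j\<in>UNIV. m y $ j * \<mu> j) = msq y"
    unfolding \<mu>_def m_sq_def Gi_def by (simp add: sum_distrib_left mult_ac)
  have G\<mu>: "(\<Sum>j\<in>UNIV. G $ i $ j * \<mu> j) = m y $ i" for i
  proof -
    have "(\<Sum>j\<in>UNIV. G $ i $ j * \<mu> j) = (\<Sum>k\<in>UNIV. (\<Sum>j\<in>UNIV. G $ i $ j * Gi $ j $ k) * m y $ k)"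
      unfolding \<mu>_def sum_distrib_left sum_distrib_right by (subst sum.swap) (simp add: mult.assoc)
    then show ?thesis unfolding GGi by (simp add: if_distrib[of "\<lambda>x. x * _"] cong: if_cong)
  qed
  have h: "h y $ i $ j = G $ i $ j - l i * l j" for i j
    by (simp add: angular_metric_def G_def l_def)
  have h\<mu>: "(\<Sum>j\<in>UNIV. h y $ i $ j * \<mu> j) = m y $ i" for i
    using G\<mu>[of i] l\<mu> by (simp add: h left_diff_distrib sum_subtractf mult.assoc sum_distrib_left[symmetric])
  have E_sum: "(\<Sum>j\<in>UNIV. v j * E j k) =
      (\<Sum>j\<in>UNIV. v j * Gi $ j $ k) / P y - s0 f s b F y * (\<Sum>j\<in>UNIV. v j * \<mu> j) * \<mu> k" for v k
    by (simp add: E_def right_diff_distrib sum_subtractf sum_divide_distrib sum_distrib_left sum_distrib_right mult_ac)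
  have E_sym: "E j k = E k j" for j k
    by (simp add: E_def Gi_sym[of j k])
  have mE: "(\<Sum>j\<in>UNIV. m y $ j * E j k) = \<kappa> * \<mu> k" for k
    unfolding E_sum mGi m\<mu> \<kappa>_def by (simp add: algebra_simps)
  have lE: "(\<Sum>j\<in>UNIV. l j * E j k) = y $ k / (F y * P y)" for k
    unfolding E_sum lGi l\<mu> by simp
  have GE: "(\<Sum>j\<in>UNIV. G $ i $ j * E j k) = (if i = k then 1 else 0) / P y - s0 f s b F y * m y $ i * \<mu> k" for i k
    unfolding E_sum GGi G\<mu> ..

  \<comment> \<open>the contraction of \<open>E\<close> with \<open>l\<^sup>*\<close>; its exact value drops out\<close>
  define \<nu> where "\<nu> k = (\<Sum>j\<in>UNIV. pd j B y * E j k)" for k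
  have gbar: "metric B y $ i $ j = pd i B y * pd j B y + P y * G $ i $ j - P y * l i * l j
     + q0 f s b F y * m y $ i * m y $ j" for i j
    unfolding metric_bar[OF y] h by (simp add: algebra_simps)
  have "(\<Sum>j\<in>UNIV. metric B y $ i $ j * E j k) = (if i = k then 1 else 0) + (- l i / F y) * y $ k
      + (\<Sum>j\<in>UNIV. metric B y $ i $ j * (y $ j / B y)) * \<nu> k" for i k
  proof -
    have "(\<Sum>j\<in>UNIV. metric B y $ i $ j * E j k) = pd i B y * \<nu> k
      + P y * (\<Sum>j\<in>UNIV. G $ i $ j * E j k) - P y * l i * (\<Sum>j\<in>UNIV. l j * E j k)
      + q0 f s b F y * m y $ i * (\<Sum>j\<in>UNIV. m y $ j * E j k)"
      unfolding \<nu>_def gbar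
      by (simp add: distrib_right left_diff_distrib sum.distrib sum_subtractf sum_distrib_left mult.assoc)
    also have "\<dots> = pd i B y * \<nu> k + (if i = k then 1 else 0) - l i * y $ k / F y
       + m y $ i * \<mu> k * (q0 f s b F y * \<kappa> - P y * s0 f s b F y)"
      unfolding GE lE mE using P0 F by (simp add: field_simps)
    also have "pd i B y = (\<Sum>j\<in>UNIV. metric B y $ i $ j * (y $ j / B y))"
      using bar.metric_y[OF y, of i] B by (simp add: sum_divide_distrib[symmetric])
    finally show ?thesis by (simp add: \<kappa>q)
  qed
  then have "cartan_trace B y i = (\<Sum>j\<in>UNIV. \<Sum>k\<in>UNIV. cartan B y i j k * E j k)"
    unfolding cartan_trace_def inv_metric_def
    by (rule trace_matrix_inv_modulo[OF inv(2)])
      (simp_all add: indicatory[OF y] sum_divide_distrib[symmetric])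
  moreover have "(\<Sum>j\<in>UNIV. \<Sum>k\<in>UNIV. cartan F y i j k * E j k) =
      cartan_trace F y i / P y - s0 f s b F y * cartan_bb b F y i"
  proof -
    have b: "b_up b F y $ j = \<mu> j + (b \<bullet> y) / (F y)\<^sup>2 * y $ j" for j
    proof -
      have "b_up b F y $ j = (\<Sum>k\<in>UNIV. Gi $ j $ k * (m y $ k + (b \<bullet> y) / F y * l k))"
        by (simp add: b_up_def Gi_def m_cov_eq[OF y] l_def)
      also have "\<dots> = \<mu> j + (b \<bullet> y) / F y * (\<Sum>k\<in>UNIV. Gi $ j $ k * l k)"
        by (simp add: \<mu>_def distrib_left sum.distrib sum_distrib_left mult_ac)
      finally show ?thesis unfolding Gil by (simp add: power2_eq_square)
    qed
    have C2: "(\<Sum>k\<in>UNIV. cartan F y i j k * b_up b F y $ k) = (\<Sum>k\<in>UNIV. cartan F y i j k * \<mu> k)" for j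
      using cartan_y[OF y, of i j]
      by (simp add: b distrib_left sum.distrib mult.left_commute sum_distrib_left[symmetric]
          sum_divide_distrib[symmetric])
    have C1: "(\<Sum>j\<in>UNIV. cartan F y i j k * b_up b F y $ j) = (\<Sum>j\<in>UNIV. cartan F y i j k * \<mu> j)" for k
      using C2[of k] by (simp add: cartan_sym23[OF y, of i k])
    have "cartan_bb b F y i = (\<Sum>j\<in>UNIV. b_up b F y $ j * (\<Sum>k\<in>UNIV. cartan F y i j k * b_up b F y $ k))"
      by (simp add: cartan_bb_def sum_distrib_left mult_ac)
    also have "\<dots> = (\<Sum>j\<in>UNIV. \<Sum>k\<in>UNIV. cartan F y i j k * b_up b F y $ j * \<mu> k)"
      unfolding C2 by (simp add: sum_distrib_left mult_ac)
    also have "\<dots> = (\<Sum>k\<in>UNIV. (\<Sum>j\<in>UNIV. cartan F y i j k * b_up b F y $ j) * \<mu> k)"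
      by (subst sum.swap) (simp add: sum_distrib_right)
    also have "\<dots> = (\<Sum>j\<in>UNIV. \<Sum>k\<in>UNIV. cartan F y i j k * \<mu> j * \<mu> k)"
      unfolding C1 by (subst sum.swap) (simp add: sum_distrib_right)
    finally have bb: "cartan_bb b F y i = \<dots>" .
    show ?thesis
      unfolding bb cartan_trace_def E_def Gi_def
      by (simp add: right_diff_distrib sum_subtractf sum_divide_distrib sum_distrib_left mult_ac)
  qed
  moreover have "(\<Sum>j\<in>UNIV. \<Sum>k\<in>UNIV. h y $ i $ j * m y $ k * E j k) = \<kappa> * m y $ i"
  proof -
    have "(\<Sum>j\<in>UNIV. \<Sum>k\<in>UNIV. h y $ i $ j * m y $ k * E j k) =
        (\<Sum>j\<in>UNIV. h y $ i $ j * (\<Sum>k\<in>UNIV. m y $ k * E k j))"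
      by (simp add: sum_distrib_left mult.assoc E_sym)
    then show ?thesis
      unfolding mE using h\<mu>[of i] by (simp add: mult.left_commute sum_distrib_left[symmetric])
  qed
  moreover have "(\<Sum>j\<in>UNIV. \<Sum>k\<in>UNIV. h y $ k $ i * m y $ j * E j k) = \<kappa> * m y $ i"
  proof -
    have "(\<Sum>j\<in>UNIV. \<Sum>k\<in>UNIV. h y $ k $ i * m y $ j * E j k) =
        (\<Sum>k\<in>UNIV. h y $ i $ k * (\<Sum>j\<in>UNIV. m y $ j * E j k))"
      by (subst sum.swap) (simp add: sum_distrib_left mult.assoc angular_sym[OF y, of _ i])
    then show ?thesis
      unfolding mE using h\<mu>[of i] by (simp add: mult.left_commute sum_distrib_left[symmetric])
  qed
  moreover have "(\<Sum>j\<in>UNIV. \<Sum>k\<in>UNIV. h y $ j $ k * m y $ i * E j k) =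
      m y $ i * ((real CARD('n) - 1) / P y - s0 f s b F y * msq y)"
  proof -
    have "(\<Sum>k\<in>UNIV. h y $ j $ k * E k j) = 1 / P y - s0 f s b F y * m y $ j * \<mu> j - l j * (y $ j / (F y * P y))" for j
      unfolding h left_diff_distrib sum_subtractf mult.assoc sum_distrib_left[symmetric] lE GE by simp
    then have "(\<Sum>j\<in>UNIV. \<Sum>k\<in>UNIV. h y $ j $ k * E j k) =
        (\<Sum>j\<in>UNIV. 1 / P y - s0 f s b F y * m y $ j * \<mu> j - l j * (y $ j / (F y * P y)))"
      by (simp add: E_sym)
    also have "\<dots> = real CARD('n) / P y - s0 f s b F y * (\<Sum>j\<in>UNIV. m y $ j * \<mu> j)
        - (\<Sum>j\<in>UNIV. y $ j * l j) / (F y * P y)"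
      by (simp add: sum_subtractf sum_distrib_left sum_divide_distrib mult_ac)
    also have "(\<Sum>j\<in>UNIV. y $ j * l j) = F y"
      unfolding l_def by (rule euler_F[OF y])
    finally have "(\<Sum>j\<in>UNIV. \<Sum>k\<in>UNIV. h y $ j $ k * E j k) =
        (real CARD('n) - 1) / P y - s0 f s b F y * msq y"
      using F by (simp add: m\<mu> diff_divide_distrib)
    moreover have "(\<Sum>j\<in>UNIV. \<Sum>k\<in>UNIV. h y $ j $ k * m y $ i * E j k) =
        m y $ i * (\<Sum>j\<in>UNIV. \<Sum>k\<in>UNIV. h y $ j $ k * E j k)"
      by (simp add: sum_distrib_left mult_ac)
    ultimately show ?thesis by simp
  qed
  moreover have "(\<Sum>j\<in>UNIV. \<Sum>k\<in>UNIV. m y $ i * m y $ j * m y $ k * E j k) = m y $ i * (\<kappa> * msq y)"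
  proof -
    have "(\<Sum>j\<in>UNIV. \<Sum>k\<in>UNIV. m y $ i * m y $ j * m y $ k * E j k) =
        (\<Sum>k\<in>UNIV. m y $ i * m y $ k * (\<Sum>j\<in>UNIV. m y $ j * E j k))"
      by (subst sum.swap) (simp add: sum_distrib_left mult_ac)
    also have "\<dots> = m y $ i * \<kappa> * (\<Sum>k\<in>UNIV. m y $ k * \<mu> k)"
      unfolding mE by (simp add: sum_distrib_left mult_ac)
    finally show ?thesis by (simp add: m\<mu>)
  qed
  moreover have "(\<Sum>j\<in>UNIV. \<Sum>k\<in>UNIV. cartan B y i j k * E j k) =
      P y * (\<Sum>j\<in>UNIV. \<Sum>k\<in>UNIV. cartan F y i j k * E j k)
    + P' y / 2 * ((\<Sum>j\<in>UNIV. \<Sum>k\<in>UNIV. h y $ i $ j * m y $ k * E j k)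
        + (\<Sum>j\<in>UNIV. \<Sum>k\<in>UNIV. h y $ j $ k * m y $ i * E j k)
        + (\<Sum>j\<in>UNIV. \<Sum>k\<in>UNIV. h y $ k $ i * m y $ j * E j k))
    + p02 f s b F y / 2 * (\<Sum>j\<in>UNIV. \<Sum>k\<in>UNIV. m y $ i * m y $ j * m y $ k * E j k)"
    unfolding cartan_bar[OF y]
    by (simp only: distrib_left distrib_right sum.distrib sum_distrib_left mult.assoc)
  ultimately have "cartan_trace B y i = P y * (cartan_trace F y i / P y - s0 f s b F y * cartan_bb b F y i)
    + P' y / 2 * (\<kappa> * m y $ i + m y $ i * ((real CARD('n) - 1) / P y - s0 f s b F y * msq y) + \<kappa> * m y $ i)
    + p02 f s b F y / 2 * (m y $ i * (\<kappa> * msq y))"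
    by simp
  also have "\<dots> = cartan_trace F y i - P y * s0 f s b F y * cartan_bb b F y i
     + m y $ i * (P' y / 2 * ((real CARD('n) + 1) / P y - 3 * s0 f s b F y * msq y)
        + p02 f s b F y / 2 * (\<kappa> * msq y))"
    using P0 by (simp add: \<kappa>_def field_simps)
  also have "P' y / 2 * ((real CARD('n) + 1) / P y - 3 * s0 f s b F y * msq y)
        + p02 f s b F y / 2 * (\<kappa> * msq y) = lam f s b F y"
  proof -
    have "\<kappa> = 1 / (P y + q0 f s b F y * msq y)"
      using \<kappa> S by (simp add: field_simps)
    moreover have "P' y / 2 * ((real CARD('n) + 1) / P y) = (real CARD('n) + 1) * pm1 f s b F y / (2 * pc f s b F y)"
      using P by (simp add: field_simps)
    ultimately show ?thesis
      unfolding lam_def right_diff_distrib by (simp add: mult_ac)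
  qed
  finally show ?thesis by (simp add: mult.commute)
qed

lemma reducing_tensor_sym: "y \<in> U \<Longrightarrow> reducing_tensor f s b F y $ i $ j = reducing_tensor f s b F y $ j $ i"
  by (simp add: reducing_tensor_def angular_sym[of y i j] mult_ac)

lemma reducing_tensor_y:
  assumes y: "y \<in> U"
  shows "(\<Sum>j\<in>UNIV. reducing_tensor f s b F y $ i $ j * y $ j) = 0"
proof -
  have "(\<Sum>j\<in>UNIV. reducing_tensor f s b F y $ i $ j * y $ j) =
     (3 * P' y * (\<Sum>j\<in>UNIV. h y $ i $ j * y $ j) + p02 f s b F y * m y $ i * (\<Sum>j\<in>UNIV. m y $ j * y $ j))
     / (6 * lam f s b F y)"
    by (simp add: reducing_tensor_def sum_divide_distrib sum_distrib_left sum.distrib[symmetric] algebra_simps)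
  then show ?thesis by (simp add: angular_y[OF y] m_y[OF y])
qed

text \<open>In \<open>C\<^sup>*\<^sub>k = \<lambda> m\<^sub>k - T\<^sub>k\<close> the correction \<open>T\<close> is the covector occurring in \<open>q\<^sub>i\<^sub>j\<^sub>k\<close>, so that \<open>q\<^sub>i\<^sub>j\<^sub>k = 0\<close> trades the
  terms with \<open>T\<close> for \<open>P C\<^sub>i\<^sub>j\<^sub>k\<close>.\<close>

lemma cartan_bar_reducible:
  assumes y: "y \<in> U" and inv: "invertible (metric F y)" "invertible (metric B y)"
    and P: "pc f s b F y \<noteq> 0" and S: "P y + msq y * q0 f s b F y \<noteq> 0"
    and lam: "lam f s b F y \<noteq> 0" and q: "q_tensor f s b F y i j k = 0"
  shows "cartan B y i j k = reducing_tensor f s b F y $ i $ j * cartan_trace B y k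
     + reducing_tensor f s b F y $ j $ k * cartan_trace B y i + reducing_tensor f s b F y $ k $ i * cartan_trace B y j"
proof -
  define \<Lambda> where "\<Lambda> = lam f s b F y"
  define T where "T k = P y * s0 f s b F y * cartan_bb b F y k - cartan_trace F y k" for k
  define W where "W i j = 3 * P' y * h y $ i $ j + p02 f s b F y * m y $ i * m y $ j" for i j
  have \<Lambda>: "\<Lambda> \<noteq> 0" using lam by (simp add: \<Lambda>_def)
  have C: "cartan_trace B y k = \<Lambda> * m y $ k - T k" for k
    unfolding cartan_trace_bar[OF y inv P S] T_def \<Lambda>_def by simp
  have Q: "reducing_tensor f s b F y $ i $ j = W i j / (6 * \<Lambda>)" for i j
    by (simp add: reducing_tensor_def W_def \<Lambda>_def mult.assoc)
  have "cyclic_sum (\<lambda>i j k. 2 * \<Lambda> * P y * cartan F y i j k + W i j * T k) i j k = 0"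
    using q lam by (simp add: q_tensor_def W_def T_def \<Lambda>_def mult_ac)
  then have WT: "W i j * T k + W j k * T i + W k i * T j = - 6 * \<Lambda> * P y * cartan F y i j k"
    unfolding cyclic_sum_def
    using cartan_sym12[OF y, of j k i] cartan_sym13[OF y, of k j i] cartan_sym23[OF y, of k i j] cartan_sym13[OF y, of k i j]
      cartan_sym23[OF y, of j i k] cartan_sym12[OF y, of j i k]
    by (simp add: algebra_simps)
  have "(W i j * (\<Lambda> * m y $ k - T k) + W j k * (\<Lambda> * m y $ i - T i) + W k i * (\<Lambda> * m y $ j - T j))
      = \<Lambda> * (W i j * m y $ k + W j k * m y $ i + W k i * m y $ j) + 6 * \<Lambda> * P y * cartan F y i j k"
    using WT by (simp add: algebra_simps)
  also have "\<dots> = 6 * \<Lambda> * cartan B y i j k"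
    unfolding cartan_bar[OF y] W_def by (simp add: algebra_simps)
  finally have "6 * \<Lambda> * cartan B y i j k = W i j * (\<Lambda> * m y $ k - T k)
      + W j k * (\<Lambda> * m y $ i - T i) + W k i * (\<Lambda> * m y $ j - T j)" by simp
  then show ?thesis
    unfolding C Q times_divide_eq_left add_divide_distrib[symmetric]
    using \<Lambda> by (simp add: eq_divide_eq mult_ac)
qed

end

section \<open>Linear changes of coordinates\<close>

lemma pd_compose_linear:
  assumes "H differentiable (at (J *v y))"
  shows "pd i (\<lambda>z. H (J *v z)) y = (\<Sum>k\<in>UNIV. J $ k $ i * pd k H (J *v y))"
proof -
  have "pd i (\<lambda>z. H (J *v z)) y = deriv (\<lambda>t. H (J *v y + t *\<^sub>R (J *v axis i 1))) 0"
    by (simp add: pd_def matrix_vector_right_distrib matrix_vector_mult_scaleR)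
  also have "\<dots> = frechet_derivative H (at (J *v y)) (J *v axis i 1)"
    by (rule deriv_along_line[OF assms])
  also have "\<dots> = (\<Sum>k\<in>UNIV. J $ k $ i * pd k H (J *v y))"
    by (simp add: frechet_derivative_pd[OF assms] matrix_vector_mult_basis column_def)
  finally show ?thesis .
qed

text \<open>The direction variable changes linearly between charts, so a second derivative transforms like a
  bilinear form, without a term from the second derivative of the coordinate change.\<close>

lemma metric_compose_linear:
  fixes J :: "real ^ 'n::finite ^ 'n"
  assumes U: "open U" "smooth_on U F" "J *v y \<in> U"
  shows "metric (\<lambda>z. F (J *v z)) y = transpose J ** metric F (J *v y) ** J"
proof -
  have sm: "smooth_on U (\<lambda>z. (F z)\<^sup>2)" by (rule smooth_on_power[OF U(1,2)])
  let ?V = "(\<lambda>z. J *v z) -` U"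
  have V: "open ?V" by (rule open_vimage[OF U(1)]) (intro continuous_intros)
  have smG: "smooth_on U (\<lambda>w. \<Sum>k\<in>UNIV. J $ k $ j * pd k (\<lambda>z. (F z)\<^sup>2) w)" for j
    by (intro smooth_on_sum smooth_on_mult U smooth_on_const smooth_on_pd sm finite)
  have "metric (\<lambda>z. F (J *v z)) y $ i $ j = (transpose J ** metric F (J *v y) ** J) $ i $ j" for i j
  proof -
    let ?G = "\<lambda>w. \<Sum>k\<in>UNIV. J $ k $ j * pd k (\<lambda>z. (F z)\<^sup>2) w"
    have pd_G: "pd l ?G (J *v y) = (\<Sum>k\<in>UNIV. J $ k $ j * pd l (pd k (\<lambda>z. (F z)\<^sup>2)) (J *v y))" for l
    proof -
      have "has_pd ?G (\<Sum>k\<in>UNIV. 0 * pd k (\<lambda>z. (F z)\<^sup>2) (J *v y)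
          + pd l (pd k (\<lambda>z. (F z)\<^sup>2)) (J *v y) * J $ k $ j) l (J *v y)"
        by (intro has_pd_sum finite has_pd_mult has_pd_const has_pd_smooth[OF smooth_on_pd[OF U(1) sm] U(3)])
      then show ?thesis using has_pd_imp_pd by (fastforce simp: mult.commute)
    qed
    have "has_pd (\<lambda>z. ?G (J *v z)) (pd i (\<lambda>z. ?G (J *v z)) y) i y"
    proof (rule has_pd_pd)
      have "?G differentiable (at (J *v y))" by (rule smooth_on_differentiable[OF smG U(3)])
      moreover have "(\<lambda>z. J *v z) differentiable (at y)"
        by (intro bounded_linear_imp_differentiable matrix_vector_mul_bounded_linear)
      ultimately show "(\<lambda>z. ?G (J *v z)) differentiable (at y)"
        using differentiable_chain_at[of "\<lambda>z. J *v z" y ?G] by (simp add: o_def)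
    qed
    then have "has_pd (pd j (\<lambda>z. (F (J *v z))\<^sup>2)) (pd i (\<lambda>z. ?G (J *v z)) y) i y"
      by (rule has_pd_cong[OF V _ _, rotated 2])
        (use U(3) in \<open>auto simp: pd_compose_linear[OF smooth_on_differentiable[OF sm]]\<close>)
    then have "pd i (pd j (\<lambda>z. (F (J *v z))\<^sup>2)) y = (\<Sum>l\<in>UNIV. J $ l $ i * pd l ?G (J *v y))"
      using pd_compose_linear[OF smooth_on_differentiable[OF smG U(3)]] by (simp add: has_pd_imp_pd)
    then show ?thesis
      unfolding pd_G
      by (simp add: metric_def matrix_matrix_mult_def transpose_def sum_distrib_left sum_distrib_right
          mult_ac sum_divide_distrib) (subst sum.swap, simp add: mult_ac)
  qed
  then show ?thesis by (simp add: vec_eq_iff)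
qed

lemma m_sq_eq: "m_sq b F y = m_cov b F y \<bullet> (inv_metric F y *v m_cov b F y)"
  by (simp add: m_sq_def inner_vec_def matrix_vector_mult_def sum_distrib_left mult_ac)

lemma inner_angular_metric:
  "v \<bullet> (angular_metric F y *v w) = v \<bullet> (metric F y *v w) - (\<Sum>i\<in>UNIV. v $ i * pd i F y) * (\<Sum>i\<in>UNIV. w $ i * pd i F y)"
  by (simp add: angular_metric_def inner_vec_def matrix_vector_mult_def left_diff_distrib right_diff_distrib
      sum_subtractf sum_distrib_left sum_distrib_right mult_ac) (subst sum.swap, simp add: mult_ac)

lemma inner_reducing_tensor:
  "v \<bullet> (reducing_tensor f s b F y *v w) = (3 * exp s * pm1 f s b F y * (v \<bullet> (angular_metric F y *v w))
     + p02 f s b F y * (m_cov b F y \<bullet> v) * (m_cov b F y \<bullet> w)) / (6 * lam f s b F y)"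
  by (simp add: reducing_tensor_def inner_vec_def matrix_vector_mult_def sum_divide_distrib sum_distrib_left
      sum_distrib_right distrib_left distrib_right sum.distrib add_divide_distrib mult_ac)

text \<open>Every constituent of the tensor is covariant: \<open>m\<close> is a covector, \<open>h\<close> a bilinear form, and \<open>m\<^sup>2\<close>, hence
  \<open>\<lambda>\<close>, is invariant since the inverse metric transforms contravariantly.\<close>

lemma reducing_tensor_compose_linear:
  fixes J :: "real ^ 'n::finite ^ 'n"
  assumes U: "open U" "smooth_on U F" "J *v y \<in> U" and J: "invertible J" and g: "invertible (metric F (J *v y))"
    and F': "\<And>z. F' z = F (J *v z)" and b': "\<And>z. b' \<bullet> z = b \<bullet> (J *v z)"
  shows "v \<bullet> (reducing_tensor f s b' F' y *v w) = (J *v v) \<bullet> (reducing_tensor f s b F (J *v y) *v (J *v w))"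
proof -
  have F'_eq: "F' = (\<lambda>z. F (J *v z))" using F' by blast
  have metric: "metric F' y = transpose J ** metric F (J *v y) ** J"
    unfolding F'_eq by (rule metric_compose_linear[OF U])
  have metric': "metric F' y *v z = transpose J *v (metric F (J *v y) *v (J *v z))" for z
    unfolding metric by (simp add: matrix_vector_mul_assoc matrix_mul_assoc)
  have y_low: "y_low G z = metric G z *v z" for G :: "real ^ 'n \<Rightarrow> real" and z
    by (simp add: y_low_def matrix_vector_mult_def)
  have b: "b' = transpose J *v b"
    using b' inner_transpose[of J b] by (metis vector_eq_rdot)
  have m_cov: "m_cov c G z = c - ((c \<bullet> z) / (G z)\<^sup>2) *\<^sub>R y_low G z" for c z and G :: "real ^ 'n \<Rightarrow> real"
    by (simp add: m_cov_def vec_eq_iff)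
  have m: "m_cov b' F' y = transpose J *v m_cov b F (J *v y)"
    unfolding m_cov b'[of y] F' y_low metric' unfolding b
    by (simp add: matrix_vector_mult_diff_distrib matrix_vector_mult_scaleR)
  have msq: "m_sq b' F' y = m_sq b F (J *v y)"
  proof -
    have KT: "transpose (matrix_inv J) ** transpose J = mat 1"
      using matrix_inv_works(1)[OF J] by (metis matrix_transpose_mul transpose_mat)
    have "inv_metric F' y *v m_cov b' F' y =
       matrix_inv J *v (inv_metric F (J *v y) *v ((transpose (matrix_inv J) ** transpose J) *v m_cov b F (J *v y)))"
      unfolding inv_metric_def metric matrix_inv_congruence[OF J g] m by (simp only: matrix_vector_mul_assoc matrix_mul_assoc)
    then show ?thesis
      unfolding m_sq_eq KT unfolding m inner_transpose
      by (simp add: matrix_vector_mul_assoc matrix_mul_assoc matrix_inv_works[OF J])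
  qed
  have scal: "pc f s b' F' y = pc f s b F (J *v y)" "q0 f s b' F' y = q0 f s b F (J *v y)"
     "pm1 f s b' F' y = pm1 f s b F (J *v y)" "p02 f s b' F' y = p02 f s b F (J *v y)"
    by (simp_all add: pc_def q0_def pm1_def p02_def F' b')
  have lam: "lam f s b' F' y = lam f s b F (J *v y)"
    unfolding lam_def s0_def scal msq ..
  have grad: "(\<Sum>i\<in>UNIV. u $ i * pd i F' y) = (\<Sum>i\<in>UNIV. (J *v u) $ i * pd i F (J *v y))" for u
    unfolding F'_eq pd_compose_linear[OF smooth_on_differentiable[OF U(2,3)]]
    by (simp add: sum_distrib_left sum_distrib_right matrix_vector_mult_def mult_ac) (rule sum.swap)
  have ang: "v \<bullet> (angular_metric F' y *v w) = (J *v v) \<bullet> (angular_metric F (J *v y) *v (J *v w))"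
    unfolding inner_angular_metric grad metric'
    using inner_transpose[of J "metric F (J *v y) *v (J *v w)" v] by (simp add: inner_commute)
  show ?thesis
    unfolding inner_reducing_tensor scal lam ang m inner_transpose ..
qed

section \<open>Smooth dependence on position and direction\<close>

lemma smooth_on_joint_pd:
  assumes "open W" "smooth_on W (\<lambda>(x, y). H x y)"
  shows "smooth_on W (\<lambda>(x :: 'a::real_normed_vector, y). pd i (H x) y)"
proof (rule smooth_on_cong[OF assms(1) _ smooth_on_frechet_derivative[OF assms(2)]])
  fix w assume w: "w \<in> W"
  obtain x y where xy: "w = (x, y)" by (cases w)
  have "deriv (\<lambda>t. (\<lambda>(x, y). H x y) ((x, y) + t *\<^sub>R (0, axis i 1))) 0 =
      frechet_derivative (\<lambda>(x, y). H x y) (at (x, y)) (0, axis i 1)"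
    by (rule deriv_along_line) (use smooth_on_differentiable[OF assms(2) w] xy in simp)
  then show "frechet_derivative (\<lambda>(x, y). H x y) (at w) (0, axis i 1) = (case w of (x, y) \<Rightarrow> pd i (H x) y)"
    by (simp add: xy pd_def)
qed

lemma smooth_on_det:
  fixes A :: "'a::real_normed_vector \<Rightarrow> real ^ 'n::finite ^ 'n"
  assumes "open W" "\<And>i j. smooth_on W (\<lambda>x. A x $ i $ j)"
  shows "smooth_on W (\<lambda>x. det (A x))"
  unfolding det_def
  by (intro smooth_on_sum smooth_on_mult smooth_on_prod smooth_on_const assms finite finite_permutations)

text \<open>Cramer's rule makes the entries of the inverse rational in those of the matrix, hence smooth
  functions of a parameter.\<close>

lemma matrix_inv_cramer:
  fixes A :: "real ^ 'n::finite ^ 'n"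
  assumes "invertible A"
  shows "matrix_inv A $ i $ j = det (\<chi> k l. if l = i then if k = j then 1 else 0 else A $ k $ l) / det A"
proof -
  have "A *v (matrix_inv A *v axis j 1) = axis j 1"
    by (simp add: matrix_vector_mul_assoc matrix_inv_works[OF assms])
  then have "matrix_inv A *v axis j 1 = (\<chi> i. det (\<chi> k l. if l = i then axis j 1 $ k else A $ k $ l) / det A)"
    using cramer[of A "matrix_inv A *v axis j 1" "axis j 1"] invertible_det_nz[of A] assms by blast
  then have "(matrix_inv A *v axis j 1) $ i = det (\<chi> k l. if l = i then axis j 1 $ k else A $ k $ l) / det A"
    by simp
  moreover have "(axis j 1 :: real ^ 'n) $ k = (if k = j then 1 else 0)" for k
    by (simp add: axis_def)
  ultimately show ?thesis
    by (simp add: matrix_vector_mult_basis column_def cong: if_cong)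
qed

lemma smooth_on_matrix_inv:
  fixes A :: "'a::real_normed_vector \<Rightarrow> real ^ 'n::finite ^ 'n"
  assumes W: "open W" and sm: "\<And>i j. smooth_on W (\<lambda>x. A x $ i $ j)" and inv: "\<And>x. x \<in> W \<Longrightarrow> invertible (A x)"
  shows "smooth_on W (\<lambda>x. matrix_inv (A x) $ i $ j)"
proof (rule smooth_on_cong[OF W])
  show "smooth_on W (\<lambda>x. det (\<chi> k l. if l = i then if k = j then 1 else 0 else A x $ k $ l) / det (A x))"
  proof (intro smooth_on_divide[OF W] smooth_on_det[OF W])
    fix k l
    show "smooth_on W (\<lambda>x. (\<chi> k l. if l = i then if k = j then 1 else 0 else A x $ k $ l) $ k $ l)"
      using sm by (cases "l = i"; cases "k = j") simp_all
  qed (use sm inv invertible_det_nz in auto)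
qed (simp add: matrix_inv_cramer inv)

lemma smooth_on_reducing_tensor:
  fixes F :: "'a::real_normed_vector \<Rightarrow> real ^ 'n::finite \<Rightarrow> real"
  assumes W: "open W" and F: "smooth_on W (\<lambda>(x, y). F x y)"
    and s: "smooth_on W (\<lambda>(x, y). s x)" and b: "smooth_on W (\<lambda>(x, y). b x)"
    and f: "homogeneous2 \<Omega> f"
    and nz: "\<And>x y. (x, y) \<in> W \<Longrightarrow> F x y \<noteq> 0 \<and> invertible (metric (F x) y) \<and>
       (exp (s x) * F x y, b x \<bullet> y) \<in> \<Omega> \<and> f (exp (s x) * F x y) (b x \<bullet> y) \<noteq> 0 \<and>
       pc f (s x) (b x) (F x) y \<noteq> 0 \<and>
       exp (s x) * pc f (s x) (b x) (F x) y + m_sq (b x) (F x) y * q0 f (s x) (b x) (F x) y \<noteq> 0 \<and>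
       lam f (s x) (b x) (F x) y \<noteq> 0"
  shows "smooth_on W (\<lambda>(x, y). reducing_tensor f (s x) (b x) (F x) y)"
proof -
  interpret f: homogeneous2 \<Omega> f by (rule f)
  let ?F = "\<lambda>w. F (fst w) (snd w)" and ?s = "\<lambda>w :: 'a \<times> (real ^ 'n). s (fst w)" and ?b = "\<lambda>w :: 'a \<times> (real ^ 'n). b (fst w)"
  let ?t = "\<lambda>w. ?b w \<bullet> snd w" and ?a = "\<lambda>w. exp (?s w) * ?F w"
  note add = smooth_on_add[OF W] and diff = smooth_on_diff[OF W] and mult = smooth_on_mult[OF W]
    and divide = smooth_on_divide[OF W] and sum = smooth_on_sum[OF W finite] and pow = smooth_on_power[OF W]
  have F': "smooth_on W ?F" and s': "smooth_on W ?s" and b': "smooth_on W ?b"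
    using F s b by (simp_all add: case_prod_beta')
  have snd': "smooth_on W snd" by (rule smooth_on_bounded_linear[OF W bounded_linear_snd])
  have y: "smooth_on W (\<lambda>w. snd w $ i)" for i
    by (rule smooth_on_component[OF W snd'])
  have bi: "smooth_on W (\<lambda>w. ?b w $ i)" for i
    by (rule smooth_on_component[OF W b'])
  have t: "smooth_on W ?t"
    by (rule smooth_on_bilinear[OF W bounded_bilinear_inner b' snd'])
  have es: "smooth_on W (\<lambda>w. exp (?s w))" and es': "smooth_on W (\<lambda>w. exp (- ?s w))"
    by (intro smooth_on_exp[OF W] smooth_on_minus[OF W] s')+
  have a: "smooth_on W ?a" by (rule mult[OF es F'])
  have comp: "smooth_on W (\<lambda>w. g (?a w) (?t w))" if "smooth_on \<Omega> (uncurry2 g)" for g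
    using smooth_on_compose[OF W that smooth_on_Pair_real[OF W a t]] nz by auto
  have pdF: "smooth_on W (\<lambda>w. pd i (F (fst w)) (snd w))" for i
    using smooth_on_joint_pd[OF W F] by (simp add: case_prod_beta')
  have F2: "smooth_on W (\<lambda>(x, y). (F x y)\<^sup>2)"
    using pow[OF F', of 2] by (simp add: case_prod_beta')
  have g: "smooth_on W (\<lambda>w. metric (F (fst w)) (snd w) $ i $ j)" for i j
    using mult[OF smooth_on_const[of W "1/2"] smooth_on_joint_pd[OF W smooth_on_joint_pd[OF W F2], of i j]]
    unfolding metric_def vec_lambda_beta case_prod_beta' .
  have gi: "smooth_on W (\<lambda>w. inv_metric (F (fst w)) (snd w) $ i $ j)" for i j
    unfolding inv_metric_def by (rule smooth_on_matrix_inv[OF W g]) (use nz in auto)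
  have yl: "smooth_on W (\<lambda>w. y_low (F (fst w)) (snd w) $ i)" for i
    unfolding y_low_def vec_lambda_beta by (intro sum mult g y)
  have m: "smooth_on W (\<lambda>w. m_cov (?b w) (F (fst w)) (snd w) $ i)" for i
    unfolding m_cov_def vec_lambda_beta
    by (intro diff bi mult[OF _ yl] divide t pow F') (use nz in auto)
  have msq: "smooth_on W (\<lambda>w. m_sq (?b w) (F (fst w)) (snd w))"
    unfolding m_sq_def by (intro sum mult gi m)
  have h: "smooth_on W (\<lambda>w. angular_metric (F (fst w)) (snd w) $ i $ j)" for i j
    unfolding angular_metric_def vec_lambda_beta by (intro diff g mult pdF)
  have pc: "smooth_on W (\<lambda>w. pc f (?s w) (?b w) (F (fst w)) (snd w))"
    unfolding pc_def p_fun_def by (intro divide mult comp f.smooth_Ds F') (use nz in auto)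
  have q0: "smooth_on W (\<lambda>w. q0 f (?s w) (?b w) (F (fst w)) (snd w))"
    unfolding q0_def by (rule comp[OF f.smooth_q0_fun])
  have p02: "smooth_on W (\<lambda>w. p02 f (?s w) (?b w) (F (fst w)) (snd w))"
    unfolding p02_def p02_fun_def by (rule comp[OF smooth_on_D2[OF f.open_\<Omega> f.smooth_p0_fun]])
  have pm1: "smooth_on W (\<lambda>w. pm1 f (?s w) (?b w) (F (fst w)) (snd w))"
    unfolding pm1_def pm1_fun_def pc_def[symmetric]
    by (intro add divide[OF mult] comp f.smooth_Ds F' pc) (use nz in auto)
  have den: "smooth_on W (\<lambda>w. exp (?s w) * pc f (?s w) (?b w) (F (fst w)) (snd w) +
      m_sq (?b w) (F (fst w)) (snd w) * q0 f (?s w) (?b w) (F (fst w)) (snd w))"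
    by (intro add mult es pc msq q0)
  have s0: "smooth_on W (\<lambda>w. s0 f (?s w) (?b w) (F (fst w)) (snd w))"
    unfolding s0_def by (intro divide[OF mult[OF es' q0] mult[OF pc den]]) (use nz in auto)
  have lam: "smooth_on W (\<lambda>w. lam f (?s w) (?b w) (F (fst w)) (snd w))"
  proof -
    have den': "smooth_on W (\<lambda>w. 2 * (exp (?s w) * pc f (?s w) (?b w) (F (fst w)) (snd w) +
      q0 f (?s w) (?b w) (F (fst w)) (snd w) * m_sq (?b w) (F (fst w)) (snd w)))"
      by (intro add mult es pc msq q0 smooth_on_const)
    have nz': "2 * (exp (?s w) * pc f (?s w) (?b w) (F (fst w)) (snd w) +
      q0 f (?s w) (?b w) (F (fst w)) (snd w) * m_sq (?b w) (F (fst w)) (snd w)) \<noteq> 0" if "w \<in> W" for w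
      using nz[of "fst w" "snd w"] that by (simp only: mult_eq_0_iff mult.commute[of "q0 _ _ _ _ _"]) simp
    show ?thesis
      unfolding lam_def
      by (intro add diff divide[OF mult[OF smooth_on_const pm1] mult[OF smooth_on_const pc]]
          divide[OF mult[OF mult[OF mult[OF mult[OF smooth_on_const es] pm1] msq] s0] smooth_on_const]
          divide[OF mult[OF p02 msq] den' nz'])
        (use nz in auto)
  qed
  have "smooth_on W (\<lambda>w. reducing_tensor f (?s w) (?b w) (F (fst w)) (snd w) $ i $ j)" for i j
    unfolding reducing_tensor_def vec_lambda_beta
    by (intro divide[OF add[OF mult[OF mult[OF mult[OF smooth_on_const es] pm1] h] mult[OF mult[OF p02 m] m]]
          mult[OF smooth_on_const lam]]) (use nz in auto)
  then have "smooth_on W (\<lambda>w. reducing_tensor f (?s w) (?b w) (F (fst w)) (snd w))"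
    by (intro smooth_on_vector[OF W])
  then show ?thesis by (simp add: case_prod_beta')
qed

section \<open>Charts and tangent vectors\<close>

lemma chart_inv_image:
  assumes "x \<in> snd c ` fst c"
  shows "chart_inv c x \<in> fst c" and "snd c (chart_inv c x) = x"
  using assms by (simp_all add: chart_inv_def inv_into_into f_inv_into_f)

locale smooth_atlas =
  fixes M :: "'p topology" and A :: "('p, 'n::finite) chart set"
  assumes manifold: "smooth_manifold M A"
begin

lemma chart:
  assumes "c \<in> A"
  shows "openin M (fst c)" and "open (snd c ` fst c)"
    and "homeomorphic_map (subtopology M (fst c)) (top_of_set (snd c ` fst c)) (snd c)"
proof -
  have "\<forall>c\<in>A. openin M (fst c) \<and> open (snd c ` fst c) \<and>
      homeomorphic_map (subtopology M (fst c)) (top_of_set (snd c ` fst c)) (snd c)"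
    using manifold unfolding smooth_manifold_def by (elim conjE)
  then show "openin M (fst c)" and "open (snd c ` fst c)"
    and "homeomorphic_map (subtopology M (fst c)) (top_of_set (snd c ` fst c)) (snd c)"
    using assms by simp_all
qed

lemma chart_inv_chart:
  assumes "c \<in> A" "p \<in> fst c" shows "chart_inv c (snd c p) = p"
proof -
  have "inj_on (snd c) (topspace (subtopology M (fst c)))"
    using chart(3)[OF assms(1)] by (rule homeomorphic_imp_injective_map)
  moreover have "topspace (subtopology M (fst c)) = fst c"
    using openin_subset[OF chart(1)[OF assms(1)]] by (simp add: inf.absorb2)
  ultimately show ?thesis
    using assms(2) by (simp add: chart_inv_def)
qed

lemma open_overlap:
  assumes "c \<in> A" "d \<in> A" shows "open (snd c ` (fst c \<inter> fst d))"
proof -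
  have "openin (subtopology M (fst c)) (fst c \<inter> fst d)"
    using chart(1)[OF assms(2)] by (rule openin_subtopology_Int2)
  then have "openin (top_of_set (snd c ` fst c)) (snd c ` (fst c \<inter> fst d))"
    using homeomorphic_imp_open_map[OF chart(3)[OF assms(1)]] by (simp add: open_map_def)
  then show ?thesis using chart(2)[OF assms(1)] by (rule openin_open_trans)
qed

definition "jac c d p = matrix (frechet_derivative (snd d \<circ> chart_inv c) (at (snd c p)))"

lemma transition_has_derivative:
  assumes "c \<in> A" "d \<in> A" "p \<in> fst c" "p \<in> fst d"
  shows "((snd d \<circ> chart_inv c) has_derivative (\<lambda>y. jac c d p *v y)) (at (snd c p))"
    and "frechet_derivative (snd d \<circ> chart_inv c) (at (snd c p)) = (\<lambda>y. jac c d p *v y)"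
proof -
  have "smooth_on (snd c ` (fst c \<inter> fst d)) (snd d \<circ> chart_inv c)"
    using manifold assms(1,2) unfolding smooth_manifold_def by blast
  then have d: "(snd d \<circ> chart_inv c) differentiable (at (snd c p))"
    using assms(3,4) by (intro smooth_on_differentiable) auto
  show 1: "frechet_derivative (snd d \<circ> chart_inv c) (at (snd c p)) = (\<lambda>y. jac c d p *v y)"
    using linear_frechet_derivative[OF d] by (simp add: jac_def)
  show "((snd d \<circ> chart_inv c) has_derivative (\<lambda>y. jac c d p *v y)) (at (snd c p))"
    using d unfolding frechet_derivative_works 1 .
qed

lemma tvec_eq:
  assumes "c \<in> A" "p \<in> fst c"
  shows "tvec A c p y = (\<lambda>d. if d \<in> A \<and> p \<in> fst d then jac c d p *v y else 0)"
  by (rule ext) (simp add: tvec_def transition_has_derivative(2)[OF assms(1) _ assms(2)])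

lemma jac_self:
  assumes "c \<in> A" "p \<in> fst c" shows "jac c c p = mat 1"
proof -
  have "((\<lambda>x. x) has_derivative (\<lambda>y. y)) (at (snd c p))" by (rule has_derivative_ident)
  then have "((snd c \<circ> chart_inv c) has_derivative (\<lambda>y. y)) (at (snd c p))"
    by (rule has_derivative_transform_within_open[OF _ chart(2)[OF assms(1)]])
      (use assms in \<open>auto simp: chart_inv_chart\<close>)
  then have "(\<lambda>y. jac c c p *v y) = (\<lambda>y. y)"
    using transition_has_derivative(1)[OF assms(1,1,2,2)] has_derivative_unique by blast
  then have "jac c c p *v y = mat 1 *v y" for y
    by (metis matrix_vector_mul_lid)
  then show ?thesis by (simp add: matrix_eq)
qed

text \<open>The chain rule is applied on the overlap of \<open>c\<close> and \<open>d\<close>, where the transition from \<open>c\<close> to \<open>e\<close> factors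
  through \<open>d\<close>; the overlap is open in the coordinates of \<open>c\<close>.\<close>

lemma jac_chain:
  assumes "c \<in> A" "d \<in> A" "e \<in> A" "p \<in> fst c" "p \<in> fst d" "p \<in> fst e"
  shows "jac c e p *v y = jac d e p *v (jac c d p *v y)"
proof -
  have p: "(snd d \<circ> chart_inv c) (snd c p) = snd d p"
    by (simp add: chart_inv_chart[OF assms(1,4)])
  have "((\<lambda>x. (snd e \<circ> chart_inv d) ((snd d \<circ> chart_inv c) x)) has_derivative
      (\<lambda>y. jac d e p *v (jac c d p *v y))) (at (snd c p))"
    by (rule has_derivative_compose[where f="snd d \<circ> chart_inv c", OF transition_has_derivative(1)[OF assms(1,2,4,5)]])
      (unfold p, rule transition_has_derivative(1)[OF assms(2,3,5,6)])
  then have "((snd e \<circ> chart_inv c) has_derivative (\<lambda>y. jac d e p *v (jac c d p *v y))) (at (snd c p))"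
  proof (rule has_derivative_transform_within_open[OF _ open_overlap[OF assms(1,2)]])
    show "snd c p \<in> snd c ` (fst c \<inter> fst d)" using assms by auto
    fix x assume "x \<in> snd c ` (fst c \<inter> fst d)"
    then obtain q where "q \<in> fst c" "q \<in> fst d" "x = snd c q" by auto
    then show "(snd e \<circ> chart_inv d) ((snd d \<circ> chart_inv c) x) = (snd e \<circ> chart_inv c) x"
      by (simp add: chart_inv_chart assms)
  qed
  then have "(\<lambda>y. jac c e p *v y) = (\<lambda>y. jac d e p *v (jac c d p *v y))"
    using transition_has_derivative(1)[OF assms(1,3,4,6)] has_derivative_unique by blast
  then show ?thesis by metis
qed

lemma invertible_jac:
  assumes "c \<in> A" "d \<in> A" "p \<in> fst c" "p \<in> fst d"
  shows "invertible (jac c d p)"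
proof -
  have "jac d c p *v (jac c d p *v y) = y" for y
    using jac_chain[OF assms(1,2,1,3,4,3), of y] by (simp add: jac_self assms)
  then have "jac d c p ** jac c d p = mat 1"
    by (simp add: matrix_eq matrix_vector_mul_assoc[symmetric])
  then show ?thesis
    unfolding invertible_def using matrix_left_right_inverse by blast
qed

lemma tvec_change:
  assumes "c \<in> A" "d \<in> A" "p \<in> fst c" "p \<in> fst d"
  shows "tvec A c p y = tvec A d p (jac c d p *v y)"
  unfolding tvec_eq[OF assms(1,3)] tvec_eq[OF assms(2,4)]
proof (rule ext)
  fix e
  show "(if e \<in> A \<and> p \<in> fst e then jac c e p *v y else 0) =
      (if e \<in> A \<and> p \<in> fst e then jac d e p *v (jac c d p *v y) else 0)"
    using jac_chain[OF assms(1,2) _ assms(3,4), of e y] by simp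
qed

lemma tpoint_change:
  assumes "c \<in> A" "d \<in> A" "x \<in> snd c ` fst c" "chart_inv c x = p" "p \<in> fst d"
  shows "tpoint A c x y = tpoint A d (snd d p) (jac c d p *v y)"
proof -
  have "p \<in> fst c" using chart_inv_image(1)[OF assms(3)] assms(4) by simp
  then have "tvec A c p y = tvec A d p (jac c d p *v y)"
    using assms by (intro tvec_change) auto
  then show ?thesis
    unfolding tpoint_def assms(4) chart_inv_chart[OF assms(2,5)] by simp
qed

lemma tpoint_scale:
  assumes "c \<in> A" "x \<in> snd c ` fst c"
  shows "tpoint A c x (t *\<^sub>R y) = (fst (tpoint A c x y), \<lambda>d. t *\<^sub>R snd (tpoint A c x y) d)"
  using chart_inv_image(1)[OF assms(2)]
  by (auto simp: tpoint_def tvec_eq[OF assms(1)] matrix_vector_mult_scaleR)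

lemma one_form_eq:
  assumes "one_form A \<beta>" "c \<in> A" "x \<in> snd c ` fst c"
  shows "\<beta> (tpoint A c x y) = form_comp A c \<beta> x \<bullet> y"
proof -
  have lin: "linear (\<lambda>y. \<beta> (tpoint A c x y))"
    using assms unfolding one_form_def by blast
  have "y = (\<Sum>i\<in>UNIV. y $ i *\<^sub>R axis i 1)"
    using basis_expansion[of y] by (simp add: scalar_mult_eq_scaleR)
  then have "\<beta> (tpoint A c x y) = \<beta> (tpoint A c x (\<Sum>i\<in>UNIV. y $ i *\<^sub>R axis i 1))"
    by (rule arg_cong[where f="\<lambda>y. \<beta> (tpoint A c x y)"])
  also have "\<dots> = (\<Sum>i\<in>UNIV. y $ i * \<beta> (tpoint A c x (axis i 1)))"
    by (simp only: linear_sum[OF lin] linear_scale[OF lin] real_scaleR_def)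
  finally show ?thesis by (simp add: form_comp_def inner_vec_def mult.commute)
qed

end

lemma smooth_on_slice:
  fixes W :: "('a::euclidean_space \<times> 'b::euclidean_space) set"
  assumes "open W" "smooth_on W (\<lambda>(x, y). H x y)"
  shows "open {y. (x, y) \<in> W}" and "smooth_on {y. (x, y) \<in> W} (H x)"
proof -
  have "open ((\<lambda>y. (x, y)) -` W)"
    by (rule open_vimage[OF assms(1)]) (intro continuous_intros)
  then show op: "open {y. (x, y) \<in> W}" by (simp add: vimage_def)
  have "smooth_on {y. (x, y) \<in> W} (\<lambda>y. (x, 0) + (0, y))"
    by (intro smooth_on_add[OF op] smooth_on_const smooth_on_bounded_linear[OF op]
        bounded_linear_Pair bounded_linear_zero bounded_linear_ident)
  then have pair: "smooth_on {y. (x, y) \<in> W} (\<lambda>y. (x, y))" by simp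
  have "smooth_on {y. (x, y) \<in> W} (\<lambda>y. case (x, y) of (x, y) \<Rightarrow> H x y)"
    by (rule smooth_on_compose[OF op assms(2) pair]) simp
  then show "smooth_on {y. (x, y) \<in> W} (H x)" by simp
qed

lemma tcoords_image: "(x, y) \<in> tcoords A c D \<Longrightarrow> x \<in> snd c ` fst c"
  by (simp add: tcoords_def)

lemma finsler_space_slice:
  assumes F: "finsler_space M A D L" and c: "c \<in> A"
  shows "finsler_cone {y. (x, y) \<in> tcoords A c D} (local_rep A c L x)"
proof -
  interpret smooth_atlas M A using F by (unfold_locales) (simp add: finsler_space_def)
  have W: "open (tcoords A c D)" "smooth_on (tcoords A c D) (\<lambda>(x, y). local_rep A c L x y)"
    and pos: "\<And>u. u \<in> D \<Longrightarrow> 0 < L u"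
    and cone: "\<And>p v t. (p, v) \<in> D \<Longrightarrow> t > 0 \<Longrightarrow> (p, \<lambda>d. t *\<^sub>R v d) \<in> D \<and> L (p, \<lambda>d. t *\<^sub>R v d) = t * L (p, v)"
    using F c unfolding finsler_space_def by blast+
  show ?thesis
  proof
    fix y and t :: real assume y: "y \<in> {y. (x, y) \<in> tcoords A c D}"
    then have x: "x \<in> snd c ` fst c" and D: "tpoint A c x y \<in> D" by (simp_all add: tcoords_def)
    show "0 < local_rep A c L x y" using pos[OF D] by (simp add: local_rep_def)
    assume "t > 0"
    then show "t *\<^sub>R y \<in> {y. (x, y) \<in> tcoords A c D}" "local_rep A c L x (t *\<^sub>R y) = t * local_rep A c L x y"
      using cone[of "fst (tpoint A c x y)" "snd (tpoint A c x y)" t] D x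
      by (simp_all add: tcoords_def local_rep_def tpoint_scale[OF c x])
  qed (use smooth_on_slice[OF W] in auto)
qed

section \<open>The reducing tensor field\<close>

text \<open>A tensor field has to be a function on the tangent bundle, whereas the reducing tensor is given by
  components. Its value is read off in one chosen chart around each point; by the transformation law
  all other charts then show the same tensor.\<close>

definition chart_at :: "('p, 'n) chart set \<Rightarrow> 'p \<Rightarrow> ('p, 'n) chart" where
  "chart_at A p = (SOME c. c \<in> A \<and> p \<in> fst c)"

definition reducing_field :: "('p, 'n::finite) chart set \<Rightarrow> ('p \<Rightarrow> real) \<Rightarrow> ('p \<times> ('p, 'n) tvec \<Rightarrow> real) \<Rightarrow>
    (real \<Rightarrow> real \<Rightarrow> real) \<Rightarrow> ('p \<times> ('p, 'n) tvec \<Rightarrow> real) \<Rightarrow>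
    'p \<times> ('p, 'n) tvec \<Rightarrow> ('p, 'n) tvec \<Rightarrow> ('p, 'n) tvec \<Rightarrow> real" where
  "reducing_field A \<sigma> \<beta> f L u v w = (let p = fst u; d = chart_at A p; x = snd d p in
     v d \<bullet> (reducing_tensor f (\<sigma> p) (form_comp A d \<beta> x) (local_rep A d L x) (snd u d) *v w d))"

locale generalized_beta_change =
  fixes M :: "'p topology" and A :: "('p, 'n::finite) chart set" and D L \<sigma> \<beta> \<Omega> f
  assumes change: "gen_beta_conformal_change M A D L \<sigma> \<beta> \<Omega> f"
    and standing: "\<And>c x y. c \<in> A \<Longrightarrow> (x, y) \<in> tcoords A c D \<Longrightarrow>
      let F = local_rep A c L x; b = form_comp A c \<beta> x; s = \<sigma> (chart_inv c x) in
        m_cov b F y \<noteq> 0 \<and> m_sq b F y \<noteq> 0 \<and> pc f s b F y \<noteq> 0 \<and>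
        exp s * pc f s b F y + m_sq b F y * q0 f s b F y \<noteq> 0"
    and lam_nonzero: "\<And>c x y. c \<in> A \<Longrightarrow> (x, y) \<in> tcoords A c D \<Longrightarrow>
      lam f (\<sigma> (chart_inv c x)) (form_comp A c \<beta> x) (local_rep A c L x) y \<noteq> 0"
begin

lemma finsler: "finsler_space M A D L" "finsler_space M A D (changed_L \<sigma> \<beta> f L)"
  and \<sigma>: "smooth_function A \<sigma>" and \<beta>: "one_form A \<beta>"
  and in_\<Omega>: "u \<in> D \<Longrightarrow> (exp (\<sigma> (fst u)) * L u, \<beta> u) \<in> \<Omega>"
  using change unfolding gen_beta_conformal_change_def by blast+

sublocale smooth_atlas M A
  using finsler(1) by unfold_locales (simp add: finsler_space_def)

lemma homogeneous: "homogeneous2 \<Omega> f"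
  using change unfolding gen_beta_conformal_change_def by unfold_locales auto

lemma local_rep_changed:
  assumes "c \<in> A" "x \<in> snd c ` fst c"
  shows "local_rep A c (changed_L \<sigma> \<beta> f L) x y =
    f (exp (\<sigma> (chart_inv c x)) * local_rep A c L x y) (form_comp A c \<beta> x \<bullet> y)"
  by (simp add: local_rep_def changed_L_def one_form_eq[OF \<beta> assms]) (simp add: tpoint_def)

lemma in_\<Omega>_local:
  assumes "c \<in> A" "(x, y) \<in> tcoords A c D"
  shows "(exp (\<sigma> (chart_inv c x)) * local_rep A c L x y, form_comp A c \<beta> x \<bullet> y) \<in> \<Omega>"
    and "f (exp (\<sigma> (chart_inv c x)) * local_rep A c L x y) (form_comp A c \<beta> x \<bullet> y) > 0"
proof -
  have x: "x \<in> snd c ` fst c" and D: "tpoint A c x y \<in> D" using assms(2) by (simp_all add: tcoords_def)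
  show "(exp (\<sigma> (chart_inv c x)) * local_rep A c L x y, form_comp A c \<beta> x \<bullet> y) \<in> \<Omega>"
    using in_\<Omega>[OF D] unfolding one_form_eq[OF \<beta> assms(1) x] by (simp add: local_rep_def tpoint_def)
  have "0 < changed_L \<sigma> \<beta> f L (tpoint A c x y)" using finsler(2) D unfolding finsler_space_def by blast
  then show "f (exp (\<sigma> (chart_inv c x)) * local_rep A c L x y) (form_comp A c \<beta> x \<bullet> y) > 0"
    unfolding local_rep_changed[OF assms(1) x, symmetric] by (simp add: local_rep_def)
qed

lemma slice:
  assumes "c \<in> A"
  shows "beta_change {y. (x, y) \<in> tcoords A c D} (local_rep A c L x) \<Omega> f (\<sigma> (chart_inv c x)) (form_comp A c \<beta> x)"
proof -
  interpret finsler_cone "{y. (x, y) \<in> tcoords A c D}" "local_rep A c L x"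
    by (rule finsler_space_slice[OF finsler(1) assms])
  interpret homogeneous2 \<Omega> f by (rule homogeneous)
  show ?thesis by unfold_locales (use in_\<Omega>_local[OF assms] in auto)
qed

lemma invertible_metric:
  assumes "c \<in> A" "(x, y) \<in> tcoords A c D"
  shows "invertible (metric (local_rep A c L x) y)"
    and "invertible (metric (local_rep A c (changed_L \<sigma> \<beta> f L) x) y)"
  using finsler assms unfolding finsler_space_def by blast+

text \<open>The components in the chosen chart, pulled back by the Jacobian \<open>J\<close> from the chart \<open>c\<close>, are the components in
  \<open>c\<close>: both the Finsler function and the 1-form in \<open>c\<close> are their counterparts composed with \<open>J\<close>.\<close>

lemma reducing_field_local:
  assumes c: "c \<in> A" and xy: "(x, y) \<in> tcoords A c D"
  shows "reducing_field A \<sigma> \<beta> f L (tpoint A c x y) (tvec A c (chart_inv c x) v) (tvec A c (chart_inv c x) w) =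
    v \<bullet> (reducing_tensor f (\<sigma> (chart_inv c x)) (form_comp A c \<beta> x) (local_rep A c L x) y *v w)"
proof -
  define p where "p = chart_inv c x"
  define d where "d = chart_at A p"
  define J where "J = jac c d p"
  have x: "x \<in> snd c ` fst c" and D: "tpoint A c x y \<in> D" using xy by (simp_all add: tcoords_def)
  have pc: "p \<in> fst c" using chart_inv_image(1)[OF x] by (simp add: p_def)
  have "d \<in> A \<and> p \<in> fst d"
    unfolding d_def chart_at_def by (rule someI[of _ c]) (use c pc in simp)
  then have d: "d \<in> A" "p \<in> fst d" by auto
  have point: "tpoint A c x z = tpoint A d (snd d p) (J *v z)" for z
    unfolding J_def by (rule tpoint_change[OF c d(1) x p_def[symmetric] d(2)])
  have xd: "snd d p \<in> snd d ` fst d" using d(2) by simp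
  have comp: "tvec A c p z d = J *v z" for z
    using d by (simp add: tvec_eq[OF c pc] J_def)
  have "(snd d p, J *v y) \<in> tcoords A d D"
    using D xd point by (simp add: tcoords_def)
  then interpret finsler_cone "{y. (snd d p, y) \<in> tcoords A d D}" "local_rep A d L (snd d p)"
    by (intro finsler_space_slice[OF finsler(1) d(1)])
  have Jy: "(snd d p, J *v y) \<in> tcoords A d D" by fact
  have "v \<bullet> (reducing_tensor f (\<sigma> p) (form_comp A c \<beta> x) (local_rep A c L x) y *v w) =
     (J *v v) \<bullet> (reducing_tensor f (\<sigma> p) (form_comp A d \<beta> (snd d p)) (local_rep A d L (snd d p)) (J *v y) *v (J *v w))"
  proof (rule reducing_tensor_compose_linear[OF open_U smooth_F])
    show "J *v y \<in> {y. (snd d p, y) \<in> tcoords A d D}" using Jy by simp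
    show "invertible J" unfolding J_def by (rule invertible_jac[OF c d(1) pc d(2)])
    show "invertible (metric (local_rep A d L (snd d p)) (J *v y))"
      by (rule invertible_metric(1)[OF d(1) Jy])
    show "local_rep A c L x z = local_rep A d L (snd d p) (J *v z)" for z
      by (simp add: local_rep_def point)
    show "form_comp A c \<beta> x \<bullet> z = form_comp A d \<beta> (snd d p) \<bullet> (J *v z)" for z
      using one_form_eq[OF \<beta> c x, of z] one_form_eq[OF \<beta> d(1) xd, of "J *v z"] point by simp
  qed
  moreover have "fst (tpoint A c x y) = p" "snd (tpoint A c x y) d = J *v y"
    using comp by (simp_all add: tpoint_def p_def)
  ultimately show ?thesis
    unfolding reducing_field_def Let_def by (simp add: d_def[symmetric] comp p_def[symmetric])
qed

lemma tensor_comp_reducing_field: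
  assumes c: "c \<in> A" and xy: "(x, y) \<in> tcoords A c D"
  shows "tensor_comp A c (reducing_field A \<sigma> \<beta> f L) x y =
    reducing_tensor f (\<sigma> (chart_inv c x)) (form_comp A c \<beta> x) (local_rep A c L x) y"
  by (simp add: tensor_comp_def reducing_field_local[OF c xy] vec_eq_iff matrix_vector_mult_basis column_def inner_axis')

lemma tensor_field_reducing_field: "tensor_field A D (reducing_field A \<sigma> \<beta> f L)"
proof -
  have "bilinear (\<lambda>v w. reducing_field A \<sigma> \<beta> f L (tpoint A c x y) (tvec A c (chart_inv c x) v) (tvec A c (chart_inv c x) w))"
    if "c \<in> A" "(x, y) \<in> tcoords A c D" for c x y
    unfolding reducing_field_local[OF that] bilinear_def
    by (auto intro!: linearI simp: algebra_simps)
  moreover have "smooth_on (tcoords A c D) (\<lambda>(x, y). tensor_comp A c (reducing_field A \<sigma> \<beta> f L) x y)" if c: "c \<in> A" for c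
  proof (rule smooth_on_cong)
    show W: "open (tcoords A c D)" using finsler(1) c unfolding finsler_space_def by blast
    have fst: "smooth_on (tcoords A c D) fst" by (rule smooth_on_bounded_linear[OF W bounded_linear_fst])
    have base: "smooth_on (tcoords A c D) (\<lambda>(x, y). g x)" if "smooth_on (snd c ` fst c) g" for g :: "_ \<Rightarrow> 'z::real_normed_vector"
      using smooth_on_compose[OF W that fst] tcoords_image by (fastforce simp: case_prod_beta')
    show "smooth_on (tcoords A c D) (\<lambda>(x, y). reducing_tensor f (\<sigma> (chart_inv c x)) (form_comp A c \<beta> x) (local_rep A c L x) y)"
    proof (rule smooth_on_reducing_tensor[OF W _ _ _ homogeneous])
      show "smooth_on (tcoords A c D) (\<lambda>(x, y). local_rep A c L x y)"
        using finsler(1) c unfolding finsler_space_def by blast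
      show "smooth_on (tcoords A c D) (\<lambda>(x, y). \<sigma> (chart_inv c x))"
        using base[of "\<sigma> \<circ> chart_inv c"] \<sigma> c by (simp add: smooth_function_def)
      show "smooth_on (tcoords A c D) (\<lambda>(x, y). form_comp A c \<beta> x)"
        using \<beta> c unfolding one_form_def by (intro base) blast
      fix x y assume xy: "(x, y) \<in> tcoords A c D"
      interpret beta_change "{y. (x, y) \<in> tcoords A c D}" "local_rep A c L x" \<Omega> f "\<sigma> (chart_inv c x)" "form_comp A c \<beta> x"
        by (rule slice[OF c])
      show "local_rep A c L x y \<noteq> 0 \<and> invertible (metric (local_rep A c L x) y) \<and>
         (exp (\<sigma> (chart_inv c x)) * local_rep A c L x y, form_comp A c \<beta> x \<bullet> y) \<in> \<Omega> \<and>
         f (exp (\<sigma> (chart_inv c x)) * local_rep A c L x y) (form_comp A c \<beta> x \<bullet> y) \<noteq> 0 \<and>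
         pc f (\<sigma> (chart_inv c x)) (form_comp A c \<beta> x) (local_rep A c L x) y \<noteq> 0 \<and>
         exp (\<sigma> (chart_inv c x)) * pc f (\<sigma> (chart_inv c x)) (form_comp A c \<beta> x) (local_rep A c L x) y +
         m_sq (form_comp A c \<beta> x) (local_rep A c L x) y * q0 f (\<sigma> (chart_inv c x)) (form_comp A c \<beta> x) (local_rep A c L x) y \<noteq> 0 \<and>
         lam f (\<sigma> (chart_inv c x)) (form_comp A c \<beta> x) (local_rep A c L x) y \<noteq> 0"
        using F_nonzero[of y] xy invertible_metric(1)[OF c xy] in_\<Omega>_local[OF c xy] standing[OF c xy] lam_nonzero[OF c xy]
        by (simp add: Let_def)
    qed
  qed (auto simp: tensor_comp_reducing_field[OF c])
  ultimately show ?thesis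
    unfolding tensor_field_def by blast
qed

end

theorem theorem2p5:
  fixes M :: "'p topology" and A :: "('p, 'n::finite) chart set"
    and D :: "('p \<times> ('p, 'n) tvec) set"
    and L \<beta> :: "'p \<times> ('p, 'n) tvec \<Rightarrow> real" and \<sigma> :: "'p \<Rightarrow> real"
    and \<Omega> :: "(real \<times> real) set" and f :: "real \<Rightarrow> real \<Rightarrow> real"
  assumes dim: "CARD('n) \<ge> 3"
    and change: "gen_beta_conformal_change M A D L \<sigma> \<beta> \<Omega> f"
    and standing: "\<And>c x y. c \<in> A \<Longrightarrow> (x, y) \<in> tcoords A c D \<Longrightarrow>
      let F = local_rep A c L x; b = form_comp A c \<beta> x; s = \<sigma> (chart_inv c x) in
        m_cov b F y \<noteq> 0 \<and> m_sq b F y \<noteq> 0 \<and> pc f s b F y \<noteq> 0 \<and>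
        exp s * pc f s b F y + m_sq b F y * q0 f s b F y \<noteq> 0"
    and lam_nonzero: "\<And>c x y. c \<in> A \<Longrightarrow> (x, y) \<in> tcoords A c D \<Longrightarrow>
      lam f (\<sigma> (chart_inv c x)) (form_comp A c \<beta> x) (local_rep A c L x) y \<noteq> 0"
    and q_vanishes: "\<And>c x y i j k. c \<in> A \<Longrightarrow> (x, y) \<in> tcoords A c D \<Longrightarrow>
      q_tensor f (\<sigma> (chart_inv c x)) (form_comp A c \<beta> x) (local_rep A c L x) y i j k = 0"
  shows "quasi_C_reducible M A D (changed_L \<sigma> \<beta> f L)"
proof -
  interpret G: generalized_beta_change M A D L \<sigma> \<beta> \<Omega> f
    by unfold_locales (fact change, fact standing, fact lam_nonzero)
  let ?Q = "reducing_field A \<sigma> \<beta> f L"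
  have "let F = local_rep A c (changed_L \<sigma> \<beta> f L) x; q = tensor_comp A c ?Q x y in
      (\<forall>i j. q $ i $ j = q $ j $ i) \<and> (\<forall>j. (\<Sum>i\<in>UNIV. q $ i $ j * y $ i) = 0) \<and>
      (\<forall>i j k. cartan F y i j k = q $ i $ j * cartan_trace F y k + q $ j $ k * cartan_trace F y i
         + q $ k $ i * cartan_trace F y j)"
    if c: "c \<in> A" and xy: "(x, y) \<in> tcoords A c D" for c x y
  proof -
    interpret beta_change "{y. (x, y) \<in> tcoords A c D}" "local_rep A c L x" \<Omega> f "\<sigma> (chart_inv c x)" "form_comp A c \<beta> x"
      by (rule G.slice[OF c])
    have y: "y \<in> {y. (x, y) \<in> tcoords A c D}" using xy by simp
    have B: "local_rep A c (changed_L \<sigma> \<beta> f L) x = B"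
      using G.local_rep_changed[OF c tcoords_image[OF xy]] by (auto simp: B_def)
    have nz: "pc f (\<sigma> (chart_inv c x)) (form_comp A c \<beta> x) (local_rep A c L x) y \<noteq> 0"
      "P y + msq y * q0 f (\<sigma> (chart_inv c x)) (form_comp A c \<beta> x) (local_rep A c L x) y \<noteq> 0"
      using standing[OF c xy] by (simp_all add: Let_def)
    show ?thesis
      unfolding Let_def G.tensor_comp_reducing_field[OF c xy] B
      using reducing_tensor_sym[OF y] reducing_tensor_y[OF y]
        cartan_bar_reducible[OF y G.invertible_metric(1)[OF c xy] _ nz lam_nonzero[OF c xy] q_vanishes[OF c xy]]
        G.invertible_metric(2)[OF c xy, unfolded B]
      by auto
  qed
  then show ?thesis
    unfolding quasi_C_reducible_def
    using G.finsler(2) dim G.tensor_field_reducing_field by blast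
qed

end
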